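(* Let $G$ and $H$ be simple directed graphs on $[n]$ and $[m]$, respectively. Assume that $m\geq 2$. Then the following conditions are equivalent. (i) $I_{G\to H}^k$ is weakly polymatroidal for all $k\geq 1$. (ii) $I_{G\to H}^k$ is weakly polymatroidal for some $k\geq 1$. (iii) $I_{G\to H}^k$ has linear quotients for some $k\geq 1$. (iv) $I_{G\to H}^k$ has a linear resolution for some $k\geq 1$. (v) $I_{G\to H}^k$ is linearly related for some $k\geq 1$. (vi) $G$ is totally disconnected, or $G$ is an acyclic graph and $H$ is an acyclic complete graph.
   Context: $[n]=\{1,\dots,n\}$, $n\ge1$. A directed graph is simple if its underlying graph has no loops and no multiple edges (in particular $(x,y)$ and $(y,x)$ are never both edges). It is acyclic if it has no directed cycle as a subgraph, totally disconnected if it has no edges, and complete if its underlying undirected graph is complete. A weak graph homomorphism from $G$ to $H$ is a map $\phi:V(G)\to V(H)$ such that for every $(x,y)\in E(G)$ either $\phi(x)=\phi(y)$ or $(\phi(x),\phi(y))\in E(H)$; the set of these is $\mathrm{WHom}(G,H)$. Let $K$ be a field, $S=K[x_{ij}: i\in[n], j\in[m]]$, $u_\phi=\prod_{i=1}^n x_{i\phi(i)}$ and $I_{G\to H}=(u_\phi:\phi\in\mathrm{WHom}(G,H))\subseteq S$. For a monomial ideal $I$, $\mathcal G(I)$ is its minimal set of monomial generators. $I$ has linear quotients if $\mathcal G(I)$ can be ordered $u_1,\dots,u_r$ so that each $(u_1,\dots,u_{i-1}):u_i$, $i=2,\dots,r$, is generated by a subset of the variables. $I$ is weakly polymatroidal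 if, for a suitable ordering $y_1,\dots,y_t$ of all the variables of $S$, the following holds: for any $u=y_1^{a_1}\cdots y_t^{a_t}$ and $v=y_1^{b_1}\cdots y_t^{b_t}$ in $\mathcal G(I)$ with $a_1=b_1,\dots,a_{r-1}=b_{r-1}$ and $a_r>b_r$ for some $r$, there exists $s>r$ such that $y_s$ divides $v$ and $y_r(v/y_s)\in I$. For $I$ generated in a single degree $d$: $I$ has a linear resolution if $\operatorname{reg} I=d$ (Castelnuovo–Mumford regularity), and is linearly related if the graded Betti numbers satisfy $\beta_{1,j}(I)=0$ for all $j\neq d+1$. *)

theory Defs
  imports
    "HOL-Library.Poly_Mapping"
    "HOL-Library.Extended_Real"
    "Jordan_Normal_Form.Matrix_Kernel"
begin

text \<open>
  Directed graphs are relations on a finite type of vertices. The sets \<open>[n]\<close> and \<open>[m]\<close> are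
  arbitrary (automatically nonempty) types of class \<open>finite\<close>, with \<open>n\<close> and \<open>m\<close> their cardinalities.
  Acyclicity is \<^const>\<open>acyclic\<close> from the distribution.
\<close>

definition simple_digraph :: "('a \<times> 'a) set \<Rightarrow> bool" where
  "simple_digraph E \<longleftrightarrow> irrefl E \<and> (\<forall>x y. (x, y) \<in> E \<longrightarrow> (y, x) \<notin> E)"

definition complete_digraph :: "('a \<times> 'a) set \<Rightarrow> bool" where
  "complete_digraph E \<longleftrightarrow> (\<forall>x y. x \<noteq> y \<longrightarrow> (x, y) \<in> E \<or> (y, x) \<in> E)"

definition totally_disconnected :: "('a \<times> 'a) set \<Rightarrow> bool" where
  "totally_disconnected E \<longleftrightarrow> E = {}"

definition WHom :: "('a \<times> 'a) set \<Rightarrow> ('b \<times> 'b) set \<Rightarrow> ('a \<Rightarrow> 'b) set" where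
  "WHom G H = {\<phi>. \<forall>(x, y) \<in> G. \<phi> x = \<phi> y \<or> (\<phi> x, \<phi> y) \<in> H}"


text \<open>
  For a finite type \<open>'v\<close> of variables, \<open>('v, 'k) mpoly\<close> is the polynomial ring \<open>K[x\<^sub>v : v \<in> 'v]\<close>,
  with multiplication the convolution product of \<^theory>\<open>HOL-Library.Poly_Mapping\<close>.
\<close>

type_synonym 'v monomial = "'v \<Rightarrow>\<^sub>0 nat"
type_synonym ('v, 'k) mpoly = "'v monomial \<Rightarrow>\<^sub>0 'k"

definition mon :: "'v monomial \<Rightarrow> ('v, 'k::comm_ring_1) mpoly" where
  "mon t = Poly_Mapping.single t 1"

definition Var :: "'v \<Rightarrow> ('v, 'k::comm_ring_1) mpoly" where
  "Var v = mon (Poly_Mapping.single v 1)"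

definition mon_degree :: "'v monomial \<Rightarrow> nat" where
  "mon_degree t = (\<Sum>v \<in> Poly_Mapping.keys t. Poly_Mapping.lookup t v)"


text \<open>Ideals of a commutative ring are the submodules of the ring as a module over itself.\<close>

global_interpretation ring_ideal: Modules.module "(*) :: 'a::comm_ring_1 \<Rightarrow> 'a \<Rightarrow> 'a"
  defines ideal_gen = ring_ideal.span
  by standard (simp_all add: algebra_simps)

definition ideal_mult :: "'a::comm_ring_1 set \<Rightarrow> 'a set \<Rightarrow> 'a set" where
  "ideal_mult I J = ideal_gen {a * b | a b. a \<in> I \<and> b \<in> J}"

primrec ideal_power :: "'a::comm_ring_1 set \<Rightarrow> nat \<Rightarrow> 'a set" where
  "ideal_power I 0 = UNIV"
| "ideal_power I (Suc k) = ideal_mult I (ideal_power I k)"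

definition colon :: "'a::comm_ring_1 set \<Rightarrow> 'a \<Rightarrow> 'a set" where
  "colon J f = {g. g * f \<in> J}"

definition whom_ideal ::
    "('n::finite \<times> 'n) set \<Rightarrow> ('m::finite \<times> 'm) set \<Rightarrow> ('n \<times> 'm, 'k::field) mpoly set" where
  "whom_ideal G H = ideal_gen ((\<lambda>\<phi>. \<Prod>i\<in>UNIV. Var (i, \<phi> i)) ` WHom G H)"


text \<open>
  From here on \<open>I\<close> is meant to be a monomial ideal; \<open>mingens I\<close> consists of the exponents of the
  monomials in its (unique) minimal set of monomial generators.
\<close>

definition mingens :: "('v, 'k::field) mpoly set \<Rightarrow> 'v monomial set" where
  "mingens I = (THE B. ideal_gen (mon ` B) = I \<and> (\<forall>C. C \<subset> B \<longrightarrow> ideal_gen (mon ` C) \<noteq> I))"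

definition has_linear_quotients :: "('v::finite, 'k::field) mpoly set \<Rightarrow> bool" where
  "has_linear_quotients I \<longleftrightarrow>
    (\<exists>us. distinct us \<and> set us = mingens I \<and>
      (\<forall>i. 1 \<le> i \<and> i < length us \<longrightarrow>
        (\<exists>V. colon (ideal_gen (mon ` set (take i us))) (mon (us ! i) :: ('v, 'k) mpoly) =
              ideal_gen (Var ` V))))"

definition weakly_polymatroidal :: "('v::finite, 'k::field) mpoly set \<Rightarrow> bool" where
  "weakly_polymatroidal I \<longleftrightarrow>
    (\<exists>ys. distinct ys \<and> set ys = UNIV \<and>
      (\<forall>u \<in> mingens I. \<forall>v \<in> mingens I. \<forall>r < length ys.
        (\<forall>q < r. Poly_Mapping.lookup u (ys ! q) = Poly_Mapping.lookup v (ys ! q)) \<and>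
        Poly_Mapping.lookup u (ys ! r) > Poly_Mapping.lookup v (ys ! r) \<longrightarrow>
        (\<exists>s. r < s \<and> s < length ys \<and> Poly_Mapping.lookup v (ys ! s) > 0 \<and>
          Var (ys ! r) * mon (v - Poly_Mapping.single (ys ! s) 1) \<in> I)))"


text \<open>
  A minimal graded free resolution \<open>\<cdots> \<rightarrow> F\<^sub>1 \<rightarrow> F\<^sub>0 \<rightarrow> I \<rightarrow> 0\<close>. The list \<open>degs i\<close> contains the degrees
  of the basis elements of \<open>F\<^sub>i\<close>, i.e. \<open>F\<^sub>i\<close> is the direct sum of the \<open>S(-d)\<close> for \<open>d\<close> in \<open>degs i\<close>.
  \<open>A 0\<close> is the one-row matrix of the surjection of \<open>F\<^sub>0\<close> onto \<open>I\<close>, and \<open>A (Suc i)\<close> the matrix of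
  \<open>F\<^sub>i\<^sub>+\<^sub>1 \<rightarrow> F\<^sub>i\<close>. The two degree conditions say that these maps are homogeneous of degree 0;
  minimality says that the image of \<open>F\<^sub>i\<^sub>+\<^sub>1\<close> lies in \<open>\<mm> F\<^sub>i\<close> for \<open>\<mm>\<close> the ideal of the variables.
\<close>

definition minimal_free_resolution ::
    "('v, 'k::field) mpoly set \<Rightarrow> (nat \<Rightarrow> nat list) \<times> (nat \<Rightarrow> ('v, 'k) mpoly mat) \<Rightarrow> bool" where
  "minimal_free_resolution I = (\<lambda>(degs, A).
     A 0 \<in> carrier_mat 1 (length (degs 0)) \<and>
     (\<forall>i. A (Suc i) \<in> carrier_mat (length (degs i)) (length (degs (Suc i)))) \<and>
     (\<forall>b < length (degs 0). \<forall>t \<in> Poly_Mapping.keys (A 0 $$ (0, b)). mon_degree t = degs 0 ! b) \<and>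
     (\<forall>i. \<forall>a < length (degs i). \<forall>b < length (degs (Suc i)).
        \<forall>t \<in> Poly_Mapping.keys (A (Suc i) $$ (a, b)).
          degs i ! a + mon_degree t = degs (Suc i) ! b) \<and>
     (\<lambda>v. (A 0 *\<^sub>v v) $ 0) ` carrier_vec (length (degs 0)) = I \<and>
     (\<forall>i. (\<lambda>v. A (Suc i) *\<^sub>v v) ` carrier_vec (length (degs (Suc i))) = mat_kernel (A i)) \<and>
     (\<forall>i. \<forall>a < length (degs i). \<forall>b < length (degs (Suc i)).
        A (Suc i) $$ (a, b) \<in> ideal_gen (range Var)))"

text \<open>
  The graded Betti numbers are read off from a minimal graded free resolution; for a homogeneous
  ideal one exists and is unique up to isomorphism, so the choice is immaterial.
\<close>

definition betti :: "('v::finite, 'k::field) mpoly set \<Rightarrow> nat \<Rightarrow> nat \<Rightarrow> nat" where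
  "betti I i j = count_list (fst (SOME F. minimal_free_resolution I F) i) j"

text \<open>
  Castelnuovo--Mumford regularity as a supremum in the extended reals, so that no finiteness of the
  resolution has to be built into the definition.
\<close>

definition regularity :: "('v::finite, 'k::field) mpoly set \<Rightarrow> ereal" where
  "regularity I = Sup {ereal (real j - real i) | i j. betti I i j \<noteq> 0}"

definition generated_in_degree :: "('v, 'k::field) mpoly set \<Rightarrow> nat \<Rightarrow> bool" where
  "generated_in_degree I d \<longleftrightarrow> (\<forall>u \<in> mingens I. mon_degree u = d)"

definition has_linear_resolution :: "('v::finite, 'k::field) mpoly set \<Rightarrow> bool" where
  "has_linear_resolution I \<longleftrightarrow>
    (\<exists>d. generated_in_degree I d \<and> regularity I = ereal (real d))"

definition linearly_related :: "('v::finite, 'k::field) mpoly set \<Rightarrow> bool" where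
  "linearly_related I \<longleftrightarrow>
    (\<exists>d. generated_in_degree I d \<and> (\<forall>j. j \<noteq> d + 1 \<longrightarrow> betti I 1 j = 0))"

end

theory Submission
  imports Defs "HOL-Library.Function_Algebras"
begin

text \<open>
  If \<open>G\<close> has no edges, or \<open>G\<close> is acyclic and \<open>H\<close> is a transitive tournament, then for some linear
  order on the target the homomorphisms are the maps with \<open>\<phi> x \<le> \<phi> y\<close> on edges. The generators of
  the powers are then described by inequalities between the cumulative row sums of the exponents,
  which yields weak polymatroidality for the row-wise order of the variables. Ordering the generators
  lexicographically turns this into linear quotients. These give a linear resolution because, adding
  one generator at a time, the syzygies of the generators are iterated extensions of ideals generated
  by variables.

  Conversely, if the first syzygies are linear, then no two generators \<open>u\<close>, \<open>v\<close> can be separated by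
  two variables \<open>p \<noteq> q\<close> that have equal exponents in every generator dividing a common multiple of
  \<open>u\<close> and \<open>v\<close>. For \<open>u\<close> and \<open>v\<close> the \<open>k\<close>-th powers of the monomials of two homomorphisms, this rules
  out in turn a pair of nonadjacent vertices of \<open>H\<close>, a directed cycle of \<open>G\<close> and a directed triangle of
  \<open>H\<close>.
\<close>

text \<open>As a simp rule this would loop together with associativity of multiplication.\<close>

declare ring_ideal.scale_scale [simp del]

section \<open>Monomials and monomial ideals\<close>

text \<open>Betti numbers are read off from whichever minimal free resolution the choice operator
  returns. So a resolution is first shown to exist, and the later arguments must apply to an
  arbitrary one, whose first generators need not be monomials. It is compared with the monomial
  generators through the fact that two K-independent homogeneous generating lists of one degree
  differ by an invertible matrix of constants, which carries linear syzygies to linear syzygies.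

  A condition on a single \<open>k\<close> suffices to return to the graphs because the separation
  criterion, applied to \<open>k\<close>-th powers, depends only on the two homomorphisms and not on
  \<open>k\<close>.\<close>

definition mon_dvd :: "('v \<Rightarrow>\<^sub>0 nat) \<Rightarrow> ('v \<Rightarrow>\<^sub>0 nat) \<Rightarrow> bool" where
  "mon_dvd s t \<longleftrightarrow> (\<forall>v. Poly_Mapping.lookup s v \<le> Poly_Mapping.lookup t v)"

lemma mon_dvd_iff_add: "mon_dvd s t \<longleftrightarrow> (\<exists>r. t = s + r)"
proof
  assume "mon_dvd s t"
  hence "t = s + (t - s)"
    by (intro poly_mapping_eqI) (simp add: lookup_add lookup_minus mon_dvd_def)
  thus "\<exists>r. t = s + r" ..
qed (auto simp: mon_dvd_def lookup_add)

lemma mon_dvd_refl [simp]: "mon_dvd s s"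
  by (simp add: mon_dvd_def)

lemma mon_dvd_trans: "mon_dvd r s \<Longrightarrow> mon_dvd s t \<Longrightarrow> mon_dvd r t"
  unfolding mon_dvd_def by (meson le_trans)

lemma mon_degree_eq_sum_UNIV: "mon_degree (t :: ('v::finite) monomial) = (\<Sum>v\<in>UNIV. Poly_Mapping.lookup t v)"
  unfolding mon_degree_def by (rule sum.mono_neutral_left) (auto simp: in_keys_iff)

lemma mon_degree_add: "mon_degree (s + t :: ('v::finite) monomial) = mon_degree s + mon_degree t"
  by (simp add: mon_degree_eq_sum_UNIV lookup_add sum.distrib)

lemma mon_degree_zero [simp]: "mon_degree 0 = 0"
  by (simp add: mon_degree_def)

lemma mon_degree_single [simp]: "mon_degree (Poly_Mapping.single v n) = n"
  by (simp add: mon_degree_def)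

lemma mon_degree_eq_0_iff: "mon_degree (t :: ('v::finite) monomial) = 0 \<longleftrightarrow> t = 0"
  by (auto simp: mon_degree_eq_sum_UNIV intro: poly_mapping_eqI)

lemma mon_degree_eq_1_iff: "mon_degree (t :: ('v::finite) monomial) = 1 \<longleftrightarrow> (\<exists>v. t = Poly_Mapping.single v 1)"
proof
  assume deg: "mon_degree t = 1"
  then obtain v where v: "Poly_Mapping.lookup t v = 1" "\<forall>w. w \<noteq> v \<longrightarrow> Poly_Mapping.lookup t w = 0"
    using sum_eq_1_iff[of "UNIV :: 'v set" "Poly_Mapping.lookup t"] by (auto simp: mon_degree_eq_sum_UNIV)
  hence "t = Poly_Mapping.single v 1"
    by (intro poly_mapping_eqI) (auto simp: lookup_single when_def)
  thus "\<exists>v. t = Poly_Mapping.single v 1" ..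
qed auto

lemma mon_dvd_eqI:
  fixes s t :: "('v::finite) monomial"
  assumes "mon_dvd s t" and "mon_degree s = mon_degree t"
  shows "s = t"
proof -
  obtain r where "t = s + r" using assms(1) by (auto simp: mon_dvd_iff_add)
  with assms(2) show ?thesis by (simp add: mon_degree_add mon_degree_eq_0_iff)
qed

definition mon_of_fun :: "('v \<Rightarrow> nat) \<Rightarrow> ('v::finite) monomial" where
  "mon_of_fun f = Abs_poly_mapping f"

lemma lookup_mon_of_fun [simp]: "Poly_Mapping.lookup (mon_of_fun f) = f"
  by (simp add: mon_of_fun_def)

lemma mon_of_fun_lookup [simp]: "mon_of_fun (Poly_Mapping.lookup t) = t"
  by (simp add: mon_of_fun_def)

text \<open>Bounds the set of multidegrees in which syzygies have to be generated.\<close>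

lemma finite_mon_dvd: "finite {c :: ('v::finite) monomial. mon_dvd c L}"
proof -
  have "{c. mon_dvd c L} \<subseteq> mon_of_fun ` (\<Pi>\<^sub>E v\<in>UNIV. {..Poly_Mapping.lookup L v})"
  proof
    fix c assume "c \<in> {c. mon_dvd c L}"
    hence "Poly_Mapping.lookup c \<in> (\<Pi>\<^sub>E v\<in>UNIV. {..Poly_Mapping.lookup L v})"
      by (simp add: mon_dvd_def PiE_UNIV_domain)
    thus "c \<in> mon_of_fun ` (\<Pi>\<^sub>E v\<in>UNIV. {..Poly_Mapping.lookup L v})"
      by (metis imageI mon_of_fun_lookup)
  qed
  thus ?thesis by (rule finite_subset) (intro finite_imageI finite_PiE, auto)
qed

section \<open>Membership in monomial ideals\<close>

lemma lookup_mon_mult: "Poly_Mapping.lookup (mon s * f) (s + t) = Poly_Mapping.lookup f t"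
proof -
  have "Poly_Mapping.lookup (mon s * f) (s + t)
        = (\<Sum>l. (1 when s = l) * (\<Sum>q. Poly_Mapping.lookup f q when s + t = l + q))"
    by (simp add: lookup_mult mon_def lookup_single)
  also have "\<dots> = (\<Sum>l. (\<Sum>q. Poly_Mapping.lookup f q when s + t = l + q) when l = s)"
    by (rule Sum_any.cong) (auto simp: when_def)
  also have "\<dots> = (\<Sum>q. Poly_Mapping.lookup f q when s + t = s + q)"
    by (rule Sum_any_when_equal)
  also have "\<dots> = (\<Sum>q. Poly_Mapping.lookup f q when q = t)"
    by (rule Sum_any.cong) (auto simp: when_def)
  finally show ?thesis by simp
qed

lemma poly_eq_sum_single:
  "f = (\<Sum>t\<in>Poly_Mapping.keys f. Poly_Mapping.single t (Poly_Mapping.lookup f t))"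
proof (rule poly_mapping_eqI)
  fix k
  show "Poly_Mapping.lookup f k
     = Poly_Mapping.lookup (\<Sum>t\<in>Poly_Mapping.keys f. Poly_Mapping.single t (Poly_Mapping.lookup f t)) k"
    by (auto simp: lookup_sum lookup_single when_def sum.delta in_keys_iff)
qed

lemma mon_mult_eq_0_iff: "mon s * f = 0 \<longleftrightarrow> f = 0"
proof
  assume "mon s * f = 0"
  show "f = 0"
    by (rule poly_mapping_eqI) (metis \<open>mon s * f = 0\<close> lookup_mon_mult lookup_zero)
qed simp

lemma mon_mult: "mon s * mon t = mon (s + t)"
  by (simp add: mon_def mult_single)

lemma mon_0: "mon 0 = 1"
  by (simp add: mon_def)

lemma keys_mon [simp]: "Poly_Mapping.keys (mon t :: ('v, 'k::comm_ring_1) mpoly) = {t}"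
  by (simp add: mon_def)

lemma lookup_mon: "Poly_Mapping.lookup (mon t) s = (if s = t then 1 else 0)"
  by (auto simp: mon_def lookup_single when_def)

lemma ideal_gen_mult: "f \<in> ideal_gen X \<Longrightarrow> c * f \<in> ideal_gen X"
  by (rule ring_ideal.span_scale)

lemma keys_sum: "Poly_Mapping.keys (sum f A) \<subseteq> (\<Union>a\<in>A. Poly_Mapping.keys (f a))"
  by (induction A rule: infinite_finite_induct) (use keys_add in fastforce)+

text \<open>The polynomials all of whose terms are divisible by an element of \<open>B\<close> form
  an ideal containing the generators; conversely each such term is a multiple of a generator.
  Membership thus becomes a question about exponents, for finite or infinite
  \<open>B\<close>.\<close>

lemma monomial_ideal_iff:
  fixes f :: "('v, 'k::comm_ring_1) mpoly"
  shows "f \<in> ideal_gen (mon ` B) \<longleftrightarrow> (\<forall>t\<in>Poly_Mapping.keys f. \<exists>b\<in>B. mon_dvd b t)"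
proof
  assume "f \<in> ideal_gen (mon ` B)"
  thus "\<forall>t\<in>Poly_Mapping.keys f. \<exists>b\<in>B. mon_dvd b t"
  proof (induction rule: ring_ideal.span_induct_alt)
    case base thus ?case by simp
  next
    case (step c x y)
    from step(1) obtain b where b: "b \<in> B" "x = mon b" by auto
    have "Poly_Mapping.keys (c * x + y) \<subseteq> {s + b | s. True} \<union> Poly_Mapping.keys y"
      using keys_add[of "c * x" y] keys_mult[of c x] b(2) by auto
    moreover have "mon_dvd b (s + b)" for s by (auto simp: mon_dvd_def lookup_add)
    ultimately show ?case using step b(1) by blast
  qed
next
  assume *: "\<forall>t\<in>Poly_Mapping.keys f. \<exists>b\<in>B. mon_dvd b t"
  have "Poly_Mapping.single t (Poly_Mapping.lookup f t) \<in> ideal_gen (mon ` B)"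
    if t: "t \<in> Poly_Mapping.keys f" for t
  proof -
    obtain b where "b \<in> B" "mon_dvd b t" using * t by blast
    then obtain r where b: "b \<in> B" "t = b + r" by (metis mon_dvd_iff_add)
    hence "Poly_Mapping.single t (Poly_Mapping.lookup f t)
           = Poly_Mapping.single r (Poly_Mapping.lookup f t) * mon b"
      by (simp add: mon_def mult_single add.commute)
    moreover have "(mon b :: ('v, 'k) mpoly) \<in> ideal_gen (mon ` B)" using b(1) by (intro ring_ideal.span_base imageI)
    ultimately show ?thesis by (simp add: ideal_gen_mult)
  qed
  thus "f \<in> ideal_gen (mon ` B)"
    by (subst poly_eq_sum_single) (auto intro: ring_ideal.span_sum)
qed

lemma mon_in_monomial_ideal_iff:
  "(mon t :: ('v, 'k::comm_ring_1) mpoly) \<in> ideal_gen (mon ` B) \<longleftrightarrow> (\<exists>b\<in>B. mon_dvd b t)"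
  by (simp add: monomial_ideal_iff)

lemma Var_image: "Var ` V = mon ` (\<lambda>v. Poly_Mapping.single v 1) ` V"
  by (simp add: Var_def image_image)

lemma mon_dvd_single_iff: "mon_dvd (Poly_Mapping.single v (Suc 0)) t \<longleftrightarrow> Poly_Mapping.lookup t v > 0"
  by (auto simp: mon_dvd_def lookup_single when_def)

lemma var_ideal_iff:
  fixes f :: "('v, 'k::comm_ring_1) mpoly"
  shows "f \<in> ideal_gen (Var ` V) \<longleftrightarrow> (\<forall>t\<in>Poly_Mapping.keys f. \<exists>v\<in>V. Poly_Mapping.lookup t v > 0)"
  unfolding Var_image by (simp add: monomial_ideal_iff mon_dvd_single_iff)

text \<open>Turns the minimality condition of a resolution into the vanishing of constant
  terms.\<close>

lemma max_ideal_iff: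
  fixes f :: "('v, 'k::comm_ring_1) mpoly"
  shows "f \<in> ideal_gen (range Var) \<longleftrightarrow> Poly_Mapping.lookup f 0 = 0"
proof -
  have "(\<exists>v. Poly_Mapping.lookup t v > 0) \<longleftrightarrow> t \<noteq> 0" for t :: "'v monomial"
    by (metis gr0I lookup_zero poly_mapping_eqI bot_nat_0.not_eq_extremum)
  thus ?thesis by (auto simp: var_ideal_iff in_keys_iff)
qed

text \<open>Equal degrees make \<open>B\<close> an antichain for divisibility, so dropping a
  generator shrinks the ideal. A competing minimal set \<open>B'\<close>, whose degrees are unknown,
  contains \<open>B\<close>: an element of \<open>B'\<close> dividing \<open>b\<close> is itself
  divisible by an element of \<open>B\<close>, which can only be \<open>b\<close>.\<close>

lemma mingens_monomial_ideal:
  fixes B :: "('v::finite) monomial set"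
  assumes deg: "\<And>b. b \<in> B \<Longrightarrow> mon_degree b = d"
  shows "mingens (ideal_gen (mon ` B) :: ('v, 'k::field) mpoly set) = B"
  unfolding mingens_def
proof (rule the_equality)
  have "ideal_gen (mon ` C :: ('v, 'k) mpoly set) \<noteq> ideal_gen (mon ` B)" if "C \<subset> B" for C
  proof
    assume eq: "ideal_gen (mon ` C :: ('v, 'k) mpoly set) = ideal_gen (mon ` B)"
    from that obtain b where b: "b \<in> B" "b \<notin> C" by auto
    hence "(mon b :: ('v, 'k) mpoly) \<in> ideal_gen (mon ` C)"
      unfolding eq by (auto intro: ring_ideal.span_base)
    then obtain c where "c \<in> C" "mon_dvd c b" by (auto simp: mon_in_monomial_ideal_iff)
    thus False using b that deg mon_dvd_eqI by (metis psubsetD)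
  qed
  thus "ideal_gen (mon ` B) = ideal_gen (mon ` B :: ('v, 'k) mpoly set) \<and>
    (\<forall>C. C \<subset> B \<longrightarrow> ideal_gen (mon ` C) \<noteq> ideal_gen (mon ` B :: ('v, 'k) mpoly set))"
    by auto
next
  fix B'
  assume B': "ideal_gen (mon ` B') = ideal_gen (mon ` B :: ('v, 'k) mpoly set) \<and>
    (\<forall>C. C \<subset> B' \<longrightarrow> ideal_gen (mon ` C) \<noteq> ideal_gen (mon ` B :: ('v, 'k) mpoly set))"
  have "B \<subseteq> B'"
  proof
    fix b assume b: "b \<in> B"
    hence "(mon b :: ('v, 'k) mpoly) \<in> ideal_gen (mon ` B')"
      using B' by (auto intro: ring_ideal.span_base)
    then obtain b' where b': "b' \<in> B'" "mon_dvd b' b" by (auto simp: mon_in_monomial_ideal_iff)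
    hence "(mon b' :: ('v, 'k) mpoly) \<in> ideal_gen (mon ` B)"
      using B' by (metis image_eqI ring_ideal.span_base)
    then obtain b'' where b'': "b'' \<in> B" "mon_dvd b'' b'" by (auto simp: mon_in_monomial_ideal_iff)
    have "b'' = b" using b b' b'' deg mon_dvd_eqI mon_dvd_trans by metis
    hence "b = b'" using b' b'' by (intro poly_mapping_eqI) (simp add: mon_dvd_def eq_iff)
    thus "b \<in> B'" using b' by simp
  qed
  thus "B' = B" using B' by blast
qed

section \<open>Products and powers of monomial ideals\<close>

lemma ideal_gen_mult_ideal_gen:
  "ideal_mult (ideal_gen X) (ideal_gen Y) = ideal_gen {x * y | x y. x \<in> X \<and> y \<in> Y}" (is "_ = ?R")
proof
  have "a * b \<in> ?R" if "a \<in> ideal_gen X" "b \<in> ideal_gen Y" for a b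
    using that(1)
  proof (induction rule: ring_ideal.span_induct_alt)
    case base thus ?case by (simp add: ring_ideal.span_zero)
  next
    case (step c x y)
    have "x * b \<in> ?R" using that(2)
    proof (induction rule: ring_ideal.span_induct_alt)
      case base thus ?case by (simp add: ring_ideal.span_zero)
    next
      case (step c' x' y')
      have "c' * (x * x') \<in> ?R" using step \<open>x \<in> X\<close>
        by (intro ideal_gen_mult ring_ideal.span_base) blast
      from ring_ideal.span_add[OF this step(2)] have "c' * (x * x') + x * y' \<in> ?R" .
      moreover have "x * (c' * x' + y') = c' * (x * x') + x * y'" by (simp add: algebra_simps)
      ultimately show ?case by (simp only:)
    qed
    hence "c * (x * b) \<in> ?R" by (rule ideal_gen_mult)
    from ring_ideal.span_add[OF this step(2)] have "c * (x * b) + y * b \<in> ?R" .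
    moreover have "(c * x + y) * b = c * (x * b) + y * b" by (simp add: algebra_simps)
    ultimately show ?case by (simp only:)
  qed
  thus "ideal_mult (ideal_gen X) (ideal_gen Y) \<subseteq> ?R"
    unfolding ideal_mult_def by (intro ring_ideal.span_minimal) auto
  show "?R \<subseteq> ideal_mult (ideal_gen X) (ideal_gen Y)"
    unfolding ideal_mult_def
    by (rule ring_ideal.span_mono) (blast intro: ring_ideal.span_base)
qed

primrec sum_power :: "'a::comm_monoid_add set \<Rightarrow> nat \<Rightarrow> 'a set" where
  "sum_power B 0 = {0}"
| "sum_power B (Suc k) = {s + t | s t. s \<in> B \<and> t \<in> sum_power B k}"

lemma ideal_power_monomial:
  "ideal_power (ideal_gen (mon ` B) :: ('v, 'k::comm_ring_1) mpoly set) k = ideal_gen (mon ` sum_power B k)"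
proof (induction k)
  case 0
  have "f \<in> ideal_gen (mon ` {0})" for f :: "('v, 'k) mpoly"
    by (auto simp only: monomial_ideal_iff) (auto simp: mon_dvd_def)
  thus ?case by auto
next
  case (Suc k)
  have "{x * y | x y. x \<in> mon ` B \<and> y \<in> mon ` sum_power B k} = (mon ` sum_power B (Suc k) :: ('v, 'k) mpoly set)"
    by (auto simp: mon_mult image_iff) (metis mon_mult)+
  thus ?case using Suc by (simp add: ideal_gen_mult_ideal_gen)
qed

lemma finite_sum_power: "finite B \<Longrightarrow> finite (sum_power B k)"
proof (induction k)
  case (Suc k)
  have "sum_power B (Suc k) = (\<lambda>(s, t). s + t) ` (B \<times> sum_power B k)" by auto
  with Suc show ?case by simp
qed simp

section \<open>Weakly polymatroidal ideals have linear quotients\<close>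

text \<open>A linear extension of a finite acyclic relation, used for the lexicographic order of
  generators and for the vertices of both graphs.\<close>

lemma finite_acyclic_rank:
  assumes "finite A" and "acyclic R"
  obtains f :: "'a \<Rightarrow> nat"
  where "inj_on f A" and "\<And>x y. x \<in> A \<Longrightarrow> y \<in> A \<Longrightarrow> (x, y) \<in> R \<Longrightarrow> f x < f y"
proof -
  obtain e :: "'a \<Rightarrow> nat" and N where e: "e ` A = {i. i < N}" "inj_on e A"
    using finite_imp_inj_to_nat_seg[OF assms(1)] by auto
  define h where "h x = card {z \<in> A. (z, x) \<in> R\<^sup>+}" for x
  \<comment> \<open>The number of proper predecessors grows strictly along edges; the injective
    numbering \<open>e\<close>, with values below \<open>N\<close>, breaks ties.\<close>
  define f where "f x = h x * N + e x" for x
  have less: "e x < N" if "x \<in> A" for x using e that by auto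
  have "f x mod N = e x" if "x \<in> A" for x using less[OF that] by (simp add: f_def)
  hence "inj_on f A" using e(2) unfolding inj_on_def by metis
  moreover have "f x < f y" if "x \<in> A" "y \<in> A" "(x, y) \<in> R" for x y
  proof -
    have "x \<notin> {z \<in> A. (z, x) \<in> R\<^sup>+}" using assms(2) by (auto simp: acyclic_def)
    moreover have "{z \<in> A. (z, x) \<in> R\<^sup>+} \<subseteq> {z \<in> A. (z, y) \<in> R\<^sup>+}"
      using that by (auto intro: trancl_into_trancl)
    moreover have "x \<in> {z \<in> A. (z, y) \<in> R\<^sup>+}" using that by auto
    ultimately have "h x < h y"
      unfolding h_def using assms(1) by (intro psubset_card_mono) auto
    hence "(h x + 1) * N \<le> h y * N" by (intro mult_le_mono1) simp
    thus ?thesis using less[OF that(1)] by (simp add: f_def)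
  qed
  ultimately show thesis using that by blast
qed

lemma finite_list_by_rank:
  fixes h :: "'a \<Rightarrow> nat"
  assumes "finite A" and "inj_on h A"
  obtains xs where "distinct xs" and "set xs = A"
    and "\<And>i j. i < length xs \<Longrightarrow> j < length xs \<Longrightarrow> h (xs ! i) < h (xs ! j) \<longleftrightarrow> i < j"
proof -
  define ns where "ns = sorted_list_of_set (h ` A)"
  define xs where "xs = map (inv_into A h) ns"
  have ns: "set ns = h ` A" "sorted_wrt (<) ns" "distinct ns"
    using assms by (auto simp: ns_def)
  have h: "h (xs ! i) = ns ! i" if "i < length ns" for i
    using that ns(1) nth_mem[OF that] by (auto simp: xs_def f_inv_into_f)
  have set: "set xs = A"
    using assms ns(1) by (auto simp: xs_def image_image)
  have "distinct xs"
    using ns assms(2) by (auto simp: xs_def distinct_map inj_on_def inv_into_injective)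
  moreover have "h (xs ! i) < h (xs ! j) \<longleftrightarrow> i < j" if "i < length xs" "j < length xs" for i j
  proof -
    have l: "i < length ns" "j < length ns" using that by (auto simp: xs_def)
    show ?thesis
      using sorted_wrt_nth_less[OF ns(2), of i j] sorted_wrt_nth_less[OF ns(2), of j i] l h
      by (cases i j rule: linorder_cases) auto
  qed
  ultimately show thesis using set that by blast
qed

text \<open>Multiplication by a monomial translates exponents injectively, so no terms cancel and
  the colon ideal is again decided term by term.\<close>

lemma colon_monomial_iff:
  fixes f :: "('v, 'k::comm_ring_1) mpoly"
  shows "f \<in> colon (ideal_gen (mon ` B)) (mon u) \<longleftrightarrow>
    (\<forall>t\<in>Poly_Mapping.keys f. \<exists>b\<in>B. mon_dvd b (u + t))"
proof -
  have "Poly_Mapping.keys (mon u * f) = (+) u ` Poly_Mapping.keys f"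
  proof
    show "Poly_Mapping.keys (mon u * f) \<subseteq> (+) u ` Poly_Mapping.keys f"
      using keys_mult[of "mon u" f] by auto
  qed (auto simp: in_keys_iff lookup_mon_mult)
  thus ?thesis by (simp add: colon_def monomial_ideal_iff mult.commute)
qed

text \<open>Lexicographically larger generators come first. If an earlier \<open>w\<close> divides
  the product of \<open>u\<close> and \<open>t\<close>, let \<open>y\<close> be the variable of the
  first difference. The exchange property replaces a later variable of \<open>u\<close> by
  \<open>y\<close>; the result is an earlier generator dividing \<open>u\<close> times
  \<open>y\<close>, and \<open>y\<close> divides \<open>t\<close>. So the colon ideal is generated
  by such variables.\<close>

lemma weakly_polymatroidal_imp_linear_quotients:
  fixes B :: "('v::finite) monomial set"
  assumes fin: "finite B" and deg: "\<And>b. b \<in> B \<Longrightarrow> mon_degree b = d"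
    and wp: "weakly_polymatroidal (ideal_gen (mon ` B) :: ('v, 'k::field) mpoly set)"
  shows "has_linear_quotients (ideal_gen (mon ` B) :: ('v, 'k) mpoly set)"
proof -
  have mg: "mingens (ideal_gen (mon ` B) :: ('v, 'k) mpoly set) = B"
    using deg by (rule mingens_monomial_ideal)
  from wp[unfolded weakly_polymatroidal_def mg] obtain ys where
    *: "distinct ys \<and> set ys = (UNIV :: 'v set) \<and>
      (\<forall>u\<in>B. \<forall>v\<in>B. \<forall>r < length ys.
        (\<forall>q < r. Poly_Mapping.lookup u (ys ! q) = Poly_Mapping.lookup v (ys ! q)) \<and>
        Poly_Mapping.lookup u (ys ! r) > Poly_Mapping.lookup v (ys ! r) \<longrightarrow>
        (\<exists>s. r < s \<and> s < length ys \<and> Poly_Mapping.lookup v (ys ! s) > 0 \<and>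
          Var (ys ! r) * mon (v - Poly_Mapping.single (ys ! s) 1) \<in> (ideal_gen (mon ` B) :: ('v, 'k) mpoly set)))"
    by (elim exE)
  note ys = conjunct1[OF *] conjunct1[OF conjunct2[OF *]]
  note exch = conjunct2[OF conjunct2[OF *], rule_format]
  define lex where "lex u v \<longleftrightarrow> (\<exists>r < length ys.
     (\<forall>q < r. Poly_Mapping.lookup u (ys ! q) = Poly_Mapping.lookup v (ys ! q)) \<and>
     Poly_Mapping.lookup u (ys ! r) > Poly_Mapping.lookup v (ys ! r))" for u v :: "'v monomial"
  have lex_irrefl: "\<not> lex u u" for u by (auto simp: lex_def)
  have lex_trans: "lex u w" if uv: "lex u v" and vw: "lex v w" for u v w
  proof -
    obtain r where r: "r < length ys"
      "\<forall>q < r. Poly_Mapping.lookup u (ys ! q) = Poly_Mapping.lookup v (ys ! q)"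
      "Poly_Mapping.lookup u (ys ! r) > Poly_Mapping.lookup v (ys ! r)"
      using uv unfolding lex_def by blast
    obtain r' where r': "r' < length ys"
      "\<forall>q < r'. Poly_Mapping.lookup v (ys ! q) = Poly_Mapping.lookup w (ys ! q)"
      "Poly_Mapping.lookup v (ys ! r') > Poly_Mapping.lookup w (ys ! r')"
      using vw unfolding lex_def by blast
    show ?thesis unfolding lex_def
    proof (rule exI[of _ "min r r'"], intro conjI)
      show "Poly_Mapping.lookup w (ys ! min r r') < Poly_Mapping.lookup u (ys ! min r r')"
        using r r' by (cases r r' rule: linorder_cases) (auto simp: min_def)
    qed (use r r' in auto)
  qed
  have lex_total: "lex u v \<or> lex v u" if "u \<noteq> v" for u v
  proof -
    obtain p where "Poly_Mapping.lookup u p \<noteq> Poly_Mapping.lookup v p"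
      using \<open>u \<noteq> v\<close> by (metis poly_mapping_eqI)
    moreover obtain r0 where "r0 < length ys" "ys ! r0 = p"
      using ys(2) by (metis UNIV_I in_set_conv_nth)
    ultimately have "\<exists>r. r < length ys \<and> Poly_Mapping.lookup u (ys ! r) \<noteq> Poly_Mapping.lookup v (ys ! r)"
      by blast
    then obtain r where r: "r < length ys" "Poly_Mapping.lookup u (ys ! r) \<noteq> Poly_Mapping.lookup v (ys ! r)"
      "\<And>q. q < r \<Longrightarrow> \<not> (q < length ys \<and> Poly_Mapping.lookup u (ys ! q) \<noteq> Poly_Mapping.lookup v (ys ! q))"
      using exists_least_iff[of "\<lambda>r. r < length ys \<and> Poly_Mapping.lookup u (ys ! r) \<noteq> Poly_Mapping.lookup v (ys ! r)"]
      by auto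
    have "Poly_Mapping.lookup u (ys ! q) = Poly_Mapping.lookup v (ys ! q)" if "q < r" for q
      using r(1) r(3)[OF that] that by simp
    with r(1,2) show ?thesis unfolding lex_def
      by (cases "Poly_Mapping.lookup u (ys ! r) < Poly_Mapping.lookup v (ys ! r)") force+
  qed
  have "trans {(u, v). lex u v}" using lex_trans by (auto intro: transI)
  hence "acyclic {(u, v). lex u v}"
    using lex_irrefl by (simp add: acyclic_def trancl_id)
  then obtain h :: "'v monomial \<Rightarrow> nat" where h: "inj_on h B"
    "\<And>x y. x \<in> B \<Longrightarrow> y \<in> B \<Longrightarrow> lex x y \<Longrightarrow> h x < h y"
    using finite_acyclic_rank[OF fin, of "{(u, v). lex u v}"] by auto
  obtain us where us: "distinct us" "set us = B"
    "\<And>i j. i < length us \<Longrightarrow> j < length us \<Longrightarrow> h (us ! i) < h (us ! j) \<longleftrightarrow> i < j"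
    using finite_list_by_rank[OF fin h(1)] by metis
  have h_iff: "h x < h y \<longleftrightarrow> lex x y" if "x \<in> B" "y \<in> B" for x y
    using h(2)[OF that] h(2)[OF that(2,1)] lex_total[of x y] by fastforce
  have prev: "set (take i us) = {w \<in> B. lex w (us ! i)}" if i: "i < length us" for i
  proof -
    have lex: "lex (us ! j) (us ! i) \<longleftrightarrow> j < i" if "j < length us" for j
      using h_iff[of "us ! j" "us ! i"] us(2,3) i that by auto
    have "set (take i us) = (!) us ` {..<i}"
      using i nth_image[of i us] by (simp add: atLeast0LessThan)
    also have "{..<i} = {j. j < length us \<and> lex (us ! j) (us ! i)}"
      using lex i by auto
    also have "(!) us ` \<dots> = {w \<in> B. lex w (us ! i)}"
      using us(2) by (auto simp: in_set_conv_nth)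
    finally show ?thesis .
  qed
  have "\<exists>V. colon (ideal_gen (mon ` set (take i us))) (mon (us ! i) :: ('v, 'k) mpoly) = ideal_gen (Var ` V)"
    if i: "i < length us" for i
  proof -
    define u where "u = us ! i"
    define P where "P = {w \<in> B. lex w u}"
    define V where "V = {p. \<exists>w\<in>P. mon_dvd w (u + Poly_Mapping.single p 1)}"
    have u: "u \<in> B" using i us(2) by (auto simp: u_def)
    have "(\<exists>w\<in>P. mon_dvd w (u + t)) \<longleftrightarrow> (\<exists>p\<in>V. Poly_Mapping.lookup t p > 0)" for t
    proof
      assume "\<exists>w\<in>P. mon_dvd w (u + t)"
      then obtain w where w: "w \<in> B" "lex w u" "mon_dvd w (u + t)" by (auto simp: P_def)
      then obtain r where r: "r < length ys"
        "\<forall>q < r. Poly_Mapping.lookup w (ys ! q) = Poly_Mapping.lookup u (ys ! q)"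
        "Poly_Mapping.lookup w (ys ! r) > Poly_Mapping.lookup u (ys ! r)"
        unfolding lex_def by blast
      obtain s where s: "r < s" "s < length ys" "Poly_Mapping.lookup u (ys ! s) > 0"
        and mem: "Var (ys ! r) * mon (u - Poly_Mapping.single (ys ! s) 1) \<in> (ideal_gen (mon ` B) :: ('v, 'k) mpoly set)"
        using exch[OF w(1) u r(1) conjI[OF r(2,3)]] by (elim exE conjE)
      define w' where "w' = Poly_Mapping.single (ys ! r) 1 + (u - Poly_Mapping.single (ys ! s) 1)"
      have uw': "u = Poly_Mapping.single (ys ! s) 1 + (u - Poly_Mapping.single (ys ! s) 1)"
        using s(3) by (intro poly_mapping_eqI) (auto simp: lookup_add lookup_minus lookup_single when_def)
      have "mon_degree w' = mon_degree u"
        by (subst uw') (simp add: w'_def mon_degree_add)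
      moreover obtain b where "b \<in> B" "mon_dvd b w'"
        using mem by (auto simp: Var_def mon_mult mon_in_monomial_ideal_iff w'_def)
      \<comment> \<open>All generators have the degree of \<open>w'\<close>, so a generator dividing
        \<open>w'\<close> equals it.\<close>
      ultimately have "w' \<in> B" using mon_dvd_eqI deg u by metis
      have ne: "ys ! s \<noteq> ys ! q" if "q \<le> r" for q
        using that s(1,2) ys(1) by (simp add: nth_eq_iff_index_eq)
      have "ys ! r \<noteq> ys ! q" if "q < r" for q
        using that r(1) ys(1) by (simp add: nth_eq_iff_index_eq)
      hence "Poly_Mapping.lookup w' (ys ! q) = Poly_Mapping.lookup u (ys ! q)" if "q < r" for q
        using that ne[of q] by (simp add: w'_def lookup_add lookup_minus lookup_single when_def)
      moreover have "Poly_Mapping.lookup w' (ys ! r) > Poly_Mapping.lookup u (ys ! r)"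
        using ne[of r] by (simp add: w'_def lookup_add lookup_minus lookup_single when_def)
      ultimately have "lex w' u"
        unfolding lex_def using r(1) by blast
      moreover have "mon_dvd w' (u + Poly_Mapping.single (ys ! r) 1)"
        by (auto simp: w'_def mon_dvd_def lookup_add lookup_minus)
      ultimately have "ys ! r \<in> V" using \<open>w' \<in> B\<close> by (auto simp: V_def P_def)
      \<comment> \<open>The exponent of \<open>w\<close> at this variable exceeds that of
        \<open>u\<close>, and \<open>w\<close> divides \<open>u + t\<close>.\<close>
      moreover have "Poly_Mapping.lookup t (ys ! r) > 0"
        using w(3) r(3) by (auto simp: mon_dvd_def lookup_add dest: spec[of _ "ys ! r"])
      ultimately show "\<exists>p\<in>V. Poly_Mapping.lookup t p > 0" ..
    next
      assume "\<exists>p\<in>V. Poly_Mapping.lookup t p > 0"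
      then obtain p w where p: "Poly_Mapping.lookup t p > 0" "w \<in> P" "mon_dvd w (u + Poly_Mapping.single p 1)"
        by (auto simp: V_def)
      moreover have "mon_dvd (u + Poly_Mapping.single p 1) (u + t)"
        using p(1) by (auto simp: mon_dvd_def lookup_add lookup_single when_def)
      ultimately show "\<exists>w\<in>P. mon_dvd w (u + t)" using mon_dvd_trans by blast
    qed
    hence "colon (ideal_gen (mon ` P)) (mon u :: ('v, 'k) mpoly) = ideal_gen (Var ` V)"
      by (simp add: set_eq_iff colon_monomial_iff var_ideal_iff)
    thus ?thesis unfolding prev[OF i] u_def[symmetric] P_def[symmetric] by blast
  qed
  thus ?thesis
    unfolding has_linear_quotients_def mg using us(1,2) by blast
qed

section \<open>Powers of ideals of weak homomorphisms into a transitive tournament\<close>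

definition whom_mon :: "('n::finite \<Rightarrow> 'm) \<Rightarrow> ('n \<times> 'm) monomial" where
  "whom_mon \<phi> = (\<Sum>i\<in>UNIV. Poly_Mapping.single (i, \<phi> i) 1)"

lemma lookup_whom_mon: "Poly_Mapping.lookup (whom_mon \<phi>) (i, j) = (if \<phi> i = j then 1 else 0)"
proof -
  have "Poly_Mapping.lookup (whom_mon \<phi>) (i, j) = (\<Sum>i'\<in>UNIV. if i' = i then (if \<phi> i = j then 1 else 0) else 0)"
    unfolding whom_mon_def lookup_sum by (rule sum.cong) (auto simp: lookup_single when_def)
  thus ?thesis by simp
qed

lemma prod_Var_eq_mon: "finite A \<Longrightarrow> (\<Prod>i\<in>A. Var (h i)) = mon (\<Sum>i\<in>A. Poly_Mapping.single (h i) 1)"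
  by (induction A rule: finite_induct) (simp_all add: mon_0 Var_def mon_mult)

lemma whom_ideal_eq: "whom_ideal G H = ideal_gen (mon ` whom_mon ` WHom G H)"
  by (simp add: whom_ideal_def prod_Var_eq_mon whom_mon_def image_image)

lemma whom_ideal_power:
  "ideal_power (whom_ideal G H) k = ideal_gen (mon ` sum_power (whom_mon ` WHom G H) k)"
  by (simp add: whom_ideal_eq ideal_power_monomial)

lemma mon_degree_whom_mon: "mon_degree (whom_mon \<phi> :: ('n::finite \<times> 'm::finite) monomial) = card (UNIV :: 'n set)"
proof -
  have "mon_degree (sum h A) = (\<Sum>i\<in>A. mon_degree (h i))" for h :: "'n \<Rightarrow> ('n \<times> 'm) monomial" and A
    by (induction A rule: infinite_finite_induct) (simp_all add: mon_degree_add)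
  thus ?thesis by (simp add: whom_mon_def)
qed

text \<open>Degrees, row sums and cumulative sums are additive in the exponent, so identities, and
  with the next lemma inequalities, pass from generators to \<open>k\<close>-fold products.\<close>

lemma sum_power_additive:
  assumes "s \<in> sum_power B k" and "\<And>s t. F (s + t) = F s + F t" and "F 0 = (0 :: nat)"
    and "\<And>b. b \<in> B \<Longrightarrow> F b = c"
  shows "F s = k * c"
  using assms(1) by (induction k arbitrary: s) (auto simp: assms)

lemma sum_power_additive_le:
  assumes "s \<in> sum_power B k" and "\<And>s t. F (s + t) = F s + F t" and "F 0 = (0 :: nat)"
    and "\<And>s t. F' (s + t) = F' s + F' t" and "F' 0 = (0 :: nat)"
    and "\<And>b. b \<in> B \<Longrightarrow> F b \<le> F' b"
  shows "F s \<le> F' s"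
  using assms(1) by (induction k arbitrary: s) (auto simp: assms intro!: add_le_mono)

lemma mon_degree_sum_power:
  "s \<in> sum_power (whom_mon ` W) k \<Longrightarrow> mon_degree (s :: ('n::finite \<times> 'm::finite) monomial) = k * card (UNIV :: 'n set)"
  by (erule sum_power_additive) (auto simp: mon_degree_add mon_degree_whom_mon)

lemma row_sum_sum_power:
  fixes s :: "('n::finite \<times> 'm::finite) monomial"
  assumes "s \<in> sum_power (whom_mon ` W) k"
  shows "(\<Sum>j\<in>UNIV. Poly_Mapping.lookup s (i, j)) = k"
proof -
  have "(\<Sum>j\<in>UNIV. Poly_Mapping.lookup s (i, j)) = k * 1"
    by (rule sum_power_additive[OF assms]) (auto simp: lookup_add sum.distrib lookup_whom_mon)
  thus ?thesis by simp
qed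

text \<open>For a product of homomorphism monomials this counts the factors whose value at
  \<open>i\<close> has rank at most \<open>c\<close>. The condition
  \<open>g (\<phi> x) \<le> g (\<phi> y)\<close> becomes an inequality between counts for every
  threshold \<open>c\<close>.\<close>

definition cum :: "('m::finite \<Rightarrow> nat) \<Rightarrow> ('n \<times> 'm) monomial \<Rightarrow> 'n \<Rightarrow> nat \<Rightarrow> nat" where
  "cum g u i c = (\<Sum>j | g j \<le> c. Poly_Mapping.lookup u (i, j))"

lemma cum_add: "cum g (u + v) i c = cum g u i c + cum g v i c"
  by (simp add: cum_def lookup_add sum.distrib)

lemma cum_0 [simp]: "cum g 0 i c = 0"
  by (simp add: cum_def)

lemma cum_single:
  "cum g (Poly_Mapping.single (a, b) (Suc 0)) i c = (if a = i \<and> g b \<le> c then 1 else 0)"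
proof -
  have "cum g (Poly_Mapping.single (a, b) (Suc 0)) i c = (\<Sum>j | g j \<le> c. if j = b then (if a = i then 1 else 0) else 0)"
    unfolding cum_def by (rule sum.cong) (auto simp: lookup_single when_def)
  thus ?thesis by (auto simp: sum.delta)
qed

lemma cum_whom_mon: "cum g (whom_mon \<phi>) i c = (if g (\<phi> i) \<le> c then 1 else 0)"
  by (auto simp: cum_def lookup_whom_mon sum.delta')

lemma cum_pos_iff: "cum g u i c > 0 \<longleftrightarrow> (\<exists>j. g j \<le> c \<and> Poly_Mapping.lookup u (i, j) > 0)"
  unfolding cum_def neq0_conv[symmetric] by (simp add: sum_eq_0_iff)

lemma cum_le_row_sum: "cum g u i c \<le> (\<Sum>j\<in>UNIV. Poly_Mapping.lookup u (i, j))"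
  unfolding cum_def by (rule sum_mono2) auto

text \<open>
  The converse direction splits off the homomorphism that sends each vertex to the smallest
  value occurring in its row.
\<close>

lemma sum_power_monotone_iff:
  fixes g :: "'m::finite \<Rightarrow> nat" and G :: "('n::finite \<times> 'n) set"
  defines "W \<equiv> {\<phi>. \<forall>(x, y) \<in> G. g (\<phi> x) \<le> g (\<phi> y)}"
  shows "u \<in> sum_power (whom_mon ` W) k \<longleftrightarrow>
    (\<forall>i. (\<Sum>j\<in>UNIV. Poly_Mapping.lookup u (i, j)) = k) \<and> (\<forall>(x, y) \<in> G. \<forall>c. cum g u y c \<le> cum g u x c)"
proof
  assume u: "u \<in> sum_power (whom_mon ` W) k"
  have "cum g u y c \<le> cum g u x c" if "(x, y) \<in> G" for x y c
  proof (rule sum_power_additive_le[OF u])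
    fix b assume "b \<in> whom_mon ` W"
    with that show "cum g b y c \<le> cum g b x c" by (force simp: W_def cum_whom_mon)
  qed (simp_all add: cum_add)
  thus "(\<forall>i. (\<Sum>j\<in>UNIV. Poly_Mapping.lookup u (i, j)) = k) \<and> (\<forall>(x, y) \<in> G. \<forall>c. cum g u y c \<le> cum g u x c)"
    using row_sum_sum_power[OF u] by auto
next
  assume "(\<forall>i. (\<Sum>j\<in>UNIV. Poly_Mapping.lookup u (i, j)) = k) \<and> (\<forall>(x, y) \<in> G. \<forall>c. cum g u y c \<le> cum g u x c)"
  thus "u \<in> sum_power (whom_mon ` W) k"
  proof (induction k arbitrary: u)
    case 0
    hence "u = 0" by (intro poly_mapping_eqI) auto
    thus ?case by simp
  next
    case (Suc k)
    have "\<exists>j. Poly_Mapping.lookup u (i, j) > 0 \<and> (\<forall>j'. Poly_Mapping.lookup u (i, j') > 0 \<longrightarrow> g j \<le> g j')" for i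
    proof -
      have "(\<Sum>j\<in>UNIV. Poly_Mapping.lookup u (i, j)) \<noteq> 0" using Suc.prems by simp
      hence "\<exists>j. Poly_Mapping.lookup u (i, j) > 0" by (metis gr0I sum.neutral)
      thus ?thesis using ex_has_least_nat[of "\<lambda>j. Poly_Mapping.lookup u (i, j) > 0" _ g] by blast
    qed
    then obtain \<phi> where \<phi>: "\<And>i. Poly_Mapping.lookup u (i, \<phi> i) > 0"
      "\<And>i j. Poly_Mapping.lookup u (i, j) > 0 \<Longrightarrow> g (\<phi> i) \<le> g j" by metis
    have pos: "cum g u i c > 0 \<longleftrightarrow> g (\<phi> i) \<le> c" for i c
      unfolding cum_pos_iff using \<phi> le_trans by blast
    have mono: "g (\<phi> x) \<le> g (\<phi> y)" if "(x, y) \<in> G" for x y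
    proof -
      have "cum g u y (g (\<phi> y)) \<le> cum g u x (g (\<phi> y))" using Suc.prems that by blast
      moreover have "cum g u y (g (\<phi> y)) > 0" by (simp add: pos)
      ultimately show ?thesis by (simp flip: pos)
    qed
    hence "\<phi> \<in> W" by (auto simp: W_def)
    define u' where "u' = u - whom_mon \<phi>"
    have u: "u = whom_mon \<phi> + u'"
    proof (rule poly_mapping_eqI)
      fix p show "Poly_Mapping.lookup u p = Poly_Mapping.lookup (whom_mon \<phi> + u') p"
        using \<phi>(1)[of "fst p"]
        by (cases p) (auto simp: u'_def lookup_add lookup_minus lookup_whom_mon)
    qed
    have "(\<Sum>j\<in>UNIV. Poly_Mapping.lookup u (i, j)) = 1 + (\<Sum>j\<in>UNIV. Poly_Mapping.lookup u' (i, j))" for i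
      by (subst u) (simp add: lookup_add sum.distrib lookup_whom_mon)
    hence "(\<Sum>j\<in>UNIV. Poly_Mapping.lookup u' (i, j)) = k" for i
      using Suc.prems by simp
    moreover have "cum g u' y c \<le> cum g u' x c" if "(x, y) \<in> G" for x y c
    proof -
      have *: "cum g u i c = (if g (\<phi> i) \<le> c then 1 else 0) + cum g u' i c" for i
        by (subst u) (simp add: cum_add cum_whom_mon)
      have le: "cum g u y c \<le> cum g u x c" using Suc.prems that by blast
      show ?thesis
      \<comment> \<open>If the threshold admits \<open>\<phi> y\<close>, it also admits
        \<open>\<phi> x\<close> and both sums drop by 1; otherwise row \<open>y\<close> of
        \<open>u\<close> has nothing up to the threshold.\<close>
      proof (cases "g (\<phi> y) \<le> c")
        case True
        thus ?thesis using le mono[OF that] *[of x] *[of y] by simp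
      next
        case False
        hence "cum g u y c = 0" using pos by blast
        thus ?thesis using *[of y] by simp
      qed
    qed
    ultimately have "u' \<in> sum_power (whom_mon ` W) k" by (intro Suc.IH) auto
    thus ?case using u \<open>\<phi> \<in> W\<close> by auto
  qed
qed

text \<open>An injective rank of the variables replaces positions in the list that the definition
  asks for.\<close>

lemma weakly_polymatroidalI:
  fixes I :: "('v::finite, 'k::field) mpoly set" and \<kappa> :: "'v \<Rightarrow> nat"
  assumes "inj \<kappa>"
    and exch: "\<And>u v p. u \<in> mingens I \<Longrightarrow> v \<in> mingens I \<Longrightarrow>
      (\<And>q. \<kappa> q < \<kappa> p \<Longrightarrow> Poly_Mapping.lookup u q = Poly_Mapping.lookup v q) \<Longrightarrow>
      Poly_Mapping.lookup u p > Poly_Mapping.lookup v p \<Longrightarrow>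
      \<exists>s. \<kappa> p < \<kappa> s \<and> Poly_Mapping.lookup v s > 0 \<and> Var p * mon (v - Poly_Mapping.single s 1) \<in> I"
  shows "weakly_polymatroidal I"
proof -
  obtain ys where ys: "distinct ys" "set ys = (UNIV :: 'v set)"
    "\<And>i j. i < length ys \<Longrightarrow> j < length ys \<Longrightarrow> \<kappa> (ys ! i) < \<kappa> (ys ! j) \<longleftrightarrow> i < j"
    using finite_list_by_rank[OF finite_UNIV assms(1)] by metis
  show ?thesis unfolding weakly_polymatroidal_def
  proof (rule exI[of _ ys], intro conjI ballI allI impI)
    fix u v r
    assume uv: "u \<in> mingens I" "v \<in> mingens I" and r: "r < length ys"
      and *: "(\<forall>q<r. Poly_Mapping.lookup u (ys ! q) = Poly_Mapping.lookup v (ys ! q)) \<and>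
        Poly_Mapping.lookup u (ys ! r) > Poly_Mapping.lookup v (ys ! r)"
    have "Poly_Mapping.lookup u q = Poly_Mapping.lookup v q" if "\<kappa> q < \<kappa> (ys ! r)" for q
    proof -
      obtain q' where "q' < length ys" "q = ys ! q'" using ys(2) by (metis UNIV_I in_set_conv_nth)
      thus ?thesis using * that ys(3) r by blast
    qed
    then obtain s where s: "\<kappa> (ys ! r) < \<kappa> s" "Poly_Mapping.lookup v s > 0"
      "Var (ys ! r) * mon (v - Poly_Mapping.single s 1) \<in> I"
      using exch[OF uv, of "ys ! r"] * by blast
    obtain s' where "s' < length ys" "s = ys ! s'" using ys(2) by (metis UNIV_I in_set_conv_nth)
    thus "\<exists>s>r. s < length ys \<and> 0 < Poly_Mapping.lookup v (ys ! s) \<and>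
        Var (ys ! r) * mon (v - Poly_Mapping.single (ys ! s) 1) \<in> I"
      using s ys(3) r by blast
  qed (use ys in auto)
qed

text \<open>
  The variables are ordered by rows along a linear extension of the graph and within a row by the
  order of the target. The variable exchanged for the first difference is the next one of its row.
\<close>

lemma weakly_polymatroidal_monotone:
  fixes f :: "'n::finite \<Rightarrow> nat" and g :: "'m::finite \<Rightarrow> nat" and G :: "('n \<times> 'n) set"
  defines "W \<equiv> {\<phi>. \<forall>(x, y) \<in> G. g (\<phi> x) \<le> g (\<phi> y)}"
  assumes f: "inj f" "\<And>x y. (x, y) \<in> G \<Longrightarrow> f x < f y" and g: "inj g"
  shows "weakly_polymatroidal (ideal_gen (mon ` sum_power (whom_mon ` W) k) :: ('n \<times> 'm, 'k::field) mpoly set)"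
proof -
  define B where "B = sum_power (whom_mon ` W) k"
  note B_iff = sum_power_monotone_iff[where G = G and g = g and k = k, folded W_def B_def]
  have mg: "mingens (ideal_gen (mon ` B) :: ('n \<times> 'm, 'k) mpoly set) = B"
    unfolding B_def by (rule mingens_monomial_ideal[OF mon_degree_sum_power])
  \<comment> \<open>\<open>M\<close> exceeds every rank in the target, so that
    \<open>\<kappa>\<close> numbers the variables row by row.\<close>
  define M where "M = Suc (Max (range g))"
  have M: "g j < M" for j by (simp add: M_def le_imp_less_Suc)
  define \<kappa> where "\<kappa> = (\<lambda>(i, j). f i * M + g j)"
  have row: "\<kappa> (i', j') < \<kappa> (i, j)" if "f i' < f i" for i i' j j'
  proof -
    have "(f i' + 1) * M \<le> f i * M" using that by (intro mult_le_mono1) simp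
    thus ?thesis using M[of j'] by (simp add: \<kappa>_def)
  qed
  have col: "\<kappa> (i, j') < \<kappa> (i, j) \<longleftrightarrow> g j' < g j" for i j j' by (simp add: \<kappa>_def)
  have "inj \<kappa>"
  proof (rule injI)
    fix p q assume eq: "\<kappa> p = \<kappa> q"
    obtain i j i' j' where pq: "p = (i, j)" "q = (i', j')" by (metis surj_pair)
    have "f i = f i'" using row[of i' i j' j] row[of i i' j j'] eq pq
      by (metis less_irrefl linorder_neqE_nat)
    hence "i = i'" using f(1) by (simp add: inj_eq)
    moreover from this have "g j = g j'" using eq pq by (simp add: \<kappa>_def)
    ultimately show "p = q" using g pq by (simp add: inj_eq)
  qed
  thus ?thesis unfolding B_def[symmetric]
  proof (rule weakly_polymatroidalI, unfold mg)
    fix u v p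
    assume u: "u \<in> B" and v: "v \<in> B"
      and agree: "\<And>q. \<kappa> q < \<kappa> p \<Longrightarrow> Poly_Mapping.lookup u q = Poly_Mapping.lookup v q"
      and less: "Poly_Mapping.lookup v p < Poly_Mapping.lookup u p"
    obtain i j where p: "p = (i, j)" by (metis surj_pair)
    have cum_less: "cum g v i (g j) < cum g u i (g j)"
      unfolding cum_def
    proof (rule sum_strict_mono_ex1)
      have "Poly_Mapping.lookup v (i, j') \<le> Poly_Mapping.lookup u (i, j')" if "g j' \<le> g j" for j'
      proof (cases "g j' = g j")
        case True
        thus ?thesis using g less p by (simp add: inj_eq)
      next
        case False
        thus ?thesis using agree[of "(i, j')"] that col p by simp
      qed
      thus "\<forall>j'\<in>{j'. g j' \<le> g j}. Poly_Mapping.lookup v (i, j') \<le> Poly_Mapping.lookup u (i, j')" by simp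
      show "\<exists>j'\<in>{j'. g j' \<le> g j}. Poly_Mapping.lookup v (i, j') < Poly_Mapping.lookup u (i, j')"
        using less p by auto
    qed simp
    \<comment> \<open>Both rows sum to \<open>k\<close>, so the deficit of \<open>v\<close> up to
      \<open>j\<close> is made up later in the row.\<close>
    have "\<exists>j'. g j < g j' \<and> Poly_Mapping.lookup v (i, j') > 0"
    proof (rule ccontr)
      assume "\<not> ?thesis"
      hence "(\<Sum>j'\<in>UNIV. Poly_Mapping.lookup v (i, j')) = cum g v i (g j)"
        unfolding cum_def by (intro sum.mono_neutral_right) (auto simp: not_le)
      also have "\<dots> < (\<Sum>j'\<in>UNIV. Poly_Mapping.lookup u (i, j'))"
        using cum_less cum_le_row_sum[of g u i "g j"] by linarith
      finally show False using u v by (simp add: B_iff)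
    qed
    then obtain j' where j': "g j < g j'" "Poly_Mapping.lookup v (i, j') > 0"
      and least: "\<And>l. g j < g l \<Longrightarrow> Poly_Mapping.lookup v (i, l) > 0 \<Longrightarrow> g j' \<le> g l"
      using ex_has_least_nat[of "\<lambda>l. g j < g l \<and> Poly_Mapping.lookup v (i, l) > 0" _ g] by blast
    define v' where "v' = v - Poly_Mapping.single (i, j') 1"
    define w where "w = Poly_Mapping.single (i, j) 1 + v'"
    have v_eq: "v = Poly_Mapping.single (i, j') 1 + v'"
      using j'(2) by (intro poly_mapping_eqI) (auto simp: v'_def lookup_add lookup_minus lookup_single when_def)
    have cum_v: "cum g v x c = (if i = x \<and> g j' \<le> c then 1 else 0) + cum g v' x c" for x c
      by (subst v_eq) (simp add: cum_add cum_single)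
    have cum_w: "cum g w x c = (if i = x \<and> g j \<le> c then 1 else 0) + cum g v' x c" for x c
      by (simp add: w_def cum_add cum_single)
    \<comment> \<open>By the choice of \<open>j'\<close>, \<open>v\<close> has no entry of rank
      strictly between those of \<open>j\<close> and \<open>j'\<close>, so its sum stays below that
      of \<open>u\<close>. Precisely in this range the exchange raises the sum of row
      \<open>i\<close>, by 1.\<close>
    have between: "cum g v i c < cum g u i c" if "g j \<le> c" "c < g j'" for c
    proof -
      have "cum g v i c = cum g v i (g j)"
        unfolding cum_def
      proof (rule sum.mono_neutral_right)
        have "\<not> Poly_Mapping.lookup v (i, l) > 0" if "g l \<le> c" "\<not> g l \<le> g j" for l
          using least[of l] that \<open>c < g j'\<close> by linarith
        thus "\<forall>l\<in>{l. g l \<le> c} - {l. g l \<le> g j}. Poly_Mapping.lookup v (i, l) = 0" by blast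
      qed (use that in auto)
      also have "\<dots> < cum g u i (g j)" by (rule cum_less)
      also have "\<dots> \<le> cum g u i c"
        unfolding cum_def by (rule sum_mono2) (use that in auto)
      finally show ?thesis .
    qed
    have row_single: "(\<Sum>l\<in>UNIV. Poly_Mapping.lookup (Poly_Mapping.single (i, b) (Suc 0)) (x, l)) = (if i = x then 1 else 0)"
      for b :: 'm and x
      by (subst sum.mono_neutral_right[of UNIV "{b}"]) (auto simp: lookup_single when_def)
    have rows: "(\<Sum>l\<in>UNIV. Poly_Mapping.lookup w (x, l)) = (\<Sum>l\<in>UNIV. Poly_Mapping.lookup v (x, l))" for x
      by (subst v_eq) (simp add: w_def lookup_add sum.distrib row_single)
    have "cum g w y c \<le> cum g w x c" if "(x, y) \<in> G" for x y c
    proof -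
      have le: "cum g v y c \<le> cum g v x c" "cum g u y c \<le> cum g u x c"
        using u v that by (auto simp: B_iff)
      have xy: "f x < f y" by (rule f(2)[OF that])
      show ?thesis
      \<comment> \<open>For an edge into \<open>i\<close>, row \<open>x\<close> precedes row
        \<open>i\<close>, so it agrees in \<open>u\<close> and \<open>v\<close>, and the raised sum
        is bounded by that of \<open>u\<close> or \<open>v\<close>. For any other edge only the
        larger side can have been raised.\<close>
      proof (cases "y = i")
        case True
        have "cum g v x c = cum g u x c"
          unfolding cum_def using agree row xy True p by (intro sum.cong) auto
        moreover have "cum g w x c = cum g v x c"
          using xy True by (auto simp: cum_v cum_w)
        moreover have "cum g w i c \<le> max (cum g v i c) (cum g u i c)"
          using between[of c] j'(1) by (auto simp: cum_v cum_w max_def)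
        ultimately show ?thesis using le True by simp
      next
        case False
        thus ?thesis using le(1) j'(1) by (auto simp: cum_v cum_w split: if_splits)
      qed
    qed
    hence "w \<in> B" using rows v by (simp add: B_iff) blast
    hence "Var p * mon v' \<in> (ideal_gen (mon ` B) :: ('n \<times> 'm, 'k) mpoly set)"
      by (auto simp: Var_def mon_mult p w_def intro: ring_ideal.span_base)
    thus "\<exists>s. \<kappa> p < \<kappa> s \<and> Poly_Mapping.lookup v s > 0 \<and>
        Var p * mon (v - Poly_Mapping.single s 1) \<in> (ideal_gen (mon ` B) :: ('n \<times> 'm, 'k) mpoly set)"
      using j' col p by (intro exI[of _ "(i, j')"]) (auto simp: v'_def)
  qed
qed

lemma acyclic_complete_rank:
  fixes H :: "('m::finite \<times> 'm) set"
  assumes "acyclic H" "complete_digraph H"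
  obtains g :: "'m \<Rightarrow> nat" where "inj g" "\<And>a b. (a, b) \<in> H \<longleftrightarrow> g a < g b"
proof -
  obtain g :: "'m \<Rightarrow> nat" where g: "inj g" "\<And>a b. (a, b) \<in> H \<Longrightarrow> g a < g b"
    using finite_acyclic_rank[OF finite_UNIV assms(1)] by (metis UNIV_I)
  have "(a, b) \<in> H" if "g a < g b" for a b
    using that assms(2) g(2)[of b a] unfolding complete_digraph_def by (metis less_asym less_irrefl)
  thus thesis using that g by blast
qed

lemma whom_ideal_power_weakly_polymatroidal:
  fixes G :: "('n::finite \<times> 'n) set" and H :: "('m::finite \<times> 'm) set"
  assumes "totally_disconnected G \<or> (acyclic G \<and> acyclic H \<and> complete_digraph H)"
  shows "weakly_polymatroidal (ideal_power (whom_ideal G H :: ('n \<times> 'm, 'k::field) mpoly set) k)"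
proof -
  have "\<exists>g :: 'm \<Rightarrow> nat. inj g \<and> WHom G H = {\<phi>. \<forall>(x, y) \<in> G. g (\<phi> x) \<le> g (\<phi> y)}"
  proof (cases "G = {}")
    \<comment> \<open>Without edges every map is a homomorphism, so any injective ranking
      serves.\<close>
    case True
    obtain g :: "'m \<Rightarrow> nat" where "inj g"
      using finite_imp_inj_to_nat_seg[OF finite_UNIV] by metis
    thus ?thesis using True by (auto simp: WHom_def)
  next
    case False
    then obtain g :: "'m \<Rightarrow> nat" where g: "inj g" "\<And>a b. (a, b) \<in> H \<longleftrightarrow> g a < g b"
      using assms acyclic_complete_rank by (metis totally_disconnected_def)
    have "a = b \<or> (a, b) \<in> H \<longleftrightarrow> g a \<le> g b" for a b
      using g by (auto simp: le_less inj_eq)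
    thus ?thesis using g(1) by (auto simp: WHom_def)
  qed
  then obtain g :: "'m \<Rightarrow> nat" where g: "inj g" "WHom G H = {\<phi>. \<forall>(x, y) \<in> G. g (\<phi> x) \<le> g (\<phi> y)}"
    by blast
  have "acyclic G" using assms by (auto simp: totally_disconnected_def acyclic_def)
  then obtain f :: "'n \<Rightarrow> nat" where "inj f" "\<And>x y. (x, y) \<in> G \<Longrightarrow> f x < f y"
    using finite_acyclic_rank[OF finite_UNIV] by (metis UNIV_I)
  thus ?thesis unfolding whom_ideal_power g(2)
    using g(1) by (intro weakly_polymatroidal_monotone)
qed

section \<open>Syzygies over a commutative ring\<close>

lemma const_zero_fun [simp]: "(\<lambda>_. 0) = 0"
  by (simp add: fun_eq_iff)

text \<open>
  Vectors are functions on the natural numbers. The elements of \<open>S\<^sup>p\<close> are those that vanish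
  from \<open>p\<close> on.
\<close>

definition vec_scale :: "'a::comm_ring_1 \<Rightarrow> (nat \<Rightarrow> 'a) \<Rightarrow> nat \<Rightarrow> 'a" where
  "vec_scale c z = (\<lambda>i. c * z i)"

lemma vec_scale_apply [simp]: "vec_scale c z i = c * z i"
  by (simp add: vec_scale_def)

global_interpretation vecs: Modules.module "vec_scale :: 'a::comm_ring_1 \<Rightarrow> (nat \<Rightarrow> 'a) \<Rightarrow> nat \<Rightarrow> 'a"
  defines vec_span = vecs.span
  by standard (auto simp: fun_eq_iff algebra_simps)

text \<open>The matrix with columns \<open>gs\<close> applied to \<open>c\<close>; entries of
  \<open>c\<close> beyond the columns are ignored.\<close>

definition lin_comb :: "(nat \<Rightarrow> 'a::comm_ring_1) list \<Rightarrow> (nat \<Rightarrow> 'a) \<Rightarrow> nat \<Rightarrow> 'a" where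
  "lin_comb gs c = (\<lambda>i. \<Sum>j<length gs. c j * (gs ! j) i)"

text \<open>Forcing the ignored entries to vanish makes this the kernel inside the free module on
  \<open>gs\<close>.\<close>

definition syz :: "(nat \<Rightarrow> 'a::comm_ring_1) list \<Rightarrow> (nat \<Rightarrow> 'a) set" where
  "syz gs = {c. (\<forall>j\<ge>length gs. c j = 0) \<and> lin_comb gs c = 0}"

definition shift :: "nat \<Rightarrow> (nat \<Rightarrow> 'a) \<Rightarrow> nat \<Rightarrow> 'a" where
  "shift r z = (\<lambda>i. z (r + i))"

definition unit :: "nat \<Rightarrow> nat \<Rightarrow> 'a::comm_ring_1" where
  "unit b = (\<lambda>i. if i = b then 1 else 0)"

text \<open>The ring as free module of rank 1, so that ideals are submodules of the same kind as
  syzygy modules.\<close>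

definition emb :: "'a \<Rightarrow> nat \<Rightarrow> 'a::comm_ring_1" where
  "emb f = (\<lambda>i. if i = 0 then f else 0)"

lemma shift_apply [simp]: "shift r z i = z (r + i)"
  by (simp add: shift_def)

lemma emb_0 [simp]: "emb f 0 = f"
  by (simp add: emb_def)

lemma emb_pos [simp]: "0 < i \<Longrightarrow> emb f i = 0"
  by (simp add: emb_def)

lemma emb_eq_iff [simp]: "emb f = emb g \<longleftrightarrow> f = g"
  by (metis emb_0)

lemma module_hom_emb: "Modules.module_hom (*) vec_scale (emb :: 'a::comm_ring_1 \<Rightarrow> _)"
  by unfold_locales (auto simp: fun_eq_iff emb_def algebra_simps)

lemma emb_ideal_gen: "emb ` ideal_gen X = vec_span (emb ` X)"
  unfolding ideal_gen_def vec_span_def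
  by (rule Modules.module_hom.span_image[OF module_hom_emb, symmetric])

lemma lin_comb_0 [simp]: "lin_comb gs 0 = 0"
  by (simp add: lin_comb_def fun_eq_iff)

lemma lin_comb_Nil [simp]: "lin_comb [] c = 0"
  by (simp add: lin_comb_def fun_eq_iff)

lemma lin_comb_add: "lin_comb gs (c + d) = lin_comb gs c + lin_comb gs d"
  by (simp add: lin_comb_def fun_eq_iff distrib_right sum.distrib)

lemma lin_comb_diff: "lin_comb gs (c - d) = lin_comb gs c - lin_comb gs d"
  by (simp add: lin_comb_def fun_eq_iff left_diff_distrib sum_subtractf)

lemma lin_comb_scale: "lin_comb gs (vec_scale a c) = vec_scale a (lin_comb gs c)"
  by (simp add: lin_comb_def fun_eq_iff sum_distrib_left mult.assoc)

lemma module_hom_lin_comb: "Modules.module_hom vec_scale vec_scale (lin_comb gs)"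
  by unfold_locales (auto simp: lin_comb_add lin_comb_scale)

lemma lin_comb_cong: "(\<And>j. j < length gs \<Longrightarrow> c j = d j) \<Longrightarrow> lin_comb gs c = lin_comb gs d"
  by (simp add: lin_comb_def fun_eq_iff)

lemma lin_comb_unit: "b < length gs \<Longrightarrow> lin_comb gs (unit b) = gs ! b"
  by (auto simp: lin_comb_def fun_eq_iff unit_def if_distrib[of "\<lambda>x. x * _"] cong: if_cong)

lemma sum_lessThan_add:
  fixes f :: "nat \<Rightarrow> 'a::comm_monoid_add"
  shows "(\<Sum>j<m + n. f j) = (\<Sum>j<m. f j) + (\<Sum>j<n. f (m + j))"
  by (induction n) (simp_all add: add.assoc)

lemma lin_comb_append: "lin_comb (gs @ hs) c = lin_comb gs c + lin_comb hs (shift (length gs) c)"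
proof
  fix i
  have "lin_comb (gs @ hs) c i = (\<Sum>j<length gs + length hs. c j * ((gs @ hs) ! j) i)"
    by (simp add: lin_comb_def)
  also have "\<dots> = (\<Sum>j<length gs. c j * ((gs @ hs) ! j) i)
      + (\<Sum>j<length hs. c (length gs + j) * ((gs @ hs) ! (length gs + j)) i)"
    by (rule sum_lessThan_add)
  also have "(\<Sum>j<length gs. c j * ((gs @ hs) ! j) i) = lin_comb gs c i"
    by (simp add: lin_comb_def nth_append)
  finally show "lin_comb (gs @ hs) c i = (lin_comb gs c + lin_comb hs (shift (length gs) c)) i"
    by (simp add: lin_comb_def)
qed

text \<open>Associativity of the matrix product.\<close>

lemma lin_comb_lin_comb: "lin_comb hs (lin_comb gs c) = lin_comb (map (lin_comb hs) gs) c"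
proof
  fix i
  have "lin_comb hs (lin_comb gs c) i
      = (\<Sum>k<length hs. \<Sum>j<length gs. c j * ((gs ! j) k * (hs ! k) i))"
    by (simp add: lin_comb_def sum_distrib_right mult.assoc)
  also have "\<dots> = (\<Sum>j<length gs. \<Sum>k<length hs. c j * ((gs ! j) k * (hs ! k) i))"
    by (rule sum.swap)
  finally show "lin_comb hs (lin_comb gs c) i = lin_comb (map (lin_comb hs) gs) c i"
    by (simp add: lin_comb_def sum_distrib_left)
qed

lemma lin_comb_units:
  assumes "\<And>j. j \<ge> n \<Longrightarrow> c j = 0"
  shows "lin_comb (map unit [0..<n]) c = c"
proof
  fix i
  have "lin_comb (map unit [0..<n]) c i = (\<Sum>j<n. if j = i then c i else 0)"
    unfolding lin_comb_def by (intro sum.cong) (auto simp: unit_def)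
  thus "lin_comb (map unit [0..<n]) c i = c i" using assms[of i] by simp
qed

lemma lin_comb_eq_sum: "lin_comb gs c = (\<Sum>j<length gs. vec_scale (c j) (gs ! j))"
proof
  fix i
  have "(\<Sum>j\<in>A. vec_scale (c j) (gs ! j)) i = (\<Sum>j\<in>A. c j * (gs ! j) i)" for A
    by (induction A rule: infinite_finite_induct) auto
  thus "lin_comb gs c i = (\<Sum>j<length gs. vec_scale (c j) (gs ! j)) i"
    by (simp add: lin_comb_def)
qed

lemma lin_comb_in_subspace: "vecs.subspace Z \<Longrightarrow> set gs \<subseteq> Z \<Longrightarrow> lin_comb gs c \<in> Z"
  unfolding lin_comb_eq_sum by (intro vecs.subspace_sum vecs.subspace_scale) auto

lemma subspace_range_lin_comb: "vecs.subspace (range (lin_comb gs))"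
proof (rule vecs.subspaceI)
  show "0 \<in> range (lin_comb gs)" using lin_comb_0 by (metis rangeI)
qed (auto simp flip: lin_comb_add lin_comb_scale)

lemma vec_span_set: "vec_span (set gs) = range (lin_comb gs)"
proof
  have "set gs \<subseteq> range (lin_comb gs)"
    by (auto simp: in_set_conv_nth) (metis lin_comb_unit rangeI)
  thus "vec_span (set gs) \<subseteq> range (lin_comb gs)"
    by (intro vecs.span_minimal subspace_range_lin_comb)
  show "range (lin_comb gs) \<subseteq> vec_span (set gs)"
    using lin_comb_in_subspace[OF vecs.subspace_span vecs.span_superset] by blast
qed

lemma in_vec_span_setE:
  assumes "z \<in> vec_span (set gs)"
  obtains c where "z = lin_comb gs c" "\<And>j. j \<ge> length gs \<Longrightarrow> c j = 0"
proof -
  obtain c where c: "z = lin_comb gs c" using assms by (auto simp: vec_span_set)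
  show thesis
    by (rule that[of "\<lambda>j. if j < length gs then c j else 0"]) (auto simp: c intro: lin_comb_cong)
qed

lemma lin_comb_in_span: "lin_comb gs c \<in> vec_span (set gs)"
  by (simp add: vec_span_set)

lemma subspace_syz: "vecs.subspace (syz gs)"
  by (rule vecs.subspaceI) (auto simp: syz_def lin_comb_add lin_comb_scale fun_eq_iff)

lemma syz_Nil [simp]: "syz [] = {0}"
  by (auto simp: syz_def fun_eq_iff)

section \<open>Homogeneous components\<close>

definition part :: "('v monomial \<Rightarrow> bool) \<Rightarrow> ('v, 'k::comm_ring_1) mpoly \<Rightarrow> ('v, 'k) mpoly" where
  "part Q f = Abs_poly_mapping (\<lambda>t. Poly_Mapping.lookup f t when Q t)"

lemma lookup_part: "Poly_Mapping.lookup (part Q f) t = (Poly_Mapping.lookup f t when Q t)"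
proof -
  have "finite {t. (Poly_Mapping.lookup f t when Q t) \<noteq> 0}"
    by (rule finite_subset[OF _ finite_lookup[of f]]) auto
  thus ?thesis by (simp add: part_def)
qed

lemma keys_part: "Poly_Mapping.keys (part Q f) = {t \<in> Poly_Mapping.keys f. Q t}"
  by (auto simp: in_keys_iff lookup_part)

lemma part_add: "part Q (f + g) = part Q f + part Q g"
  by (rule poly_mapping_eqI) (simp add: lookup_part lookup_add when_add_distrib)

lemma part_0 [simp]: "part Q 0 = 0"
  by (rule poly_mapping_eqI) (simp add: lookup_part)

lemma part_sum: "part Q (sum f A) = (\<Sum>a\<in>A. part Q (f a))"
  by (induction A rule: infinite_finite_induct) (simp_all add: part_add)

lemma part_eq_self: "(\<And>t. t \<in> Poly_Mapping.keys f \<Longrightarrow> Q t) \<Longrightarrow> part Q f = f"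
  by (rule poly_mapping_eqI) (auto simp: lookup_part when_def in_keys_iff)

lemma part_eq_0: "(\<And>t. t \<in> Poly_Mapping.keys f \<Longrightarrow> \<not> Q t) \<Longrightarrow> part Q f = 0"
  by (rule poly_mapping_eqI) (auto simp: lookup_part when_def in_keys_iff)

text \<open>By linearity it suffices to treat a single term of \<open>f\<close>. The predicates are
  arbitrary because total degree, multidegrees and the divisibility filter of the converse direction
  all need this rule.\<close>

lemma part_mult:
  fixes f g :: "('v, 'k::comm_ring_1) mpoly"
  assumes "\<And>t s. t \<in> Poly_Mapping.keys g \<Longrightarrow> Q (t + s) \<longleftrightarrow> Q' s"
  shows "part Q (f * g) = part Q' f * g"
proof -
  have single: "part Q (Poly_Mapping.single s a * g) = part Q' (Poly_Mapping.single s a) * g" for s a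
  proof -
    have keys: "Poly_Mapping.keys (Poly_Mapping.single s a * g) \<subseteq> {t + s | t. t \<in> Poly_Mapping.keys g}"
      using keys_mult[of "Poly_Mapping.single s a" g] by (auto simp: add.commute split: if_splits)
    show ?thesis
    proof (cases "Q' s")
      case True
      hence "part Q (Poly_Mapping.single s a * g) = Poly_Mapping.single s a * g"
        using keys assms by (intro part_eq_self) auto
      moreover have "part Q' (Poly_Mapping.single s a) = Poly_Mapping.single s a"
        using True by (intro part_eq_self) (auto split: if_splits)
      ultimately show ?thesis by simp
    next
      case False
      hence "part Q (Poly_Mapping.single s a * g) = 0"
        using keys assms by (intro part_eq_0) auto
      moreover have "part Q' (Poly_Mapping.single s a) = 0"
        using False by (intro part_eq_0) (auto split: if_splits)
      ultimately show ?thesis by simp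
    qed
  qed
  show ?thesis
    by (subst (1 2) poly_eq_sum_single[of f]) (simp only: sum_distrib_right part_sum single)
qed

text \<open>The parameter \<open>deg\<close> is the total degree or, for multidegrees, the identity;
  \<open>\<rho> i\<close> is the degree of the basis vector \<open>i\<close>, as in a direct sum of
  shifted copies of the ring.\<close>

definition is_hom :: "('v monomial \<Rightarrow> 'g::comm_monoid_add) \<Rightarrow> (nat \<Rightarrow> 'g) \<Rightarrow> 'g \<Rightarrow> (nat \<Rightarrow> ('v, 'k::comm_ring_1) mpoly) \<Rightarrow> bool" where
  "is_hom deg \<rho> \<gamma> z \<longleftrightarrow> (\<forall>i. \<forall>t\<in>Poly_Mapping.keys (z i). \<rho> i + deg t = \<gamma>)"

definition component :: "('v monomial \<Rightarrow> 'g::comm_monoid_add) \<Rightarrow> (nat \<Rightarrow> 'g) \<Rightarrow> 'g \<Rightarrow> (nat \<Rightarrow> ('v, 'k::comm_ring_1) mpoly) \<Rightarrow> nat \<Rightarrow> ('v, 'k) mpoly" where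
  "component deg \<rho> \<gamma> z = (\<lambda>i. part (\<lambda>t. \<rho> i + deg t = \<gamma>) (z i))"

lemma is_hom_component: "is_hom deg \<rho> \<gamma> (component deg \<rho> \<gamma> z)"
  by (simp add: is_hom_def component_def keys_part)

lemma component_eq_self_iff: "component deg \<rho> \<gamma> z = z \<longleftrightarrow> is_hom deg \<rho> \<gamma> z"
  using is_hom_component[of deg \<rho> \<gamma> z]
  by (auto simp: is_hom_def component_def fun_eq_iff intro!: part_eq_self)

text \<open>A matrix with homogeneous columns is a graded map and hence commutes with taking
  components. The homogeneous statements on syzygies and spans below follow from this.\<close>

lemma component_lin_comb:
  assumes "\<And>s t. deg (s + t) = deg s + deg t"
    and "\<And>j. j < length gs \<Longrightarrow> is_hom deg \<rho> (\<delta> j) (gs ! j)"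
  shows "component deg \<rho> \<gamma> (lin_comb gs c) = lin_comb gs (component deg \<delta> \<gamma> c)"
proof
  fix i
  have "part (\<lambda>t. \<rho> i + deg t = \<gamma>) (c j * (gs ! j) i) = part (\<lambda>t. \<delta> j + deg t = \<gamma>) (c j) * (gs ! j) i"
    if "j < length gs" for j
  proof (rule part_mult)
    fix t s assume "t \<in> Poly_Mapping.keys ((gs ! j) i)"
    hence "\<rho> i + deg t = \<delta> j" using assms(2)[OF that] by (simp add: is_hom_def)
    thus "(\<rho> i + deg (t + s) = \<gamma>) = (\<delta> j + deg s = \<gamma>)"
      by (simp add: assms(1) flip: add.assoc)
  qed
  thus "component deg \<rho> \<gamma> (lin_comb gs c) i = lin_comb gs (component deg \<delta> \<gamma> c) i"
    by (simp add: component_def lin_comb_def part_sum)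
qed

lemma component_syz:
  assumes "\<And>s t. deg (s + t) = deg s + deg t"
    and "\<And>j. j < length gs \<Longrightarrow> is_hom deg \<rho> (\<delta> j) (gs ! j)"
    and "c \<in> syz gs"
  shows "component deg \<delta> \<gamma> c \<in> syz gs"
proof -
  have "lin_comb gs (component deg \<delta> \<gamma> c) = component deg \<rho> \<gamma> (lin_comb gs c)"
    using assms(1,2) by (rule component_lin_comb[symmetric])
  thus ?thesis using assms(3) by (simp add: syz_def component_def)
qed

lemma is_hom_lin_comb:
  assumes "\<And>s t. deg (s + t) = deg s + deg t"
    and "\<And>j. j < length gs \<Longrightarrow> is_hom deg \<rho> (\<delta> j) (gs ! j)"
    and "is_hom deg \<delta> \<gamma> c"
  shows "is_hom deg \<rho> \<gamma> (lin_comb gs c)"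
  using component_lin_comb[OF assms(1,2), of \<gamma> c] assms(3)
  by (simp flip: component_eq_self_iff)

lemma is_hom_in_spanE:
  assumes "\<And>s t. deg (s + t) = deg s + deg t"
    and "\<And>j. j < length gs \<Longrightarrow> is_hom deg \<rho> (\<delta> j) (gs ! j)"
    and "is_hom deg \<rho> \<gamma> z" "z \<in> vec_span (set gs)"
  obtains c where "z = lin_comb gs c" "is_hom deg \<delta> \<gamma> c" "\<And>j. j \<ge> length gs \<Longrightarrow> c j = 0"
proof -
  obtain c where c: "z = lin_comb gs c" "\<And>j. j \<ge> length gs \<Longrightarrow> c j = 0"
    using assms(4) by (rule in_vec_span_setE) blast
  have "z = component deg \<rho> \<gamma> z" using assms(3) component_eq_self_iff by metis
  also have "\<dots> = lin_comb gs (component deg \<delta> \<gamma> c)"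
    unfolding c(1) using assms(1,2) by (rule component_lin_comb)
  finally show thesis
    by (rule that[OF _ is_hom_component]) (simp add: component_def c(2))
qed

abbreviation hom :: "nat \<Rightarrow> (nat \<Rightarrow> ('v, 'k::comm_ring_1) mpoly) \<Rightarrow> bool" where
  "hom \<equiv> is_hom mon_degree 0"

lemma is_hom_const: "is_hom mon_degree (\<lambda>_. e) (e + n) z \<longleftrightarrow> hom n z"
  by (simp add: is_hom_def)

lemma component_const: "component mon_degree (\<lambda>_. e) (e + n) z = component mon_degree 0 n z"
  by (simp add: component_def)

section \<open>Modules with a linear resolution\<close>

text \<open>
  Coefficients that are homogeneous of degree 0 are constants, so this is linear independence over
  the field.
\<close>

definition K_indep :: "(nat \<Rightarrow> ('v, 'k::comm_ring_1) mpoly) list \<Rightarrow> bool" where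
  "K_indep gs \<longleftrightarrow> (\<forall>c\<in>syz gs. hom 0 c \<longrightarrow> c = 0)"

text \<open>The first \<open>i\<close> steps of a linear resolution of \<open>Z\<close>, with
  \<open>K_indep\<close> expressing minimality. Degrees are counted afresh at each step, with all
  basis vectors in degree 0, so that every step asks for degree 1. Bounding the depth permits
  induction.\<close>

primrec linear_upto :: "nat \<Rightarrow> (nat \<Rightarrow> ('v, 'k::comm_ring_1) mpoly) set \<Rightarrow> bool" where
  "linear_upto 0 Z \<longleftrightarrow> True"
| "linear_upto (Suc i) Z \<longleftrightarrow> (\<exists>gs. (\<forall>g\<in>set gs. hom 1 g) \<and> K_indep gs \<and>
     vec_span (set gs) = Z \<and> linear_upto i (syz gs))"

lemma linear_upto_zero: "linear_upto i {0 :: nat \<Rightarrow> ('v, 'k::comm_ring_1) mpoly}"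
proof (induction i)
  case (Suc i)
  moreover have "vec_span (set []) = {0 :: nat \<Rightarrow> ('v, 'k) mpoly}" by simp
  moreover have "K_indep ([] :: (nat \<Rightarrow> ('v, 'k) mpoly) list)" by (simp add: K_indep_def)
  ultimately show ?case unfolding linear_upto.simps by (intro exI[of _ "[]"]) simp
qed simp

text \<open>Injectivity on \<open>Z\<close> leaves the syzygies of the generators unchanged, so only
  the first step has to be transported.\<close>

lemma linear_upto_image:
  fixes Z :: "(nat \<Rightarrow> ('v, 'k::comm_ring_1) mpoly) set"
  assumes T: "Modules.module_hom vec_scale vec_scale T"
    and inj: "\<And>z. z \<in> Z \<Longrightarrow> T z = 0 \<Longrightarrow> z = 0"
    and hom: "\<And>z. hom 1 z \<Longrightarrow> hom 1 (T z)"
    and Z: "linear_upto i Z"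
  shows "linear_upto i (T ` Z)"
proof (cases i)
  case (Suc i')
  with Z obtain gs where gs: "\<forall>g\<in>set gs. hom 1 g" "K_indep gs" "vec_span (set gs) = Z" "linear_upto i' (syz gs)"
    by auto
  interpret T: Modules.module_hom vec_scale vec_scale T by (rule T)
  have comb: "lin_comb (map T gs) c = T (lin_comb gs c)" for c
    by (simp add: lin_comb_eq_sum T.sum T.scale)
  have "lin_comb (map T gs) c = 0 \<longleftrightarrow> lin_comb gs c = 0" for c
    using inj[of "lin_comb gs c"] lin_comb_in_span[of gs c] gs(3) by (auto simp: comb T.zero)
  hence "syz (map T gs) = syz gs" by (simp add: syz_def)
  moreover have "vec_span (set (map T gs)) = T ` Z"
    using T.span_image[of "set gs"] gs(3) by (simp add: vec_span_def)
  ultimately show ?thesis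
    using gs hom Suc by (auto intro!: exI[of _ "map T gs"] simp: K_indep_def)
qed simp

text \<open>
  For \<open>0 \<rightarrow> Z' \<rightarrow> Z \<rightarrow> Z'' \<rightarrow> 0\<close> the generators of \<open>Z'\<close> together with lifts of the generators
  of \<open>Z''\<close> generate \<open>Z\<close>, and their syzygies form again such an extension.
\<close>

lemma linear_upto_extension:
  fixes Z :: "(nat \<Rightarrow> ('v::finite, 'k::comm_ring_1) mpoly) set"
  assumes "vecs.subspace Z" and "\<And>z. z \<in> Z \<Longrightarrow> component mon_degree 0 1 z \<in> Z"
    and "linear_upto i {z \<in> Z. \<forall>j\<ge>r. z j = 0}" and "linear_upto i (shift r ` Z)"
  shows "linear_upto i Z"
  using assms
proof (induction i arbitrary: r Z)
  case (Suc i)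
  define Z' where "Z' = {z \<in> Z. \<forall>j\<ge>r. z j = 0}"
  obtain gs where gs: "\<forall>g\<in>set gs. hom 1 g" "K_indep gs" "vec_span (set gs) = Z'" "linear_upto i (syz gs)"
    using Suc.prems(3) by (auto simp: Z'_def)
  obtain hs where hs: "\<forall>g\<in>set hs. hom 1 g" "K_indep hs" "vec_span (set hs) = shift r ` Z" "linear_upto i (syz hs)"
    using Suc.prems(4) unfolding linear_upto.simps by blast
  \<comment> \<open>The degree 1 component of any preimage is still a preimage, because
    \<open>h\<close> is homogeneous of degree 1 and \<open>shift\<close> only renumbers
    coordinates.\<close>
  have "\<exists>l. l \<in> Z \<and> hom 1 l \<and> shift r l = h" if h: "h \<in> set hs" for h
  proof -
    obtain z where z: "z \<in> Z" "h = shift r z"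
      using vecs.span_base[OF h] unfolding hs(3) by (elim imageE)
    have "shift r (component mon_degree 0 1 z) = component mon_degree 0 1 h"
      by (simp add: z(2) component_def fun_eq_iff)
    also have "\<dots> = h" using hs(1) h by (simp add: component_eq_self_iff)
    finally show ?thesis using Suc.prems(2)[OF z(1)] is_hom_component by blast
  qed
  then obtain lift where lift: "\<And>h. h \<in> set hs \<Longrightarrow> lift h \<in> Z \<and> hom 1 (lift h) \<and> shift r (lift h) = h"
    by metis
  define ls where "ls = map lift hs"
  have ls: "set ls \<subseteq> Z" "\<forall>l\<in>set ls. hom 1 l" "length ls = length hs" using lift by (auto simp: ls_def)
  have gsZ: "set gs \<subseteq> Z'" using gs(3) vecs.span_superset by blast
  have shift_gs: "shift r (lin_comb gs c) = 0" for c
    using lin_comb_in_span[of gs c] gs(3) by (auto simp: Z'_def fun_eq_iff)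
  have shift_ls: "shift r (lin_comb ls c) = lin_comb hs c" for c
  proof
    fix i
    have "(ls ! j) (r + i) = (hs ! j) i" if "j < length hs" for j
      using lift[of "hs ! j"] that by (auto simp: ls_def fun_eq_iff)
    thus "shift r (lin_comb ls c) i = lin_comb hs c i" by (simp add: lin_comb_def ls(3))
  qed
  define p where "p = length gs"
  have comb: "lin_comb (gs @ ls) c = lin_comb gs c + lin_comb ls (shift p c)" for c
    by (simp add: lin_comb_append p_def)
  have shift_comb: "shift r (lin_comb (gs @ ls) c) = lin_comb hs (shift p c)" for c
  proof -
    have "shift r (lin_comb (gs @ ls) c) = shift r (lin_comb gs c) + shift r (lin_comb ls (shift p c))"
      unfolding comb by (simp add: fun_eq_iff)
    thus ?thesis by (simp add: shift_gs shift_ls)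
  qed
  have span: "vec_span (set (gs @ ls)) = Z"
  proof
    show "vec_span (set (gs @ ls)) \<subseteq> Z"
    proof (rule vecs.span_minimal[OF _ Suc.prems(1)])
      show "set (gs @ ls) \<subseteq> Z" using gsZ ls(1) by (auto simp: Z'_def)
    qed
    show "Z \<subseteq> vec_span (set (gs @ ls))"
    proof
      fix z assume z: "z \<in> Z"
      hence "shift r z \<in> vec_span (set hs)" using hs(3) by blast
      then obtain d where d: "shift r z = lin_comb hs d" by (auto simp: vec_span_set)
      have "z - lin_comb ls d \<in> Z"
        using z Suc.prems(1) ls(1) by (intro vecs.subspace_diff lin_comb_in_subspace)
      moreover have "(z - lin_comb ls d) j = 0" if "j \<ge> r" for j
        using fun_cong[OF d, of "j - r"] fun_cong[OF shift_ls[of d], of "j - r"] that by simp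
      ultimately have "z - lin_comb ls d \<in> vec_span (set gs)" using gs(3) by (auto simp: Z'_def)
      hence "z - lin_comb ls d \<in> vec_span (set (gs @ ls))"
        using vecs.span_mono[of "set gs" "set (gs @ ls)"] by auto
      moreover have "lin_comb ls d \<in> vec_span (set (gs @ ls))"
        using vecs.span_mono[of "set ls" "set (gs @ ls)"] lin_comb_in_span[of ls d] by auto
      ultimately have "(z - lin_comb ls d) + lin_comb ls d \<in> vec_span (set (gs @ ls))"
        by (rule vecs.span_add)
      thus "z \<in> vec_span (set (gs @ ls))" by simp
    qed
  qed
  have syz_hs: "shift p c \<in> syz hs" if "c \<in> syz (gs @ ls)" for c
    using that shift_comb[of c] by (auto simp: syz_def p_def ls(3) fun_eq_iff)
  have syz_gs: "syz gs = {c \<in> syz (gs @ ls). \<forall>j\<ge>p. c j = 0}"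
  proof -
    have "lin_comb ls (shift p c) = 0" if "\<forall>j\<ge>p. c j = 0" for c
      using that lin_comb_cong[of ls "shift p c" 0] by simp
    thus ?thesis by (auto simp: syz_def comb p_def)
  qed
  have "K_indep (gs @ ls)"
    unfolding K_indep_def
  proof (intro ballI impI)
    fix c assume c: "c \<in> syz (gs @ ls)" "hom 0 c"
    have "shift p c = 0"
      using hs(2) syz_hs[OF c(1)] c(2) by (auto simp: K_indep_def is_hom_def)
    hence "shift p c (j - p) = 0" for j by (simp only: zero_fun_apply)
    hence "c j = 0" if "j \<ge> p" for j using that by (metis le_add_diff_inverse shift_apply)
    thus "c = 0" using c gs(2) by (auto simp: K_indep_def syz_gs)
  qed
  moreover have "linear_upto i (syz (gs @ ls))"
  proof (rule Suc.IH)
    show "vecs.subspace (syz (gs @ ls))" by (rule subspace_syz)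
    show "component mon_degree 0 1 c \<in> syz (gs @ ls)" if "c \<in> syz (gs @ ls)" for c
    proof -
      have "hom 1 ((gs @ ls) ! j)" if "j < length (gs @ ls)" for j
        using that gs(1) ls(2) nth_mem[OF that] by auto
      hence "component mon_degree (\<lambda>_. 1) (1 + 1) c \<in> syz (gs @ ls)"
        using that by (intro component_syz[where \<rho> = 0] mon_degree_add)
      thus ?thesis by (simp only: component_const)
    qed
    show "linear_upto i {c \<in> syz (gs @ ls). \<forall>j\<ge>p. c j = 0}" using gs(4) by (simp flip: syz_gs)
    \<comment> \<open>A syzygy \<open>d\<close> of \<open>hs\<close>, applied to the lifts, gives an
      element of \<open>Z'\<close>; its coefficients in terms of \<open>gs\<close>, with sign
      reversed, complete \<open>d\<close> to a syzygy of \<open>gs @ ls\<close>.\<close>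
    have "syz hs \<subseteq> shift p ` syz (gs @ ls)"
    proof
      fix d assume d: "d \<in> syz hs"
      have "lin_comb ls d \<in> Z" using Suc.prems(1) ls(1) by (intro lin_comb_in_subspace)
      moreover have "lin_comb ls d j = 0" if "j \<ge> r" for j
        using fun_cong[OF shift_ls[of d], of "j - r"] that d by (simp add: syz_def)
      ultimately have "lin_comb ls d \<in> vec_span (set gs)" using gs(3) by (auto simp: Z'_def)
      then obtain c' where c': "lin_comb ls d = lin_comb gs c'" by (auto simp: vec_span_set)
      define c where "c = (\<lambda>j. if j < p then - c' j else d (j - p))"
      have sh: "shift p c = d" by (simp add: c_def fun_eq_iff)
      have "lin_comb gs c = - lin_comb gs c'"
        by (simp add: lin_comb_def fun_eq_iff c_def p_def sum_negf)
      hence "lin_comb (gs @ ls) c = 0" by (simp add: comb sh c')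
      hence "c \<in> syz (gs @ ls)" using d by (auto simp: syz_def c_def p_def ls(3))
      thus "d \<in> shift p ` syz (gs @ ls)" using sh by blast
    qed
    hence "shift p ` syz (gs @ ls) = syz hs" using syz_hs by blast
    thus "linear_upto i (shift p ` syz (gs @ ls))" using hs(4) by simp
  qed
  ultimately show ?case
    using span gs(1) ls(2) by (auto intro!: exI[of _ "gs @ ls"])
qed simp

text \<open>The last coordinates of the syzygies of \<open>fs @ [f]\<close> form exactly the colon
  ideal of \<open>fs\<close> by \<open>f\<close>, and the syzygies with last coordinate 0 are those
  of \<open>fs\<close>. To this exact sequence the extension lemma applies.\<close>

lemma linear_upto_syz_of_colons:
  fixes fs :: "('v::finite, 'k::comm_ring_1) mpoly list"
  assumes "\<And>f. f \<in> set fs \<Longrightarrow> hom e (emb f)"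
    and "\<And>q. q < length fs \<Longrightarrow> linear_upto i (emb ` colon (ideal_gen (set (take q fs))) (fs ! q))"
  shows "linear_upto i (syz (map emb fs))"
  using assms
proof (induction fs rule: rev_induct)
  case Nil thus ?case by (simp add: linear_upto_zero)
next
  case (snoc f fs)
  define r where "r = length fs"
  define Z where "Z = syz (map emb (fs @ [f]))"
  have comb: "lin_comb (map emb (fs @ [f])) c = lin_comb (map emb fs) c + vec_scale (c r) (emb f)" for c
    by (simp only: map_append lin_comb_append) (simp add: lin_comb_def r_def fun_eq_iff)
  show ?case unfolding Z_def[symmetric]
  proof (rule linear_upto_extension[where r = r])
    show "vecs.subspace Z" unfolding Z_def by (rule subspace_syz)
    show "component mon_degree 0 1 c \<in> Z" if "c \<in> Z" for c
    proof -
      have "hom e (map emb (fs @ [f]) ! j)" if "j < length (map emb (fs @ [f]))" for j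
        using that snoc.prems(1)[of "(fs @ [f]) ! j"] by (metis length_map nth_map nth_mem)
      hence "component mon_degree (\<lambda>_. e) (e + 1) c \<in> Z"
        using that unfolding Z_def by (intro component_syz[where \<rho> = 0] mon_degree_add)
      thus ?thesis by (simp only: component_const)
    qed
    have "{c \<in> Z. \<forall>j\<ge>r. c j = 0} = syz (map emb fs)"
    proof -
      have "lin_comb (map emb (fs @ [f])) c = lin_comb (map emb fs) c" if "\<forall>j\<ge>r. c j = 0" for c
        using that by (simp only: comb) (simp add: fun_eq_iff)
      thus ?thesis by (auto simp del: map_append simp: Z_def syz_def r_def)
    qed
    moreover have "linear_upto i (syz (map emb fs))"
    proof (rule snoc.IH)
      show "hom e (emb g)" if "g \<in> set fs" for g using that by (intro snoc.prems(1)) simp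
      show "linear_upto i (emb ` colon (ideal_gen (set (take q fs))) (fs ! q))" if "q < length fs" for q
        using snoc.prems(2)[of q] that by (simp add: nth_append)
    qed
    ultimately show "linear_upto i {c \<in> Z. \<forall>j\<ge>r. c j = 0}" by simp
    have "shift r ` Z = emb ` colon (ideal_gen (set fs)) f"
    proof
      show "shift r ` Z \<subseteq> emb ` colon (ideal_gen (set fs)) f"
      proof
        fix z assume "z \<in> shift r ` Z"
        then obtain c where c: "c \<in> Z" "z = shift r c" by blast
        have z: "z = emb (c r)"
          using c by (auto simp: Z_def syz_def fun_eq_iff emb_def r_def)
        have "vec_scale (c r) (emb f) = - lin_comb (map emb fs) c"
          using c(1) comb[of c] by (simp add: Z_def syz_def add_eq_0_iff)
        also have "\<dots> \<in> vec_span (emb ` set fs)"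
          using lin_comb_in_span[of "map emb fs"] by (intro vecs.span_neg) simp
        also have "\<dots> = emb ` ideal_gen (set fs)" by (simp add: emb_ideal_gen)
        also have "vec_scale (c r) (emb f) = emb (c r * f)" by (simp add: fun_eq_iff emb_def)
        finally have "c r * f \<in> ideal_gen (set fs)" by auto
        thus "z \<in> emb ` colon (ideal_gen (set fs)) f" by (simp add: z colon_def)
      qed
      show "emb ` colon (ideal_gen (set fs)) f \<subseteq> shift r ` Z"
      proof
        fix z assume "z \<in> emb ` colon (ideal_gen (set fs)) f"
        then obtain g where g: "z = emb g" "g * f \<in> ideal_gen (set fs)" by (auto simp: colon_def)
        hence "emb (g * f) \<in> vec_span (set (map emb fs))" by (simp flip: emb_ideal_gen)
        then obtain d where d: "emb (g * f) = lin_comb (map emb fs) d"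
          unfolding vec_span_set by (elim imageE)
        define c where "c = (\<lambda>j. if j < r then - d j else if j = r then g else 0)"
        have "lin_comb (map emb fs) c = - lin_comb (map emb fs) d"
          by (simp add: lin_comb_def fun_eq_iff c_def r_def sum_negf)
        moreover have "vec_scale g (emb f) = emb (g * f)" by (simp add: fun_eq_iff emb_def)
        ultimately have "lin_comb (map emb (fs @ [f])) c = 0"
          by (simp only: comb) (simp add: c_def d)
        hence "c \<in> Z" by (auto simp: Z_def syz_def c_def r_def)
        moreover have "z = shift r c" by (auto simp: g fun_eq_iff c_def emb_def)
        ultimately show "z \<in> shift r ` Z" by blast
      qed
    qed
    thus "linear_upto i (shift r ` Z)" using snoc.prems(2)[of r] by (simp add: r_def)
  qed
qed

lemma hom_emb_mon: "hom e (emb (mon t :: ('v, 'k::comm_ring_1) mpoly)) \<longleftrightarrow> mon_degree t = e"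
  by (auto simp: is_hom_def emb_def split: if_splits)

lemma K_indep_mon:
  fixes us :: "('v::finite) monomial list"
  assumes "distinct us"
  shows "K_indep (map (\<lambda>u. emb (mon u :: ('v, 'k::comm_ring_1) mpoly)) us)"
  unfolding K_indep_def
proof (intro ballI impI)
  fix c :: "nat \<Rightarrow> ('v, 'k) mpoly"
  assume c: "c \<in> syz (map (\<lambda>u. emb (mon u)) us)" "hom 0 c"
  have const: "c j = Poly_Mapping.single 0 (Poly_Mapping.lookup (c j) 0)" for j
  proof (rule poly_mapping_eqI)
    fix t
    show "Poly_Mapping.lookup (c j) t = Poly_Mapping.lookup (Poly_Mapping.single 0 (Poly_Mapping.lookup (c j) 0)) t"
    proof (cases "t = 0")
      case False
      hence "t \<notin> Poly_Mapping.keys (c j)" using c(2) by (auto simp: is_hom_def mon_degree_eq_0_iff)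
      thus ?thesis using False by (simp add: lookup_single in_keys_iff)
    qed simp
  qed
  have "Poly_Mapping.lookup (c k) 0 = 0" if k: "k < length us" for k
  proof -
    have "(\<Sum>j<length us. c j * mon (us ! j)) = 0"
    proof -
      have "lin_comb (map (\<lambda>u. emb (mon u)) us) c = 0" using c(1) unfolding syz_def by blast
      hence "lin_comb (map (\<lambda>u. emb (mon u)) us) c 0 = 0" by (simp only: zero_fun_apply)
      thus ?thesis by (simp add: lin_comb_def)
    qed
    hence "0 = Poly_Mapping.lookup (\<Sum>j<length us. c j * mon (us ! j)) (us ! k)" by simp
    also have "\<dots> = (\<Sum>j<length us. Poly_Mapping.lookup (c j * mon (us ! j)) (us ! k))"
      by (simp add: lookup_sum)
    also have "\<dots> = (\<Sum>j<length us. if j = k then Poly_Mapping.lookup (c k) 0 else 0)"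
    proof (rule sum.cong)
      fix j assume "j \<in> {..<length us}"
      hence "us ! j = us ! k \<longleftrightarrow> j = k" using assms k by (simp add: nth_eq_iff_index_eq)
      moreover have "c j * mon (us ! j) = Poly_Mapping.single (us ! j) (Poly_Mapping.lookup (c j) 0)"
        by (subst const) (simp add: mon_def mult_single)
      ultimately show "Poly_Mapping.lookup (c j * mon (us ! j)) (us ! k) = (if j = k then Poly_Mapping.lookup (c k) 0 else 0)"
        by (auto simp: lookup_single when_def)
    qed simp
    also have "\<dots> = Poly_Mapping.lookup (c k) 0" using k by simp
    finally show ?thesis by simp
  qed
  moreover have "c j = 0" if "j \<ge> length us" for j using c(1) that by (simp add: syz_def)
  ultimately show "c = 0" by (metis (no_types) const ext not_le single_zero zero_fun_apply)
qed

text \<open>A variable outside \<open>V'\<close> is a nonzerodivisor modulo the ideal of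
  \<open>V'\<close>, so the colon ideals are again generated by variables. The induction on the
  depth lets \<open>V\<close> vary.\<close>

lemma linear_upto_variables:
  "linear_upto i (emb ` ideal_gen (Var ` V :: ('v::finite, 'k::comm_ring_1) mpoly set))"
proof (induction i arbitrary: V)
  case (Suc i)
  obtain vs where vs: "set vs = V" "distinct vs" using finite_distinct_list[OF finite] by blast
  define us where "us = map (\<lambda>v. Poly_Mapping.single v (1::nat)) vs"
  define gs where "gs = map (\<lambda>u. emb (mon u :: ('v, 'k) mpoly)) us"
  have gs: "gs = map emb (map Var vs)" by (simp add: gs_def us_def Var_def)
  have "inj (\<lambda>v::'v. Poly_Mapping.single v (1::nat))"
    by (rule injI) (metis keys_single singleton_inject zero_neq_one)
  hence "distinct us" using vs(2) by (auto simp: us_def distinct_map elim: inj_on_subset)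
  hence "K_indep gs" unfolding gs_def by (rule K_indep_mon)
  moreover have hom: "\<forall>g\<in>set gs. hom 1 g" by (auto simp: gs_def us_def hom_emb_mon)
  moreover have "vec_span (set gs) = emb ` ideal_gen (Var ` V)"
    by (simp add: gs emb_ideal_gen vs(1) image_image)
  moreover have "linear_upto i (syz gs)"
    unfolding gs
  proof (rule linear_upto_syz_of_colons[where e = 1])
    fix q assume q: "q < length (map Var vs :: ('v, 'k) mpoly list)"
    define V' where "V' = set (take q vs)"
    have "vs ! q \<notin> V'"
      using q vs(2) by (auto simp: V'_def in_set_conv_nth nth_eq_iff_index_eq)
    hence "(\<exists>v\<in>V'. mon_dvd (Poly_Mapping.single v (Suc 0)) (Poly_Mapping.single (vs ! q) (Suc 0) + t))
        \<longleftrightarrow> (\<exists>v\<in>V'. Poly_Mapping.lookup t v > 0)" for t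
      by (auto simp: mon_dvd_single_iff lookup_add lookup_single when_def)
    hence "colon (ideal_gen (Var ` V')) (Var (vs ! q) :: ('v, 'k) mpoly) = ideal_gen (Var ` V')"
      unfolding set_eq_iff var_ideal_iff unfolding Var_image unfolding Var_def colon_monomial_iff by simp
    thus "linear_upto i (emb ` colon (ideal_gen (set (take q (map Var vs)))) (map Var vs ! q :: ('v, 'k) mpoly))"
      using q Suc.IH[of V'] by (simp add: take_map V'_def)
  qed (use hom in \<open>auto simp: gs\<close>)
  ultimately show ?case by auto
qed simp

text \<open>The two lists differ by an invertible matrix of constants, which maps syzygies
  bijectively and preserves degree 1. This makes \<open>linear_upto\<close>, which hides its
  generators, comparable with a given resolution.\<close>

lemma linear_upto_base_change:
  fixes gs gs' :: "(nat \<Rightarrow> ('v::finite, 'k::comm_ring_1) mpoly) list"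
  assumes gs: "\<forall>g\<in>set gs. hom e g" "K_indep gs" and gs': "\<forall>g\<in>set gs'. hom e g" "K_indep gs'"
    and span: "vec_span (set gs) = vec_span (set gs')"
    and lin: "linear_upto i (syz gs)"
  shows "linear_upto i (syz gs')"
proof -
  have transition: "\<exists>Q. length Q = length hs \<and> (\<forall>q\<in>set Q. hom 0 q \<and> (\<forall>j\<ge>length hs'. q j = 0)) \<and>
      map (lin_comb hs') Q = hs"
    if homs: "\<forall>g\<in>set hs. hom e g" "\<forall>g\<in>set hs'. hom e g" "vec_span (set hs) = vec_span (set hs')"
    for hs hs' :: "(nat \<Rightarrow> ('v, 'k) mpoly) list"
  proof -
    have "\<exists>q. h = lin_comb hs' q \<and> hom 0 q \<and> (\<forall>j\<ge>length hs'. q j = 0)" if h: "h \<in> set hs" for h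
    proof -
      have "h \<in> vec_span (set hs')" using h homs(3) vecs.span_superset by blast
      moreover have "is_hom mon_degree 0 (e + 0) h" using h homs(1) by simp
      moreover have "is_hom mon_degree 0 e (hs' ! j)" if "j < length hs'" for j
        using that homs(2) by simp
      ultimately obtain q where "h = lin_comb hs' q" "is_hom mon_degree (\<lambda>_. e) (e + 0) q"
        "\<And>j. j \<ge> length hs' \<Longrightarrow> q j = 0"
        using is_hom_in_spanE[OF mon_degree_add, of hs' 0 "\<lambda>_. e" "e + 0" h] by metis
      thus ?thesis by (metis is_hom_const)
    qed
    then obtain Q where Q: "\<And>h. h \<in> set hs \<Longrightarrow> h = lin_comb hs' (Q h) \<and> hom 0 (Q h) \<and> (\<forall>j\<ge>length hs'. Q h j = 0)"
      by metis
    have "map (lin_comb hs') (map Q hs) = hs"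
      using Q by (intro nth_equalityI) (auto simp flip: Q)
    thus ?thesis using Q by (intro exI[of _ "map Q hs"]) auto
  qed
  obtain Q where Q: "length Q = length gs" "\<forall>q\<in>set Q. hom 0 q \<and> (\<forall>j\<ge>length gs'. q j = 0)" "map (lin_comb gs') Q = gs"
    using transition[OF gs(1) gs'(1) span] by blast
  obtain P where P: "length P = length gs'" "\<forall>q\<in>set P. hom 0 q \<and> (\<forall>j\<ge>length gs. q j = 0)" "map (lin_comb gs) P = gs'"
    using transition[OF gs'(1) gs(1) span[symmetric]] by blast
  \<comment> \<open>The difference between the image of a unit vector and the unit vector itself is
    a syzygy with constant coefficients, hence 0 by K-independence.\<close>
  have inverse: "lin_comb P (lin_comb Q c) = c"
    if PQ: "length Q = length gs" "\<forall>q\<in>set Q. hom 0 q \<and> (\<forall>j\<ge>length gs'. q j = 0)" "map (lin_comb gs') Q = gs"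
      "length P = length gs'" "\<forall>q\<in>set P. hom 0 q \<and> (\<forall>j\<ge>length gs. q j = 0)" "map (lin_comb gs) P = gs'"
      and ind: "K_indep gs" and c: "\<And>j. j \<ge> length gs \<Longrightarrow> c j = 0"
    for P Q gs gs' and c :: "nat \<Rightarrow> ('v, 'k) mpoly"
  proof -
    have "lin_comb P (Q ! a) = unit a" if a: "a < length gs" for a
    proof -
      have Qa: "Q ! a \<in> set Q" using a PQ(1) by simp
      have "lin_comb gs (lin_comb P (Q ! a)) = lin_comb gs' (Q ! a)"
        unfolding lin_comb_lin_comb PQ(6) ..
      also have "\<dots> = gs ! a" using a PQ(1,3) by (metis nth_map)
      finally have "lin_comb gs (lin_comb P (Q ! a) - unit a) = 0"
        using a by (simp add: lin_comb_diff lin_comb_unit)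
      moreover have "(lin_comb P (Q ! a) - unit a) j = 0" if "j \<ge> length gs" for j
      proof -
        have "(P ! k) j = 0" if "k < length P" for k
          using PQ(5) \<open>j \<ge> length gs\<close> nth_mem[OF that] by blast
        thus ?thesis using that a by (auto simp: lin_comb_def unit_def intro!: sum.neutral)
      qed
      moreover have "hom 0 (lin_comb P (Q ! a))"
        using PQ(2,5) Qa by (intro is_hom_lin_comb[where \<delta> = 0] mon_degree_add) auto
      hence "hom 0 (lin_comb P (Q ! a) - unit a)"
        by (auto simp: is_hom_def in_keys_iff lookup_minus unit_def lookup_one when_def split: if_splits)
      ultimately have "lin_comb P (Q ! a) - unit a = 0"
        using ind unfolding K_indep_def syz_def by blast
      thus ?thesis by simp
    qed
    hence "map (lin_comb P) Q = map unit [0..<length gs]"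
      using PQ(1) by (intro nth_equalityI) auto
    thus ?thesis unfolding lin_comb_lin_comb using c by (simp add: lin_comb_units)
  qed
  have maps: "lin_comb Q c \<in> syz gs'" if PQ: "\<forall>q\<in>set Q. hom 0 q \<and> (\<forall>j\<ge>length gs'. q j = 0)"
    "map (lin_comb gs') Q = gs" and c: "c \<in> syz gs" for Q gs gs' and c :: "nat \<Rightarrow> ('v, 'k) mpoly"
  proof -
    have "lin_comb gs' (lin_comb Q c) = lin_comb gs c" unfolding lin_comb_lin_comb PQ(2) ..
    moreover have "lin_comb Q c j = 0" if "j \<ge> length gs'" for j
    proof -
      have "(Q ! k) j = 0" if "k < length Q" for k
        using PQ(1) \<open>j \<ge> length gs'\<close> nth_mem[OF that] by blast
      thus ?thesis by (auto simp: lin_comb_def intro!: sum.neutral)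
    qed
    ultimately show ?thesis using c by (auto simp: syz_def)
  qed
  have "lin_comb Q ` syz gs = syz gs'"
  proof
    show "lin_comb Q ` syz gs \<subseteq> syz gs'" using maps[OF Q(2,3)] by blast
    show "syz gs' \<subseteq> lin_comb Q ` syz gs"
    proof
      fix c assume c: "c \<in> syz gs'"
      hence "lin_comb Q (lin_comb P c) = c"
        by (intro inverse[OF P Q gs'(2)]) (simp add: syz_def)
      thus "c \<in> lin_comb Q ` syz gs" using maps[OF P(2,3) c] by (metis imageI)
    qed
  qed
  moreover have "linear_upto i (lin_comb Q ` syz gs)"
  proof (rule linear_upto_image[OF module_hom_lin_comb _ _ lin])
    fix z assume z: "z \<in> syz gs" "lin_comb Q z = 0"
    hence "lin_comb P (lin_comb Q z) = z"
      by (intro inverse[OF Q P gs(2)]) (simp add: syz_def)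
    thus "z = 0" using z(2) by simp
  next
    fix z :: "nat \<Rightarrow> ('v, 'k) mpoly" assume "hom 1 z"
    thus "hom 1 (lin_comb Q z)"
      using Q(2) by (intro is_hom_lin_comb[where \<delta> = 0] mon_degree_add) auto
  qed
  ultimately show ?thesis by simp
qed

text \<open>
  Expressing \<open>gs ! b\<close> through \<open>hs\<close> and back through \<open>gs\<close> yields a syzygy whose entry \<open>b\<close> has
  constant term 1 unless some coefficient in the first step is a nonzero constant.
\<close>

lemma minimal_generator_degree:
  fixes gs hs :: "(nat \<Rightarrow> ('v::finite, 'k::comm_ring_1) mpoly) list"
  assumes span: "vec_span (set gs) = vec_span (set hs)"
    and hs: "\<And>h. h \<in> set hs \<Longrightarrow> is_hom mon_degree \<rho> e h"
    and gs: "\<And>b. b < length gs \<Longrightarrow> is_hom mon_degree \<rho> (\<delta> b) (gs ! b)"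
    and minimal: "\<And>c j. c \<in> syz gs \<Longrightarrow> Poly_Mapping.lookup (c j) 0 = 0"
    and b: "b < length gs"
  shows "\<delta> b = e"
proof -
  have "\<exists>c. h = lin_comb gs c \<and> (\<forall>j\<ge>length gs. c j = 0)" if "h \<in> set hs" for h
  proof -
    have "h \<in> vec_span (set gs)" using that span vecs.span_superset by blast
    thus ?thesis by (metis in_vec_span_setE)
  qed
  then obtain C where C: "\<And>h. h \<in> set hs \<Longrightarrow> h = lin_comb gs (C h) \<and> (\<forall>j\<ge>length gs. C h j = 0)"
    by metis
  have "gs ! b \<in> vec_span (set hs)"
    using b span vecs.span_superset[of "set gs"] nth_mem[OF b] by blast
  moreover have "is_hom mon_degree \<rho> e (hs ! j)" if "j < length hs" for j using hs that by simp
  ultimately obtain d where d: "gs ! b = lin_comb hs d" "is_hom mon_degree (\<lambda>_. e) (\<delta> b) d"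
    using is_hom_in_spanE[OF mon_degree_add, of hs \<rho> "\<lambda>_. e" "\<delta> b" "gs ! b"] gs[OF b] by metis
  define c where "c = lin_comb (map C hs) d"
  have "map (lin_comb gs) (map C hs) = hs"
    using C by (intro nth_equalityI) (auto simp flip: C)
  hence "lin_comb gs c = gs ! b" unfolding c_def lin_comb_lin_comb by (simp add: d(1))
  moreover have "c j = 0" if "j \<ge> length gs" for j
    using that C nth_mem[of _ hs] by (auto simp: c_def lin_comb_def intro!: sum.neutral)
  moreover have "unit b j = (0 :: ('v, 'k) mpoly)" if "j \<ge> length gs" for j
    using that b by (auto simp: unit_def)
  ultimately have "unit b - c \<in> syz gs"
    using b by (simp add: syz_def lin_comb_diff lin_comb_unit)
  from minimal[OF this, of b] have "Poly_Mapping.lookup (c b) 0 \<noteq> 0"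
    by (simp add: lookup_minus unit_def)
  hence "0 \<in> Poly_Mapping.keys (\<Sum>j<length hs. d j * C (hs ! j) b)"
    by (simp add: in_keys_iff c_def lin_comb_def)
  then obtain j where "0 \<in> Poly_Mapping.keys (d j * C (hs ! j) b)"
    using keys_sum[of "\<lambda>j. d j * C (hs ! j) b" "{..<length hs}"] by blast
  then obtain s t where "s \<in> Poly_Mapping.keys (d j)" "0 = s + t"
    using keys_mult[of "d j" "C (hs ! j) b"] by blast
  \<comment> \<open>Exponents are natural numbers, so \<open>s = 0\<close>: the coefficient
    \<open>d j\<close> has a constant term, and homogeneity equates the two degrees.\<close>
  hence "0 \<in> Poly_Mapping.keys (d j)"
    by (metis add_is_0 mon_degree_add mon_degree_eq_0_iff)
  thus ?thesis using d(2) unfolding is_hom_def by (metis add_0_right mon_degree_zero)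
qed

section \<open>Existence of minimal free resolutions\<close>

text \<open>
  Monomials serve as multidegrees. Dividing a homogeneous syzygy by a monomial shows that the
  syzygies are generated in the multidegrees dividing a common multiple of the multidegrees of the
  generators, so no Noetherianity argument is needed.
\<close>

abbreviation multihom :: "(nat \<Rightarrow> 'v monomial) \<Rightarrow> 'v monomial \<Rightarrow> (nat \<Rightarrow> ('v, 'k::comm_ring_1) mpoly) \<Rightarrow> bool" where
  "multihom \<equiv> is_hom (\<lambda>t. t)"

lemma is_hom_diff: "is_hom deg \<rho> \<gamma> z \<Longrightarrow> is_hom deg \<rho> \<gamma> w \<Longrightarrow> is_hom deg \<rho> \<gamma> (z - w)"
  unfolding is_hom_def by (metis (no_types, opaque_lifting) diff_zero in_keys_iff lookup_minus minus_apply)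

text \<open>A multidegree leaves room for one monomial per coordinate. If \<open>\<rho> j\<close>
  does not divide \<open>c\<close>, the truncated difference is harmless, because \<open>z j\<close>
  is then 0.\<close>

lemma multihom_eq_single:
  fixes z :: "nat \<Rightarrow> ('v, 'k::comm_ring_1) mpoly"
  assumes "multihom \<rho> c z"
  shows "z j = Poly_Mapping.single (c - \<rho> j) (Poly_Mapping.lookup (z j) (c - \<rho> j))"
proof (rule poly_mapping_eqI)
  fix t
  have "t = c - \<rho> j" if "t \<in> Poly_Mapping.keys (z j)"
  proof -
    have "\<rho> j + t = c" using assms that by (simp add: is_hom_def)
    thus ?thesis by auto
  qed
  thus "Poly_Mapping.lookup (z j) t =
      Poly_Mapping.lookup (Poly_Mapping.single (c - \<rho> j) (Poly_Mapping.lookup (z j) (c - \<rho> j))) t"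
    by (auto simp: lookup_single when_def in_keys_iff)
qed

lemma multihom_scale_const:
  fixes z :: "nat \<Rightarrow> ('v, 'k::comm_ring_1) mpoly"
  assumes "multihom \<rho> c z"
  shows "multihom \<rho> c (vec_scale (Poly_Mapping.single 0 a) z)"
  unfolding is_hom_def
proof (intro allI ballI)
  fix i t assume "t \<in> Poly_Mapping.keys (vec_scale (Poly_Mapping.single 0 a) z i)"
  hence "t \<in> Poly_Mapping.keys (z i)"
    using keys_mult[of "Poly_Mapping.single 0 a" "z i"] by (auto split: if_splits)
  thus "\<rho> i + t = c" using assms by (simp add: is_hom_def)
qed

lemma vec_span_insert_redundant: "x \<in> vec_span S \<Longrightarrow> vec_span (insert x S) = vec_span S"
  by (intro antisym vecs.span_minimal vecs.span_mono) (auto intro: vecs.span_base)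

text \<open>Gaussian elimination inside one multidegree: the last admissible coordinate is a scalar
  times a fixed monomial, so each coordinate contributes at most one new generator.\<close>

lemma finitely_generated_multidegree:
  fixes Z :: "(nat \<Rightarrow> ('v, 'k::field) mpoly) set"
  assumes Z: "vecs.subspace Z" and supp: "\<And>z j. z \<in> Z \<Longrightarrow> j \<ge> p \<Longrightarrow> z j = 0"
  shows "\<exists>F. finite F \<and> F \<subseteq> {z \<in> Z. multihom \<rho> c z} \<and> {z \<in> Z. multihom \<rho> c z} \<subseteq> vec_span F"
proof -
  define Zc where "Zc = {z \<in> Z. multihom \<rho> c z}"
  have "\<exists>F. finite F \<and> F \<subseteq> Zc \<and> {z \<in> Zc. \<forall>j\<ge>n. z j = 0} \<subseteq> vec_span F" for n
  proof (induction n)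
    case 0
    have "{z \<in> Zc. \<forall>j\<ge>0. z j = 0} \<subseteq> {0}" by (auto simp: fun_eq_iff)
    also have "\<dots> = vec_span {}" by simp
    finally show ?case by (intro exI[of _ "{}"]) simp
  next
    case (Suc n)
    then obtain F where F: "finite F" "F \<subseteq> Zc" "{z \<in> Zc. \<forall>j\<ge>n. z j = 0} \<subseteq> vec_span F" by blast
    show ?case
    proof (cases "\<exists>w\<in>Zc. (\<forall>j\<ge>Suc n. w j = 0) \<and> w n \<noteq> 0")
      case False
      hence *: "z j = 0" if "z \<in> Zc" "\<forall>j\<ge>Suc n. z j = 0" "j \<ge> n" for z j
        using that by (cases "j = n") auto
      have "{z \<in> Zc. \<forall>j\<ge>Suc n. z j = 0} \<subseteq> {z \<in> Zc. \<forall>j\<ge>n. z j = 0}"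
        by safe (rule *)
      with F(3) have "{z \<in> Zc. \<forall>j\<ge>Suc n. z j = 0} \<subseteq> vec_span F" by (rule subset_trans[rotated])
      thus ?thesis using F(1,2) by (intro exI[of _ F] conjI)
    next
      case True
      then obtain w where w: "w \<in> Zc" "\<forall>j\<ge>Suc n. w j = 0" "w n \<noteq> 0" by blast
      define t where "t = c - \<rho> n"
      define b where "b = Poly_Mapping.lookup (w n) t"
      have wn: "w n = Poly_Mapping.single t b"
        using w(1) multihom_eq_single[of \<rho> c w n] by (simp add: Zc_def t_def b_def)
      hence b: "b \<noteq> 0" using w(3) by auto
      have "z \<in> vec_span (insert w F)" if z: "z \<in> Zc" "\<forall>j\<ge>Suc n. z j = 0" for z
      proof -
        define a where "a = Poly_Mapping.lookup (z n) t"
        define u where "u = vec_scale (Poly_Mapping.single 0 (a / b)) w"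
        have zn: "z n = Poly_Mapping.single t a"
          using z(1) multihom_eq_single[of \<rho> c z n] by (simp add: Zc_def t_def a_def)
        have "z - u \<in> Zc"
          using z(1) w(1) Z unfolding Zc_def u_def
          by (auto intro!: vecs.subspace_diff vecs.subspace_scale is_hom_diff multihom_scale_const
              simp del: vec_scale_apply)
        moreover have "(z - u) j = 0" if "j \<ge> n" for j
        proof (cases "j = n")
          case True
          thus ?thesis using b by (simp add: u_def zn wn mult_single)
        next
          case False
          thus ?thesis using that z(2) w(2) by (simp add: u_def)
        qed
        ultimately have "z - u \<in> vec_span F" using F(3) by blast
        hence "z - u \<in> vec_span (insert w F)" using vecs.span_mono[of F "insert w F"] by blast
        moreover have "u \<in> vec_span (insert w F)"
          unfolding u_def by (intro vecs.span_scale vecs.span_base) simp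
        ultimately have "(z - u) + u \<in> vec_span (insert w F)" by (rule vecs.span_add)
        thus ?thesis by simp
      qed
      hence "{z \<in> Zc. \<forall>j\<ge>Suc n. z j = 0} \<subseteq> vec_span (insert w F)" by (intro subsetI) (elim CollectE conjE)
      thus ?thesis using F(1,2) w(1) by (intro exI[of _ "insert w F"] conjI) auto
    qed
  qed
  from this[of p] obtain F where F: "finite F" "F \<subseteq> Zc" "{z \<in> Zc. \<forall>j\<ge>p. z j = 0} \<subseteq> vec_span F" by blast
  moreover have "{z \<in> Zc. \<forall>j\<ge>p. z j = 0} = Zc" using supp by (auto simp: Zc_def)
  ultimately show ?thesis unfolding Zc_def[symmetric] by auto
qed

lemma sum_components:
  fixes z :: "nat \<Rightarrow> ('v, 'k::comm_ring_1) mpoly"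
  assumes "\<And>j. j \<ge> p \<Longrightarrow> z j = 0"
  shows "\<exists>C. finite C \<and> z = (\<Sum>c\<in>C. component deg \<rho> c z)"
proof (intro exI conjI)
  define C where "C = (\<Union>j<p. (\<lambda>t. \<rho> j + deg t) ` Poly_Mapping.keys (z j))"
  show fin: "finite C" by (simp add: C_def)
  show "z = (\<Sum>c\<in>C. component deg \<rho> c z)"
  proof
    fix j
    have sum: "(\<Sum>c\<in>A. component deg \<rho> c z) j = (\<Sum>c\<in>A. component deg \<rho> c z j)" for A
      by (induction A rule: infinite_finite_induct) auto
    show "z j = (\<Sum>c\<in>C. component deg \<rho> c z) j"
      unfolding sum
    proof (rule poly_mapping_eqI)
      fix t
      have "Poly_Mapping.lookup (\<Sum>c\<in>C. component deg \<rho> c z j) t =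
          (\<Sum>c\<in>C. if c = \<rho> j + deg t then Poly_Mapping.lookup (z j) t else 0)"
        unfolding lookup_sum by (rule sum.cong) (auto simp: component_def lookup_part when_def)
      also have "\<dots> = Poly_Mapping.lookup (z j) t"
      proof (cases "t \<in> Poly_Mapping.keys (z j)")
        case True
        hence "j < p" using assms by (metis keys_zero empty_iff not_le)
        hence "\<rho> j + deg t \<in> C" using True by (auto simp: C_def)
        thus ?thesis using fin by (simp add: sum.delta)
      qed (simp add: in_keys_iff)
      finally show "Poly_Mapping.lookup (z j) t = Poly_Mapping.lookup (\<Sum>c\<in>C. component deg \<rho> c z j) t"
        by simp
    qed
  qed
qed

text \<open>Minimality comes from a homogeneous generating set of least cardinality: a syzygy with a
  nonzero constant term would express one generator through the others. The multidegrees
  \<open>ns\<close> are recorded because they grade the basis in the next step.\<close>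

lemma minimal_generators_of_syz:
  fixes gs :: "(nat \<Rightarrow> ('v::finite, 'k::field) mpoly) list"
  assumes len: "length gs = length ms"
    and hom: "\<And>j. j < length gs \<Longrightarrow> multihom \<rho> (ms ! j) (gs ! j)"
  shows "\<exists>hs ns. length hs = length ns \<and> (\<forall>j<length hs. multihom ((!) ms) (ns ! j) (hs ! j)) \<and>
    vec_span (set hs) = syz gs \<and> (\<forall>c\<in>syz hs. \<forall>j. Poly_Mapping.lookup (c j) 0 = 0)"
proof -
  \<comment> \<open>A common multiple of the multidegrees: their product, written
    additively.\<close>
  define L where "L = (\<Sum>j<length ms. ms ! j)"
  have L: "mon_dvd (ms ! j) L" if "j < length ms" for j
  proof -
    have "L = ms ! j + (\<Sum>i\<in>{..<length ms} - {j}. ms ! i)"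
      unfolding L_def using that by (intro sum.remove) auto
    thus ?thesis by (auto simp: mon_dvd_iff_add)
  qed
  define gen where "gen F \<longleftrightarrow> finite F \<and> vec_span F = syz gs \<and> (\<forall>f\<in>F. \<exists>c. multihom ((!) ms) c f)"
    for F :: "(nat \<Rightarrow> ('v, 'k) mpoly) set"
  have supp: "z j = 0" if "z \<in> syz gs" "j \<ge> length gs" for z j using that by (simp add: syz_def)
  have "\<forall>c. \<exists>F. finite F \<and> F \<subseteq> {z \<in> syz gs. multihom ((!) ms) c z} \<and>
      {z \<in> syz gs. multihom ((!) ms) c z} \<subseteq> vec_span F"
    by (intro allI finitely_generated_multidegree[where p = "length gs"] subspace_syz supp)
  then obtain F where "\<forall>c. finite (F c) \<and> F c \<subseteq> {z \<in> syz gs. multihom ((!) ms) c z} \<and>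
      {z \<in> syz gs. multihom ((!) ms) c z} \<subseteq> vec_span (F c)"
    unfolding choice_iff by (elim exE)
  hence F: "finite (F c)" "F c \<subseteq> {z \<in> syz gs. multihom ((!) ms) c z}"
    "{z \<in> syz gs. multihom ((!) ms) c z} \<subseteq> vec_span (F c)" for c
    by simp_all
  define F0 where "F0 = (\<Union>c\<in>{c. mon_dvd c L}. F c)"
  have hom_in: "z \<in> vec_span F0" if z: "z \<in> syz gs" "multihom ((!) ms) c z" for c z
  proof -
    \<comment> \<open>\<open>c'\<close> is the greatest common divisor of \<open>c\<close> and
      \<open>L\<close>, and \<open>z'\<close> is \<open>z\<close> divided by the monomial
      \<open>r\<close>. Where \<open>z j\<close> is nonzero, \<open>ms ! j\<close> divides both
      \<open>c\<close> and \<open>L\<close>, hence \<open>c'\<close>, so the division is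
      exact.\<close>
    define c' where "c' = mon_of_fun (\<lambda>v. min (Poly_Mapping.lookup c v) (Poly_Mapping.lookup L v))"
    define r where "r = c - c'"
    define z' where "z' j = (if z j = 0 then 0 else
        Poly_Mapping.single (c' - ms ! j) (Poly_Mapping.lookup (z j) (c - ms ! j)))" for j
    have c'L: "mon_dvd c' L" by (simp add: mon_dvd_def c'_def)
    have dvd: "ms ! j + (c' - ms ! j) = c' \<and> c - ms ! j = r + (c' - ms ! j)" if nz: "z j \<noteq> 0" for j
    proof -
      have j: "j < length ms" using supp[OF z(1)] nz len by (metis not_le)
      obtain t where "t \<in> Poly_Mapping.keys (z j)"
        using nz by (metis in_keys_iff lookup_zero poly_mapping_eqI)
      hence "ms ! j + t = c" using z(2) by (simp add: is_hom_def)
      hence "mon_dvd (ms ! j) c" by (auto simp: mon_dvd_iff_add)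
      thus ?thesis using L[OF j]
        by (auto intro!: poly_mapping_eqI simp: mon_dvd_def lookup_add lookup_minus r_def c'_def min_def)
    qed
    have "z = vec_scale (mon r) z'"
    proof
      fix j show "z j = vec_scale (mon r) z' j"
        using dvd[of j] multihom_eq_single[OF z(2), of j]
        by (cases "z j = 0") (simp_all add: z'_def mon_def mult_single)
    qed
    note z_eq = this
    have "vec_scale (mon r) (lin_comb gs z') = lin_comb gs z"
      by (subst z_eq) (simp only: lin_comb_scale)
    also have "\<dots> = 0" using z(1) unfolding syz_def by (elim CollectE conjE)
    finally have "mon r * lin_comb gs z' j = 0" for j
      by (metis vec_scale_apply zero_fun_apply)
    hence "lin_comb gs z' j = 0" for j by (simp add: mon_mult_eq_0_iff)
    hence "lin_comb gs z' = 0" by (intro ext) simp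
    hence z'_syz: "z' \<in> syz gs" using supp[OF z(1)] by (simp add: syz_def z'_def)
    have z'_hom: "multihom ((!) ms) c' z'"
      using dvd by (auto simp: is_hom_def z'_def split: if_splits)
    have "z' \<in> vec_span (F c')" using F(3)[of c'] z'_syz z'_hom by (auto intro: subsetD)
    moreover have "vec_span (F c') \<subseteq> vec_span F0"
      using c'L by (intro vecs.span_mono) (auto simp: F0_def)
    ultimately show ?thesis unfolding z_eq by (intro vecs.span_scale) (rule subsetD)
  qed
  have "vec_span F0 = syz gs"
  proof
    show "vec_span F0 \<subseteq> syz gs"
      using F(2) by (intro vecs.span_minimal subspace_syz) (auto simp: F0_def)
    show "syz gs \<subseteq> vec_span F0"
    proof
      fix z assume z: "z \<in> syz gs"
      obtain C where C: "z = (\<Sum>c\<in>C. component (\<lambda>t. t) ((!) ms) c z)"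
        using sum_components[of "length gs" z "\<lambda>t. t" "(!) ms"] supp[OF z] by blast
      have "component (\<lambda>t. t) ((!) ms) c z \<in> vec_span F0" for c
      proof (rule hom_in[OF _ is_hom_component])
        show "component (\<lambda>t. t) ((!) ms) c z \<in> syz gs"
          by (rule component_syz[where \<rho> = \<rho>]) (use hom z in auto)
      qed
      hence "(\<Sum>c\<in>C. component (\<lambda>t. t) ((!) ms) c z) \<in> vec_span F0" by (intro vecs.span_sum)
      thus "z \<in> vec_span F0" by (simp flip: C)
    qed
  qed
  moreover have "finite F0" using F(1) finite_mon_dvd[of L] by (simp add: F0_def)
  moreover have "\<exists>c. multihom ((!) ms) c f" if f: "f \<in> F0" for f
  proof -
    obtain c where "f \<in> F c" using f unfolding F0_def by (elim UN_E)
    thus ?thesis using F(2)[of c] by (intro exI[of _ c]) auto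
  qed
  ultimately have "gen F0" by (simp add: gen_def)
  then obtain E where E: "gen E" and least: "\<And>F. gen F \<Longrightarrow> card E \<le> card F"
    using ex_has_least_nat[of gen F0 card] by blast
  have "finite E" using E by (simp add: gen_def)
  then obtain hs where hs: "set hs = E" "distinct hs"
    using finite_distinct_list by metis
  have "\<forall>h\<in>set hs. \<exists>c. multihom ((!) ms) c h" using E hs(1) by (simp add: gen_def)
  then obtain \<nu> where \<nu>: "\<And>h. h \<in> set hs \<Longrightarrow> multihom ((!) ms) (\<nu> h) h" by metis
  define ns where "ns = map \<nu> hs"
  have hom': "multihom ((!) ms) (ns ! j) (hs ! j)" if "j < length hs" for j
    using \<nu> that by (simp add: ns_def)
  have "Poly_Mapping.lookup (c j) 0 = 0" if c: "c \<in> syz hs" for c j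
  proof (rule ccontr)
    assume nz: "Poly_Mapping.lookup (c j) 0 \<noteq> 0"
    hence j: "j < length hs" using c by (auto simp: syz_def not_le[symmetric])
    define a where "a = Poly_Mapping.lookup (c j) 0"
    \<comment> \<open>In the multidegree of generator \<open>j\<close>, entry \<open>j\<close> of
      the syzygy is exactly the nonzero constant \<open>a\<close>, which can be inverted.\<close>
    define c' where "c' = component (\<lambda>t. t) ((!) ns) (ns ! j) c"
    have "c' \<in> syz hs"
      unfolding c'_def by (rule component_syz[where \<rho> = "(!) ms"]) (use hom' c in auto)
    hence zero: "lin_comb hs c' = 0" by (simp add: syz_def)
    have c'j: "c' j = Poly_Mapping.single 0 a"
      by (rule poly_mapping_eqI) (simp add: c'_def component_def lookup_part lookup_single a_def when_def)
    define d where "d = c' - vec_scale (c' j) (unit j)"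
    have "lin_comb hs d = - vec_scale (c' j) (hs ! j)"
      by (simp only: d_def lin_comb_diff zero lin_comb_scale lin_comb_unit[OF j] diff_0)
    hence "hs ! j = vec_scale (Poly_Mapping.single 0 (- 1 / a)) (lin_comb hs d)"
      using nz by (simp add: fun_eq_iff c'j a_def mult_single single_uminus flip: mult.assoc)
    moreover have "lin_comb hs d \<in> vec_span (E - {hs ! j})"
      unfolding lin_comb_eq_sum
    proof (rule vecs.span_sum)
      fix i assume i: "i \<in> {..<length hs}"
      show "vec_scale (d i) (hs ! i) \<in> vec_span (E - {hs ! j})"
      proof (cases "i = j")
        case True
        hence "vec_scale (d i) (hs ! i) = 0" by (simp add: fun_eq_iff d_def unit_def)
        thus ?thesis by (simp only: vecs.span_zero)
      next
        case False
        hence "hs ! i \<in> E - {hs ! j}" using i j hs by (auto simp: nth_eq_iff_index_eq)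
        thus ?thesis by (intro vecs.span_scale vecs.span_base)
      qed
    qed
    ultimately have "hs ! j \<in> vec_span (E - {hs ! j})" by (metis vecs.span_scale)
    hence "vec_span (insert (hs ! j) (E - {hs ! j})) = vec_span (E - {hs ! j})" by (rule vec_span_insert_redundant)
    moreover have jE: "hs ! j \<in> E" using j hs(1) by auto
    ultimately have "gen (E - {hs ! j})" using E by (simp add: gen_def insert_absorb)
    from least[OF this] show False using card_Diff1_less[OF \<open>finite E\<close> jE] by simp
  qed
  moreover have "vec_span (set hs) = syz gs" using E hs(1) by (simp add: gen_def)
  ultimately show ?thesis using hom' by (intro exI[of _ hs] exI[of _ ns]) (auto simp: ns_def)
qed

text \<open>Minimality is stated for all syzygies instead of matrix entries; the two versions agree
  because \<open>gs (Suc i)\<close> generates \<open>syz (gs i)\<close>.\<close>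

definition vec_resolution :: "('v, 'k::field) mpoly set \<Rightarrow> (nat \<Rightarrow> nat list) \<Rightarrow> (nat \<Rightarrow> (nat \<Rightarrow> ('v, 'k) mpoly) list) \<Rightarrow> bool" where
  "vec_resolution I degs gs \<longleftrightarrow>
     (\<forall>i. length (gs i) = length (degs i)) \<and>
     (\<forall>b<length (degs 0). hom (degs 0 ! b) (gs 0 ! b)) \<and>
     (\<forall>i. \<forall>b<length (degs (Suc i)). is_hom mon_degree ((!) (degs i)) (degs (Suc i) ! b) (gs (Suc i) ! b)) \<and>
     vec_span (set (gs 0)) = emb ` I \<and>
     (\<forall>i. vec_span (set (gs (Suc i))) = syz (gs i)) \<and>
     (\<forall>i. \<forall>c\<in>syz (gs i). \<forall>j. Poly_Mapping.lookup (c j) 0 = 0)"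

text \<open>Dependent choice iterates the construction of minimal generators. Its states carry
  multidegrees, from which the total degrees are read off at the end.\<close>

lemma vec_resolution_exists:
  fixes B :: "('v::finite) monomial set"
  assumes "finite B" and deg: "\<And>b. b \<in> B \<Longrightarrow> mon_degree b = d"
  shows "\<exists>degs gs. vec_resolution (ideal_gen (mon ` B) :: ('v, 'k::field) mpoly set) degs gs"
proof -
  obtain us where us: "set us = B" "distinct us" using finite_distinct_list[OF assms(1)] by blast
  define gs0 where "gs0 = map (\<lambda>u. emb (mon u :: ('v, 'k) mpoly)) us"
  define P where "P n x \<longleftrightarrow> (n = 0 \<longrightarrow> x = (gs0, us)) \<and> length (fst x) = length (snd x) \<and>
      (\<exists>\<rho>. \<forall>j<length (fst x). multihom \<rho> (snd x ! j) (fst x ! j)) \<and>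
      (\<forall>c\<in>syz (fst x). \<forall>j. Poly_Mapping.lookup (c j) 0 = 0)"
    for n :: nat and x :: "(nat \<Rightarrow> ('v, 'k) mpoly) list \<times> 'v monomial list"
  define R where "R n x y \<longleftrightarrow> (\<forall>j<length (fst y). multihom ((!) (snd x)) (snd y ! j) (fst y ! j)) \<and>
      vec_span (set (fst y)) = syz (fst x)"
    for n :: nat and x y :: "(nat \<Rightarrow> ('v, 'k) mpoly) list \<times> 'v monomial list"
  have hom0: "multihom 0 (us ! j) (gs0 ! j)" if "j < length gs0" for j
    using that by (auto simp: gs0_def is_hom_def emb_def split: if_splits)
  \<comment> \<open>In the multidegree \<open>us ! j\<close> a syzygy has only constant entries,
    since all generators have degree \<open>d\<close>, and distinct monomials are independent over
    the constants.\<close>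
  have min0: "Poly_Mapping.lookup (c j) 0 = 0" if c: "c \<in> syz gs0" for c j
  proof (cases "j < length us")
    case True
    define c' where "c' = component (\<lambda>t. t) ((!) us) (us ! j) c"
    have "c' \<in> syz gs0"
      unfolding c'_def by (rule component_syz[where \<rho> = 0]) (use hom0 c in auto)
    moreover have "hom 0 c'"
      unfolding is_hom_def
    proof (intro allI ballI)
      fix i t assume t: "t \<in> Poly_Mapping.keys (c' i)"
      hence eq: "us ! i + t = us ! j" by (simp add: c'_def component_def keys_part)
      have "i < length us"
        using t \<open>c' \<in> syz gs0\<close> by (auto simp: syz_def gs0_def not_le[symmetric])
      hence "mon_degree (us ! i) = mon_degree (us ! j)" using True us(1) deg by auto
      thus "0 i + mon_degree t = 0" using arg_cong[OF eq, of mon_degree] by (simp add: mon_degree_add)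
    qed
    ultimately have "c' = 0" using K_indep_mon[OF us(2)] unfolding K_indep_def gs0_def by blast
    hence "Poly_Mapping.lookup (c' j) 0 = 0" by simp
    thus ?thesis by (simp add: c'_def component_def lookup_part)
  next
    case False
    thus ?thesis using c by (simp add: syz_def gs0_def)
  qed
  have "\<exists>f. \<forall>n. P n (f n) \<and> R n (f n) (f (Suc n))"
  proof (rule dependent_nat_choice)
    show "\<exists>x. P 0 x" using hom0 min0 by (auto simp: P_def gs0_def intro!: exI[of _ 0])
    show "\<exists>y. P (Suc n) y \<and> R n x y" if Px: "P n x" for x n
    proof -
      from Px obtain \<rho> where x: "length (fst x) = length (snd x)"
        "\<And>j. j < length (fst x) \<Longrightarrow> multihom \<rho> (snd x ! j) (fst x ! j)"
        unfolding P_def by blast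
      have "\<exists>hs ns. length hs = length ns \<and> (\<forall>j<length hs. multihom ((!) (snd x)) (ns ! j) (hs ! j)) \<and>
          vec_span (set hs) = syz (fst x) \<and> (\<forall>c\<in>syz hs. \<forall>j. Poly_Mapping.lookup (c j) 0 = 0)"
        by (rule minimal_generators_of_syz[where \<rho> = \<rho>]) (use x in auto)
      then obtain hs ns where
        "length hs = length ns \<and> (\<forall>j<length hs. multihom ((!) (snd x)) (ns ! j) (hs ! j)) \<and>
          vec_span (set hs) = syz (fst x) \<and> (\<forall>c\<in>syz hs. \<forall>j. Poly_Mapping.lookup (c j) 0 = 0)"
        by (elim exE)
      hence "P (Suc n) (hs, ns) \<and> R n x (hs, ns)"
        unfolding P_def R_def by (auto intro!: exI[of _ "(!) (snd x)"])
      thus ?thesis ..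
    qed
  qed
  then obtain f where f: "\<And>n. P n (f n)" "\<And>n. R n (f n) (f (Suc n))" by blast
  have f0: "f 0 = (gs0, us)" using f(1)[of 0] by (simp add: P_def)
  have len: "length (fst (f n)) = length (snd (f n))" for n using f(1)[of n] by (simp add: P_def)
  have degree: "is_hom mon_degree (\<lambda>j. mon_degree (\<rho> j)) (mon_degree m) z" if "multihom \<rho> m z"
    for \<rho> m and z :: "nat \<Rightarrow> ('v, 'k) mpoly"
    using that by (auto simp: is_hom_def simp flip: mon_degree_add)
  show ?thesis
  proof (intro exI)
    show "vec_resolution (ideal_gen (mon ` B) :: ('v, 'k) mpoly set) (\<lambda>n. map mon_degree (snd (f n))) (\<lambda>n. fst (f n))"
      unfolding vec_resolution_def
    proof (intro conjI allI impI ballI)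
      fix b assume "b < length (map mon_degree (snd (f 0)))"
      thus "hom (map mon_degree (snd (f 0)) ! b) (fst (f 0) ! b)"
        by (simp add: f0 gs0_def hom_emb_mon)
    next
      fix i b assume b: "b < length (map mon_degree (snd (f (Suc i))))"
      have hom: "multihom ((!) (snd (f i))) (snd (f (Suc i)) ! b) (fst (f (Suc i)) ! b)"
        using f(2)[of i] b len by (simp add: R_def)
      \<comment> \<open>Indexing a list beyond its end gives unspecified degrees, so the entries
        there must be known to vanish.\<close>
      have "fst (f (Suc i)) ! b \<in> syz (fst (f i))"
        using f(2)[of i] b len[of "Suc i"] vecs.span_base[of "fst (f (Suc i)) ! b" "set (fst (f (Suc i)))"]
        by (simp add: R_def)
      hence "(fst (f (Suc i)) ! b) j = 0" if "j \<ge> length (snd (f i))" for j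
        using that len by (simp add: syz_def)
      hence *: "j < length (snd (f i))" if "t \<in> Poly_Mapping.keys ((fst (f (Suc i)) ! b) j)" for j t
        using that by (metis empty_iff keys_zero not_le)
      show "is_hom mon_degree ((!) (map mon_degree (snd (f i)))) (map mon_degree (snd (f (Suc i))) ! b) (fst (f (Suc i)) ! b)"
        using degree[OF hom] b * by (auto simp: is_hom_def)
    next
      show "vec_span (set (fst (f 0))) = emb ` ideal_gen (mon ` B)"
        by (simp add: f0 gs0_def emb_ideal_gen us(1) image_image)
    next
      fix i show "vec_span (set (fst (f (Suc i)))) = syz (fst (f i))"
        using f(2)[of i] by (simp add: R_def)
    next
      fix i c j assume "c \<in> syz (fst (f i))"
      thus "Poly_Mapping.lookup (c j) 0 = 0" using f(1)[of i] by (simp add: P_def)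
    qed (use len in simp)
  qed
qed

section \<open>Betti numbers\<close>

definition vec_fun :: "'a::comm_ring_1 vec \<Rightarrow> nat \<Rightarrow> 'a" where
  "vec_fun v = (\<lambda>i. if i < dim_vec v then v $ i else 0)"

lemma vec_fun_vec: "(\<And>i. i \<ge> n \<Longrightarrow> c i = 0) \<Longrightarrow> vec_fun (vec n c) = c"
  by (auto simp: vec_fun_def fun_eq_iff)

lemma inj_on_vec_fun: "inj_on vec_fun (carrier_vec n)"
proof (rule inj_onI)
  fix v w :: "'a vec"
  assume vw: "v \<in> carrier_vec n" "w \<in> carrier_vec n" and eq: "vec_fun v = vec_fun w"
  show "v = w"
  proof (rule eq_vecI)
    fix i assume "i < dim_vec w"
    thus "v $ i = w $ i" using fun_cong[OF eq, of i] vw by (simp add: vec_fun_def carrier_vecD)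
  qed (use vw in \<open>simp add: carrier_vecD\<close>)
qed

definition mat_cols :: "'a::comm_ring_1 mat \<Rightarrow> nat \<Rightarrow> nat \<Rightarrow> (nat \<Rightarrow> 'a) list \<Rightarrow> bool" where
  "mat_cols A r p gs \<longleftrightarrow> A \<in> carrier_mat r p \<and> length gs = p \<and>
    (\<forall>b<p. (\<forall>a<r. (gs ! b) a = A $$ (a, b)) \<and> (\<forall>a\<ge>r. (gs ! b) a = 0))"

context
  fixes A :: "'a::comm_ring_1 mat" and r p gs
  assumes A: "mat_cols A r p gs"
begin

lemma vec_fun_mult_mat_vec:
  assumes "v \<in> carrier_vec p"
  shows "vec_fun (A *\<^sub>v v) = lin_comb gs (vec_fun v)"
proof
  fix i
  from A have dims: "dim_row A = r" "dim_col A = p" "length gs = p" by (auto simp: mat_cols_def)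
  show "vec_fun (A *\<^sub>v v) i = lin_comb gs (vec_fun v) i"
  proof (cases "i < r")
    case True
    hence "vec_fun (A *\<^sub>v v) i = (\<Sum>b\<in>{0..<p}. A $$ (i, b) * v $ b)"
      using assms dims by (simp add: vec_fun_def scalar_prod_def carrier_vecD)
    also have "\<dots> = (\<Sum>b<p. vec_fun v b * (gs ! b) i)"
      unfolding atLeast0LessThan
      using A True assms by (intro sum.cong) (auto simp: mat_cols_def vec_fun_def carrier_vecD mult.commute)
    finally show ?thesis by (simp add: lin_comb_def dims)
  next
    case False
    hence "lin_comb gs (vec_fun v) i = 0"
      using A unfolding lin_comb_def by (intro sum.neutral) (auto simp: mat_cols_def)
    thus ?thesis using False dims by (simp add: vec_fun_def)
  qed
qed

lemma vec_fun_image_mult: "vec_fun ` (\<lambda>v. A *\<^sub>v v) ` carrier_vec p = vec_span (set gs)"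
proof
  show "vec_fun ` (\<lambda>v. A *\<^sub>v v) ` carrier_vec p \<subseteq> vec_span (set gs)"
    by (auto simp: vec_fun_mult_mat_vec lin_comb_in_span)
  show "vec_span (set gs) \<subseteq> vec_fun ` (\<lambda>v. A *\<^sub>v v) ` carrier_vec p"
  proof
    fix z assume "z \<in> vec_span (set gs)"
    then obtain c where c: "z = lin_comb gs c" "\<And>j. j \<ge> length gs \<Longrightarrow> c j = 0"
      by (rule in_vec_span_setE) blast
    have "length gs = p" using A by (simp add: mat_cols_def)
    hence "vec_fun (A *\<^sub>v vec p c) = z"
      using c by (simp add: vec_fun_mult_mat_vec vec_fun_vec)
    thus "z \<in> vec_fun ` (\<lambda>v. A *\<^sub>v v) ` carrier_vec p" by (metis image_eqI vec_carrier)
  qed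
qed

lemma vec_fun_mat_kernel: "vec_fun ` mat_kernel A = syz gs"
proof
  from A have dims: "A \<in> carrier_mat r p" "length gs = p" by (auto simp: mat_cols_def)
  have zero: "vec_fun (0\<^sub>v r :: 'a vec) = 0" by (simp add: vec_fun_def fun_eq_iff)
  show "vec_fun ` mat_kernel A \<subseteq> syz gs"
  proof
    fix c assume "c \<in> vec_fun ` mat_kernel A"
    then obtain v where v: "c = vec_fun v" "v \<in> carrier_vec p" "A *\<^sub>v v = 0\<^sub>v r"
      using mat_kernelD[OF dims(1)] by blast
    have "lin_comb gs c = 0" using vec_fun_mult_mat_vec[OF v(2)] v(1,3) zero by simp
    thus "c \<in> syz gs" using v(1,2) dims(2) by (auto simp: syz_def vec_fun_def)
  qed
  show "syz gs \<subseteq> vec_fun ` mat_kernel A"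
  proof
    fix c assume c: "c \<in> syz gs"
    hence supp: "vec_fun (vec p c) = c" using dims(2) by (intro vec_fun_vec) (simp add: syz_def)
    hence "vec_fun (A *\<^sub>v vec p c) = vec_fun (0\<^sub>v r)"
      using c by (simp add: vec_fun_mult_mat_vec zero syz_def)
    moreover have "A *\<^sub>v vec p c \<in> carrier_vec r" using dims(1) by (intro mult_mat_vec_carrier) auto
    ultimately have "A *\<^sub>v vec p c = 0\<^sub>v r" using inj_on_vec_fun[of r] by (auto dest: inj_onD)
    hence "vec p c \<in> mat_kernel A" by (intro mat_kernelI[OF dims(1)]) auto
    thus "c \<in> vec_fun ` mat_kernel A" using supp by (metis imageI)
  qed
qed

end

lemma mat_entry_hom_iff:
  assumes "mat_cols A r p gs" "b < p"
  shows "is_hom deg \<rho> \<gamma> (gs ! b) \<longleftrightarrow> (\<forall>a<r. \<forall>t\<in>Poly_Mapping.keys (A $$ (a, b)). \<rho> a + deg t = \<gamma>)"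
proof -
  have "Poly_Mapping.keys ((gs ! b) a) = (if a < r then Poly_Mapping.keys (A $$ (a, b)) else {})" for a
    using assms by (auto simp: mat_cols_def not_less)
  thus ?thesis by (auto simp: is_hom_def split: if_splits)
qed

text \<open>The conditions translate one by one except for minimality, where passing between matrix
  entries and all syzygies uses exactness at the same place.\<close>

lemma minimal_free_resolution_iff:
  fixes I :: "('v::finite, 'k::field) mpoly set"
  assumes A: "\<And>i. mat_cols (A i) (case i of 0 \<Rightarrow> 1 | Suc i \<Rightarrow> length (degs i)) (length (degs i)) (gs i)"
  shows "minimal_free_resolution I (degs, A) \<longleftrightarrow> vec_resolution I degs gs"
proof -
  note A0 = A[of 0, simplified] and AS = A[of "Suc _", simplified]
  have carrier: "A 0 \<in> carrier_mat 1 (length (degs 0))"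
    "A (Suc i) \<in> carrier_mat (length (degs i)) (length (degs (Suc i)))" for i
    using A0 AS[of i] by (auto simp: mat_cols_def)
  have len: "length (gs i) = length (degs i)" for i using A[of i] by (simp add: mat_cols_def)
  have "(\<forall>b < length (degs 0). \<forall>t \<in> Poly_Mapping.keys (A 0 $$ (0, b)). mon_degree t = degs 0 ! b)
      \<longleftrightarrow> (\<forall>b < length (degs 0). hom (degs 0 ! b) (gs 0 ! b))"
    using mat_entry_hom_iff[OF A0, where deg = mon_degree and \<rho> = 0] by simp
  moreover have "(\<forall>a < length (degs i). \<forall>b < length (degs (Suc i)).
        \<forall>t \<in> Poly_Mapping.keys (A (Suc i) $$ (a, b)). degs i ! a + mon_degree t = degs (Suc i) ! b)
      \<longleftrightarrow> (\<forall>b<length (degs (Suc i)). is_hom mon_degree ((!) (degs i)) (degs (Suc i) ! b) (gs (Suc i) ! b))" for i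
    using mat_entry_hom_iff[OF AS, where deg = mon_degree] by auto
  moreover have "(\<lambda>v. (A 0 *\<^sub>v v) $ 0) ` carrier_vec (length (degs 0)) = I \<longleftrightarrow> vec_span (set (gs 0)) = emb ` I"
  proof -
    have "emb ((A 0 *\<^sub>v v) $ 0) = vec_fun (A 0 *\<^sub>v v)" for v
      using carrier(1) by (auto simp: emb_def vec_fun_def fun_eq_iff)
    hence "vec_span (set (gs 0)) = emb ` (\<lambda>v. (A 0 *\<^sub>v v) $ 0) ` carrier_vec (length (degs 0))"
      using vec_fun_image_mult[OF A0] by (simp add: image_image)
    moreover have "inj (emb :: ('v, 'k) mpoly \<Rightarrow> _)" by (rule injI) simp
    ultimately show ?thesis by (simp add: inj_image_eq_iff)
  qed
  moreover have image: "(\<lambda>v. A (Suc i) *\<^sub>v v) ` carrier_vec (length (degs (Suc i))) = mat_kernel (A i)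
      \<longleftrightarrow> vec_span (set (gs (Suc i))) = syz (gs i)" for i
  proof -
    have "(\<lambda>v. A (Suc i) *\<^sub>v v) ` carrier_vec (length (degs (Suc i))) \<subseteq> carrier_vec (length (degs i))"
      using carrier(2)[of i] by auto
    moreover have "mat_kernel (A i) \<subseteq> carrier_vec (length (degs i))"
      using A[of i] by (auto simp: mat_cols_def mat_kernel_def)
    ultimately have "(\<lambda>v. A (Suc i) *\<^sub>v v) ` carrier_vec (length (degs (Suc i))) = mat_kernel (A i) \<longleftrightarrow>
        vec_fun ` (\<lambda>v. A (Suc i) *\<^sub>v v) ` carrier_vec (length (degs (Suc i))) = vec_fun ` mat_kernel (A i)"
      using inj_on_image_eq_iff[OF inj_on_vec_fun] by metis
    thus ?thesis by (simp only: vec_fun_image_mult[OF AS] vec_fun_mat_kernel[OF A])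
  qed
  moreover have "(\<forall>a < length (degs i). \<forall>b < length (degs (Suc i)). A (Suc i) $$ (a, b) \<in> ideal_gen (range Var))
      \<longleftrightarrow> (\<forall>c\<in>syz (gs i). \<forall>j. Poly_Mapping.lookup (c j) 0 = 0)"
    if span: "vec_span (set (gs (Suc i))) = syz (gs i)" for i
  proof
    assume entries: "\<forall>a < length (degs i). \<forall>b < length (degs (Suc i)). A (Suc i) $$ (a, b) \<in> ideal_gen (range Var)"
    show "\<forall>c\<in>syz (gs i). \<forall>j. Poly_Mapping.lookup (c j) 0 = 0"
    proof (intro ballI allI)
      fix c j assume "c \<in> syz (gs i)"
      then obtain d where c: "c = lin_comb (gs (Suc i)) d" using span by (auto simp: vec_span_set)
      have "d b * (gs (Suc i) ! b) j \<in> ideal_gen (range Var)" if "b < length (gs (Suc i))" for b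
      proof (cases "j < length (degs i)")
        case True
        hence "(gs (Suc i) ! b) j = A (Suc i) $$ (j, b)" using AS[of i] that by (simp add: mat_cols_def)
        thus ?thesis using entries True that len by (simp add: ideal_gen_mult)
      next
        case False
        hence "(gs (Suc i) ! b) j = 0" using AS[of i] that by (simp add: mat_cols_def)
        thus ?thesis by (simp add: ring_ideal.span_zero)
      qed
      hence "c j \<in> ideal_gen (range Var)"
        unfolding c lin_comb_def by (intro ring_ideal.span_sum) simp
      thus "Poly_Mapping.lookup (c j) 0 = 0" by (simp add: max_ideal_iff)
    qed
  next
    assume const: "\<forall>c\<in>syz (gs i). \<forall>j. Poly_Mapping.lookup (c j) 0 = 0"
    show "\<forall>a < length (degs i). \<forall>b < length (degs (Suc i)). A (Suc i) $$ (a, b) \<in> ideal_gen (range Var)"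
    proof (intro allI impI)
      fix a b assume ab: "a < length (degs i)" "b < length (degs (Suc i))"
      have "gs (Suc i) ! b \<in> syz (gs i)"
        unfolding span[symmetric] using ab(2) len by (intro vecs.span_base nth_mem) simp
      hence "Poly_Mapping.lookup ((gs (Suc i) ! b) a) 0 = 0" using const by simp
      thus "A (Suc i) $$ (a, b) \<in> ideal_gen (range Var)"
        using AS[of i] ab by (simp add: max_ideal_iff mat_cols_def)
    qed
  qed
  ultimately show ?thesis
    unfolding minimal_free_resolution_def vec_resolution_def using carrier len by auto
qed

text \<open>The constructed resolution only guarantees that the choice operator picks a resolution;
  the conclusion speaks of the one picked.\<close>

lemma betti_eq_count:
  fixes B :: "('v::finite) monomial set"
  defines "I \<equiv> ideal_gen (mon ` B) :: ('v, 'k::field) mpoly set"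
  assumes "finite B" and "\<And>b. b \<in> B \<Longrightarrow> mon_degree b = d"
  obtains degs gs where "vec_resolution I degs gs" "\<And>i j. betti I i j = count_list (degs i) j"
proof -
  obtain degs gs where res: "vec_resolution I degs gs"
    using vec_resolution_exists[OF assms(2,3)] unfolding I_def by blast
  define r where "r i = (case i of 0 \<Rightarrow> 1 | Suc i \<Rightarrow> length (degs i))" for i
  define A where "A i = mat (r i) (length (degs i)) (\<lambda>(a, b). (gs i ! b) a)" for i
  have cols: "mat_cols (A i) (r i) (length (degs i)) (gs i)" for i
  proof -
    have "(gs i ! b) a = 0" if "b < length (degs i)" "a \<ge> r i" for a b
    proof (cases i)
      case 0
      have "gs 0 ! b \<in> vec_span (set (gs 0))"
        using that 0 res by (intro vecs.span_base nth_mem) (simp add: vec_resolution_def)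
      thus ?thesis using that 0 res by (auto simp: vec_resolution_def r_def)
    next
      case (Suc i')
      have "gs i ! b \<in> vec_span (set (gs i))"
        using that res by (intro vecs.span_base nth_mem) (simp add: vec_resolution_def)
      hence "gs i ! b \<in> syz (gs i')" using res Suc by (simp add: vec_resolution_def)
      thus ?thesis using that Suc res by (simp add: syz_def r_def vec_resolution_def)
    qed
    thus ?thesis using res by (auto simp: mat_cols_def A_def vec_resolution_def)
  qed
  have "minimal_free_resolution I (degs, A)"
    using minimal_free_resolution_iff[of A degs gs I] cols res by (simp add: r_def)
  hence "minimal_free_resolution I (SOME F. minimal_free_resolution I F)" by (rule someI)
  then obtain degs' A' where F: "(SOME F. minimal_free_resolution I F) = (degs', A')"
    and res': "minimal_free_resolution I (degs', A')"
    by (metis surj_pair)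
  define r' where "r' i = (case i of 0 \<Rightarrow> 1 | Suc i \<Rightarrow> length (degs' i))" for i
  define gs' where "gs' i = map (\<lambda>b a. if a < r' i then A' i $$ (a, b) else 0) [0..<length (degs' i)]" for i
  have "A' i \<in> carrier_mat (r' i) (length (degs' i))" for i
    using res' by (cases i) (auto simp: minimal_free_resolution_def r'_def)
  hence "mat_cols (A' i) (r' i) (length (degs' i)) (gs' i)" for i
    by (auto simp: mat_cols_def gs'_def)
  hence "vec_resolution I degs' gs'"
    using minimal_free_resolution_iff[of A' degs' gs' I] res' by (simp add: r'_def)
  thus thesis by (rule that) (simp add: betti_def F)
qed

section \<open>Linear quotients give linear resolutions\<close>

text \<open>Minimal generators of a module generated in one degree have that degree. The induction
  carries along that the current syzygies are linear to every depth, because each step uses up one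
  level.\<close>

lemma vec_resolution_linear:
  fixes I :: "('v::finite, 'k::field) mpoly set"
  assumes res: "vec_resolution I degs gs"
    and hs: "\<forall>h\<in>set hs. hom d h" "K_indep hs" "vec_span (set hs) = emb ` I"
    and lin: "\<And>n. linear_upto n (syz hs)"
  shows "b < length (degs i) \<Longrightarrow> degs i ! b = d + i"
proof -
  have len: "length (gs i) = length (degs i)" for i using res by (simp add: vec_resolution_def)
  have minimal: "Poly_Mapping.lookup (c j) 0 = 0" if "c \<in> syz (gs i)" for c i j
    using res that by (simp add: vec_resolution_def)
  \<comment> \<open>In degree 0 only constant terms can occur, and minimality excludes them.\<close>
  have indep: "K_indep (gs i)" for i
    unfolding K_indep_def
  proof (intro ballI impI)
    fix c assume c: "c \<in> syz (gs i)" "hom 0 c"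
    have "c j = 0" for j
    proof (rule poly_mapping_eqI)
      fix t show "Poly_Mapping.lookup (c j) t = Poly_Mapping.lookup 0 t"
      proof (cases "t = 0")
        case False
        hence "t \<notin> Poly_Mapping.keys (c j)" using c(2) by (auto simp: is_hom_def mon_degree_eq_0_iff)
        thus ?thesis by (simp add: in_keys_iff)
      qed (simp add: minimal[OF c(1)])
    qed
    thus "c = 0" by (simp add: fun_eq_iff)
  qed
  have "(\<forall>b<length (degs i). degs i ! b = d + i) \<and> (\<forall>n. linear_upto n (syz (gs i)))"
  proof (induction i)
    case 0
    have span: "vec_span (set (gs 0)) = vec_span (set hs)" using res hs(3) by (simp add: vec_resolution_def)
    have degs: "degs 0 ! b = d" if "b < length (degs 0)" for b
      by (rule minimal_generator_degree[OF span, where \<rho> = 0 and \<delta> = "(!) (degs 0)"])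
        (use hs(1) that res len minimal in \<open>auto simp: vec_resolution_def\<close>)
    have "\<forall>g\<in>set (gs 0). hom d g"
      using degs res by (auto simp: vec_resolution_def in_set_conv_nth)
    hence "linear_upto n (syz (gs 0))" for n
      using linear_upto_base_change[OF hs(1,2) _ indep span[symmetric] lin] by blast
    thus ?case using degs by simp
  next
    case (Suc i)
    have span: "vec_span (set (gs (Suc i))) = syz (gs i)" using res by (simp add: vec_resolution_def)
    \<comment> \<open>All basis vectors here have degree \<open>d + i\<close>, so the two gradings
      differ by a shift. This holds for indices within the list only, which is why \<open>h\<close>
      is taken from the syzygies.\<close>
    have hom_iff: "is_hom mon_degree ((!) (degs i)) (d + i + m) h \<longleftrightarrow> hom m h" if "h \<in> syz (gs i)" for h m
    proof -
      have "a < length (degs i)" if "t \<in> Poly_Mapping.keys (h a)" for a t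
        using that \<open>h \<in> syz (gs i)\<close> len by (auto simp: syz_def not_le[symmetric])
      thus ?thesis using Suc.IH by (auto simp: is_hom_def)
    qed
    have gen: "\<exists>hs. (\<forall>h\<in>set hs. hom 1 h) \<and> K_indep hs \<and> vec_span (set hs) = syz (gs i) \<and> linear_upto n (syz hs)" for n
      using Suc.IH linear_upto.simps(2) by blast
    have degs: "degs (Suc i) ! b = d + i + 1" if "b < length (degs (Suc i))" for b
    proof -
      obtain hs where hs: "\<forall>h\<in>set hs. hom 1 h" "vec_span (set hs) = syz (gs i)" using gen by blast
      have span': "vec_span (set (gs (Suc i))) = vec_span (set hs)" using span hs(2) by simp
      have "is_hom mon_degree ((!) (degs i)) (d + i + 1) h" if "h \<in> set hs" for h
        using hs(1) that hom_iff[of h 1] vecs.span_base[OF that, unfolded hs(2)] by blast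
      thus ?thesis
        by (intro minimal_generator_degree[OF span', where \<rho> = "(!) (degs i)" and \<delta> = "(!) (degs (Suc i))"])
          (use that res len minimal in \<open>auto simp: vec_resolution_def\<close>)
    qed
    have gs1: "\<forall>g\<in>set (gs (Suc i)). hom 1 g"
    proof
      fix g assume g: "g \<in> set (gs (Suc i))"
      obtain b where b: "b < length (degs (Suc i))" "g = gs (Suc i) ! b"
        using g len by (metis in_set_conv_nth)
      have "is_hom mon_degree ((!) (degs i)) (degs (Suc i) ! b) g"
        using res b by (simp add: vec_resolution_def)
      hence "is_hom mon_degree ((!) (degs i)) (d + i + 1) g" unfolding degs[OF b(1)] .
      thus "hom 1 g" using hom_iff[of g 1] vecs.span_base[OF g, unfolded span] by blast
    qed
    have "linear_upto n (syz (gs (Suc i)))" for n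
    proof -
      obtain hs where hs: "\<forall>h\<in>set hs. hom 1 h" "K_indep hs" "vec_span (set hs) = syz (gs i)" "linear_upto n (syz hs)"
        using gen by blast
      show ?thesis
        by (rule linear_upto_base_change[OF hs(1,2) gs1 indep _ hs(4)]) (simp add: span hs(3))
    qed
    thus ?case using degs by simp
  qed
  thus "b < length (degs i) \<Longrightarrow> degs i ! b = d + i" by simp
qed

lemma linear_quotients_imp_betti:
  fixes B :: "('v::finite) monomial set"
  defines "I \<equiv> ideal_gen (mon ` B) :: ('v, 'k::field) mpoly set"
  assumes "finite B" and deg: "\<And>b. b \<in> B \<Longrightarrow> mon_degree b = d" and "B \<noteq> {}"
    and lq: "has_linear_quotients I"
  shows "betti I i j \<noteq> 0 \<Longrightarrow> j = d + i" and "betti I 0 d \<noteq> 0"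
proof -
  have mg: "mingens I = B" unfolding I_def using deg by (rule mingens_monomial_ideal)
  from lq obtain us where us: "distinct us" "set us = B"
    and colon: "\<And>i. 1 \<le> i \<Longrightarrow> i < length us \<Longrightarrow>
        \<exists>V. colon (ideal_gen (mon ` set (take i us))) (mon (us ! i) :: ('v, 'k) mpoly) = ideal_gen (Var ` V)"
    unfolding has_linear_quotients_def mg by blast
  define hs where "hs = map (\<lambda>u. emb (mon u :: ('v, 'k) mpoly)) us"
  have hs_eq: "hs = map emb (map mon us)" by (simp add: hs_def)
  have hom: "\<forall>h\<in>set hs. hom d h" using deg us(2) by (auto simp: hs_def hom_emb_mon)
  have "linear_upto n (syz hs)" for n
    unfolding hs_eq
  proof (rule linear_upto_syz_of_colons[where e = d])
    fix q assume q: "q < length (map mon us :: ('v, 'k) mpoly list)"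
    have "\<exists>V. colon (ideal_gen (mon ` set (take q us))) (mon (us ! q) :: ('v, 'k) mpoly) = ideal_gen (Var ` V)"
    \<comment> \<open>Linear quotients constrain the colon ideals from the second generator on; for
      the first one the colon ideal is 0, generated by no variable.\<close>
    proof (cases "q = 0")
      case True
      have "colon (ideal_gen (mon ` {})) (mon (us ! q) :: ('v, 'k) mpoly) = ideal_gen (Var ` {})"
        unfolding set_eq_iff colon_monomial_iff var_ideal_iff by simp
      thus ?thesis using True by (intro exI[of _ "{}"]) simp
    qed (use colon q in auto)
    thus "linear_upto n (emb ` colon (ideal_gen (set (take q (map mon us)))) (map mon us ! q :: ('v, 'k) mpoly))"
      using linear_upto_variables[of n] q by (auto simp: take_map)
  qed (use deg us(2) in \<open>auto simp: hom_emb_mon\<close>)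
  moreover have "vec_span (set hs) = emb ` I"
    by (simp add: hs_def I_def emb_ideal_gen us(2) image_image)
  moreover have "K_indep hs" unfolding hs_def by (rule K_indep_mon[OF us(1)])
  moreover obtain degs gs where res: "vec_resolution I degs gs" and betti: "\<And>i j. betti I i j = count_list (degs i) j"
    using betti_eq_count[OF assms(2) deg] unfolding I_def by blast
  ultimately have degs: "degs i ! b = d + i" if "b < length (degs i)" for i b
    using vec_resolution_linear[OF res hom] that by blast
  show "j = d + i" if nz: "betti I i j \<noteq> 0" for i j
  proof -
    have "j \<in> set (degs i)" using nz betti by (metis count_list_0_iff)
    thus ?thesis using degs by (auto simp: in_set_conv_nth)
  qed
  \<comment> \<open>Ensures that the supremum defining the regularity attains
    \<open>d\<close>.\<close>
  have "degs 0 \<noteq> []"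
  proof
    assume "degs 0 = []"
    moreover have "length (gs 0) = length (degs 0)" "vec_span (set (gs 0)) = emb ` I"
      using res by (simp_all add: vec_resolution_def)
    ultimately have "emb ` I = {0}" by simp
    moreover obtain b where "b \<in> B" using \<open>B \<noteq> {}\<close> by blast
    hence "(mon b :: ('v, 'k) mpoly) \<in> I" unfolding I_def by (intro ring_ideal.span_base imageI)
    ultimately have "emb (mon b :: ('v, 'k) mpoly) = 0" by blast
    hence "(mon b :: ('v, 'k) mpoly) = 0" by (metis emb_0 zero_fun_apply)
    thus False by (metis keys_mon keys_zero insert_not_empty)
  qed
  hence "d \<in> set (degs 0)" using degs[of 0 0] nth_mem[of 0 "degs 0"] by simp
  thus "betti I 0 d \<noteq> 0" by (simp add: betti count_list_0_iff)
qed

lemma linear_quotients_imp_linear_resolution: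
  fixes B :: "('v::finite) monomial set"
  defines "I \<equiv> ideal_gen (mon ` B) :: ('v, 'k::field) mpoly set"
  assumes "finite B" and deg: "\<And>b. b \<in> B \<Longrightarrow> mon_degree b = d" and "B \<noteq> {}"
    and lq: "has_linear_quotients I"
  shows "has_linear_resolution I" and "linearly_related I"
proof -
  note betti = linear_quotients_imp_betti[OF assms(2-4) lq[unfolded I_def], folded I_def]
  have gen: "generated_in_degree I d"
    unfolding generated_in_degree_def I_def using mingens_monomial_ideal[OF deg] deg by auto
  have "{ereal (real j - real i) | i j. betti I i j \<noteq> 0} = {ereal (real d)}"
  proof
    show "{ereal (real j - real i) | i j. betti I i j \<noteq> 0} \<subseteq> {ereal (real d)}"
      using betti(1) by fastforce
    have "ereal (real d) = ereal (real d - real 0)" by simp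
    thus "{ereal (real d)} \<subseteq> {ereal (real j - real i) | i j. betti I i j \<noteq> 0}"
      using betti(2) by blast
  qed
  hence "regularity I = ereal (real d)" by (simp add: regularity_def)
  thus "has_linear_resolution I" using gen by (auto simp: has_linear_resolution_def)
  have "\<forall>j. j \<noteq> d + 1 \<longrightarrow> betti I 1 j = 0" using betti(1)[of 1] by auto
  thus "linearly_related I" using gen by (auto simp: linearly_related_def)
qed

section \<open>Linear relations connect the generators\<close>

text \<open>
  A linear syzygy of multidegree \<open>t\<close> involves only generators \<open>w\<close> with \<open>t = w x\<close> for a variable
  \<open>x\<close>. If \<open>t\<close> divides \<open>L\<close>, then the condition on \<open>p\<close> and \<open>q\<close> forces these generators to be all
  divisible by \<open>p\<close> or all not divisible by \<open>p\<close>, because no single variable accounts for both \<open>p\<close>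
  and \<open>q\<close>. Hence replacing each element \<open>f\<close> of a basis of \<open>F\<^sub>0\<close> by its part supported on the
  generators not divisible by \<open>p\<close> maps every syzygy to a polynomial whose coefficients at the
  divisors of \<open>L\<close> vanish, but it maps the syzygy between \<open>u\<close> and \<open>v\<close> to the monomial \<open>L\<close>.
\<close>

lemma no_separation_of_linearly_related:
  fixes B :: "('v::finite) monomial set"
  assumes res: "vec_resolution (ideal_gen (mon ` B) :: ('v, 'k::field) mpoly set) degs gs"
    and deg: "\<And>b. b \<in> B \<Longrightarrow> mon_degree b = d"
    and lin: "\<And>j. j \<in> set (degs 1) \<Longrightarrow> j \<le> d + 1"
    and pq: "p \<noteq> q" "\<And>w. w \<in> B \<Longrightarrow> mon_dvd w L \<Longrightarrow> Poly_Mapping.lookup w p = Poly_Mapping.lookup w q"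
    and u: "u \<in> B" "mon_dvd u L" "Poly_Mapping.lookup u p = 0"
    and v: "v \<in> B" "mon_dvd v L" "Poly_Mapping.lookup v p > 0"
  shows False
proof -
  define I where "I = (ideal_gen (mon ` B) :: ('v, 'k) mpoly set)"
  define Q where "Q w \<longleftrightarrow> mon_dvd w L \<and> Poly_Mapping.lookup w p = 0" for w :: "'v monomial"
  define f where "f b = (gs 0 ! b) 0" for b
  define n where "n = length (gs 0)"
  \<comment> \<open>In an arbitrary resolution \<open>f b\<close> may combine several monomial
    generators; \<open>\<Phi>\<close> therefore filters the terms of \<open>f b\<close> instead of
    selecting basis elements.\<close>
  define \<Phi> where "\<Phi> c = (\<Sum>b<n. c b * part Q (f b))" for c :: "nat \<Rightarrow> ('v, 'k) mpoly"
  have len: "length (gs i) = length (degs i)" for i using res by (simp add: vec_resolution_def)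
  have span0: "vec_span (set (gs 0)) = emb ` I" using res by (simp add: vec_resolution_def I_def)
  have span1: "vec_span (set (gs 1)) = syz (gs 0)" using res by (simp add: vec_resolution_def)
  have gs0: "gs 0 ! b = emb (f b)" "f b \<in> I" if "b < n" for b
  proof -
    have "gs 0 ! b \<in> emb ` I"
      unfolding span0[symmetric] using that by (intro vecs.span_base nth_mem) (simp add: n_def)
    thus "gs 0 ! b = emb (f b)" "f b \<in> I" by (auto simp: f_def)
  qed
  have comb: "lin_comb (gs 0) c = emb (\<Sum>b<n. c b * f b)" for c
    by (auto simp: lin_comb_def n_def[symmetric] gs0 fun_eq_iff emb_def intro!: sum.neutral)
  have keys_f: "mon_degree t = degs 0 ! b" "d \<le> mon_degree t" "mon_degree t = d \<Longrightarrow> t \<in> B"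
    if b: "b < n" and t: "t \<in> Poly_Mapping.keys (f b)" for b t
  proof -
    have "hom (degs 0 ! b) (gs 0 ! b)" using res b len by (simp add: vec_resolution_def n_def)
    thus "mon_degree t = degs 0 ! b" using t by (auto simp: is_hom_def f_def)
    obtain w where w: "w \<in> B" "mon_dvd w t"
      using gs0(2)[OF b] t unfolding I_def by (auto simp: monomial_ideal_iff)
    then obtain r where "t = w + r" by (auto simp: mon_dvd_iff_add)
    thus "d \<le> mon_degree t" using deg[OF w(1)] by (simp add: mon_degree_add)
    show "t \<in> B" if "mon_degree t = d"
      using mon_dvd_eqI[OF w(2)] w(1) deg[OF w(1)] that by simp
  qed
  have generators: "Poly_Mapping.lookup (\<Phi> c) t = 0"
    if c: "c \<in> set (gs 1)" and t: "mon_dvd t L" for c t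
  proof -
    obtain i where i: "i < length (degs 1)" "c = gs 1 ! i" using c len by (metis in_set_conv_nth)
    have hom: "is_hom mon_degree ((!) (degs 0)) (degs 1 ! i) c"
      using res i by (auto simp: vec_resolution_def)
    have le: "degs 1 ! i \<le> d + 1" using lin i(1) by simp
    have csyz: "c \<in> syz (gs 0)" using vecs.span_base[OF c] span1 by simp
    have no_const: "Poly_Mapping.lookup (c b) 0 = 0" for b
      using res csyz by (auto simp: vec_resolution_def)
    have "lin_comb (gs 0) c = 0" using csyz by (simp add: syz_def)
    hence "emb (\<Sum>b<n. c b * f b) 0 = 0" by (simp only: comb zero_fun_apply)
    hence sum0: "(\<Sum>b<n. c b * f b) = 0" by simp
    \<comment> \<open>Minimality excludes constant entries, terms of \<open>f b\<close> have degree
      at least \<open>d\<close>, and the total is at most \<open>d + 1\<close>: this forces degrees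
      1 and \<open>d\<close>.\<close>
    have linear: "w \<in> B \<and> (\<exists>x. s = Poly_Mapping.single x 1)"
      if b: "b < n" and s: "s \<in> Poly_Mapping.keys (c b)" and w: "w \<in> Poly_Mapping.keys (f b)" for b s w
    proof -
      have "s \<noteq> 0" using no_const[of b] s by (auto simp: in_keys_iff)
      hence "mon_degree s \<noteq> 0" by (simp add: mon_degree_eq_0_iff)
      moreover have "mon_degree w + mon_degree s = degs 1 ! i"
        using hom s keys_f(1)[OF b w] by (simp add: is_hom_def)
      ultimately have "mon_degree s = 1" "mon_degree w = d" using keys_f(2)[OF b w] le by linarith+
      thus ?thesis using keys_f(3)[OF b w] mon_degree_eq_1_iff by blast
    qed
    show ?thesis
    proof (cases "\<exists>w0\<in>B. \<exists>x0. Q w0 \<and> t = w0 + Poly_Mapping.single x0 1")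
      case True
      then obtain w0 x0 where w0: "w0 \<in> B" "Q w0" "t = w0 + Poly_Mapping.single x0 1" by blast
      have Q: "Q w" if w: "w \<in> B" "t = w + Poly_Mapping.single x 1" for w x
      proof -
        have wL: "mon_dvd w L" using t w(2) by (auto simp: mon_dvd_iff_add add.assoc)
        have w0L: "mon_dvd w0 L" "Poly_Mapping.lookup w0 p = 0" using w0(2) by (auto simp: Q_def)
        have zero: "Poly_Mapping.lookup w0 q = 0" using pq(2)[OF w0(1) w0L(1)] w0L(2) by simp
        have "Poly_Mapping.lookup w p = 0"
        proof (rule ccontr)
          assume "Poly_Mapping.lookup w p \<noteq> 0"
          moreover have "Poly_Mapping.lookup t p = Poly_Mapping.lookup (Poly_Mapping.single x0 (1::nat)) p"
            "Poly_Mapping.lookup t q = Poly_Mapping.lookup (Poly_Mapping.single x0 (1::nat)) q"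
            using w0(3) w0L(2) zero by (simp_all add: lookup_add)
          moreover have "Poly_Mapping.lookup t p \<ge> Poly_Mapping.lookup w p"
            "Poly_Mapping.lookup t q \<ge> Poly_Mapping.lookup w q"
            using w(2) by (simp_all add: lookup_add)
          ultimately have "x0 = p" "x0 = q"
            using pq(2)[OF w(1) wL] by (auto simp: lookup_single when_def split: if_splits)
          thus False using pq(1) by simp
        qed
        thus ?thesis using wL by (simp add: Q_def)
      qed
      have "Poly_Mapping.lookup (c b * f b) t = Poly_Mapping.lookup (c b * part Q (f b)) t" if b: "b < n" for b
      proof -
        have "t \<notin> Poly_Mapping.keys (c b * part (\<lambda>w. \<not> Q w) (f b))"
        proof
          assume "t \<in> Poly_Mapping.keys (c b * part (\<lambda>w. \<not> Q w) (f b))"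
          then obtain s w where sw: "s \<in> Poly_Mapping.keys (c b)" "w \<in> Poly_Mapping.keys (f b)" "\<not> Q w" "t = s + w"
            using keys_mult[of "c b" "part (\<lambda>w. \<not> Q w) (f b)"] by (auto simp: keys_part)
          with linear[OF b sw(1,2)] Q show False by (metis add.commute)
        qed
        moreover have "f b = part Q (f b) + part (\<lambda>w. \<not> Q w) (f b)"
          by (rule poly_mapping_eqI) (simp add: lookup_add lookup_part when_def)
        hence "c b * f b = c b * part Q (f b) + c b * part (\<lambda>w. \<not> Q w) (f b)"
          by (metis distrib_left)
        ultimately show ?thesis by (simp add: lookup_add in_keys_iff)
      qed
      hence "Poly_Mapping.lookup (\<Phi> c) t = Poly_Mapping.lookup (\<Sum>b<n. c b * f b) t"
        by (simp add: \<Phi>_def lookup_sum)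
      thus ?thesis by (simp add: sum0)
    next
      case False
      have "t \<notin> Poly_Mapping.keys (c b * part Q (f b))" if b: "b < n" for b
      proof
        assume "t \<in> Poly_Mapping.keys (c b * part Q (f b))"
        then obtain s w where sw: "s \<in> Poly_Mapping.keys (c b)" "w \<in> Poly_Mapping.keys (f b)" "Q w" "t = s + w"
          using keys_mult[of "c b" "part Q (f b)"] by (auto simp: keys_part)
        with linear[OF b sw(1,2)] False show False by (metis add.commute)
      qed
      thus ?thesis by (simp add: \<Phi>_def lookup_sum in_keys_iff)
    qed
  qed
  have syzygies: "Poly_Mapping.lookup (\<Phi> c) t = 0" if c: "c \<in> syz (gs 0)" and t: "mon_dvd t L" for c t
  proof -
    have "vecs.subspace {c. \<forall>t. mon_dvd t L \<longrightarrow> Poly_Mapping.lookup (\<Phi> c) t = 0}"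
    proof (rule vecs.subspaceI)
      show "0 \<in> {c. \<forall>t. mon_dvd t L \<longrightarrow> Poly_Mapping.lookup (\<Phi> c) t = 0}" by (simp add: \<Phi>_def)
    next
      fix x y assume "x \<in> {c. \<forall>t. mon_dvd t L \<longrightarrow> Poly_Mapping.lookup (\<Phi> c) t = 0}"
        "y \<in> {c. \<forall>t. mon_dvd t L \<longrightarrow> Poly_Mapping.lookup (\<Phi> c) t = 0}"
      moreover have "\<Phi> (x + y) = \<Phi> x + \<Phi> y" by (simp add: \<Phi>_def distrib_right sum.distrib)
      ultimately show "x + y \<in> {c. \<forall>t. mon_dvd t L \<longrightarrow> Poly_Mapping.lookup (\<Phi> c) t = 0}"
        by (simp add: lookup_add)
    next
      fix a x assume x: "x \<in> {c. \<forall>t. mon_dvd t L \<longrightarrow> Poly_Mapping.lookup (\<Phi> c) t = 0}"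
      have "\<Phi> (vec_scale a x) = a * \<Phi> x" by (simp add: \<Phi>_def sum_distrib_left mult.assoc)
      moreover have "t \<notin> Poly_Mapping.keys (a * \<Phi> x)" if t: "mon_dvd t L" for t
      proof
        assume "t \<in> Poly_Mapping.keys (a * \<Phi> x)"
        then obtain r s where rs: "s \<in> Poly_Mapping.keys (\<Phi> x)" "t = r + s" using keys_mult[of a "\<Phi> x"] by blast
        have "mon_dvd s t" unfolding rs(2) by (simp add: mon_dvd_def lookup_add)
        hence "mon_dvd s L" using t mon_dvd_trans by blast
        thus False using x rs(1) by (auto simp: in_keys_iff)
      qed
      ultimately show "vec_scale a x \<in> {c. \<forall>t. mon_dvd t L \<longrightarrow> Poly_Mapping.lookup (\<Phi> c) t = 0}"
        by (simp add: in_keys_iff)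
    qed
    moreover have "set (gs 1) \<subseteq> {c. \<forall>t. mon_dvd t L \<longrightarrow> Poly_Mapping.lookup (\<Phi> c) t = 0}"
      using generators by auto
    ultimately have "syz (gs 0) \<subseteq> {c. \<forall>t. mon_dvd t L \<longrightarrow> Poly_Mapping.lookup (\<Phi> c) t = 0}"
      unfolding span1[symmetric] by (intro vecs.span_minimal)
    thus ?thesis using c t by auto
  qed
  have lift: "\<exists>\<alpha>. (\<forall>b\<ge>n. \<alpha> b = 0) \<and> lin_comb (gs 0) \<alpha> = emb (mon w) \<and> \<Phi> \<alpha> = part Q (mon w)"
    if w: "w \<in> B" for w
  proof -
    have "(mon w :: ('v, 'k) mpoly) \<in> I" unfolding I_def using w by (intro ring_ideal.span_base imageI)
    hence "emb (mon w :: ('v, 'k) mpoly) \<in> vec_span (set (gs 0))" unfolding span0 by (rule imageI)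
    moreover have "hom d (emb (mon w :: ('v, 'k) mpoly))" using deg[OF w] by (simp add: hom_emb_mon)
    moreover have "hom (degs 0 ! b) (gs 0 ! b)" if "b < length (gs 0)" for b
      using res that len by (simp add: vec_resolution_def)
    ultimately obtain \<alpha> where \<alpha>: "emb (mon w) = lin_comb (gs 0) \<alpha>" "is_hom mon_degree ((!) (degs 0)) d \<alpha>"
      "\<And>b. b \<ge> length (gs 0) \<Longrightarrow> \<alpha> b = 0"
      using is_hom_in_spanE[OF mon_degree_add, of "gs 0" 0 "(!) (degs 0)" d "emb (mon w)"] by metis
    \<comment> \<open>No term of \<open>f b\<close> has degree below \<open>d\<close>, so the
      coefficients are constants and filtering commutes with the combination.\<close>
    have "part Q (\<alpha> b * f b) = \<alpha> b * part Q (f b)" if b: "b < n" for b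
    proof (cases "f b = 0")
      case False
      then obtain t where t: "t \<in> Poly_Mapping.keys (f b)"
        by (metis in_keys_iff lookup_zero poly_mapping_eqI)
      have zero: "s = 0" if "s \<in> Poly_Mapping.keys (\<alpha> b)" for s
      proof -
        have "degs 0 ! b + mon_degree s = d" using \<alpha>(2) that by (simp add: is_hom_def)
        thus ?thesis using keys_f(1,2)[OF b t] by (simp flip: mon_degree_eq_0_iff)
      qed
      have "part Q (f b * \<alpha> b) = part Q (f b) * \<alpha> b"
      proof (rule part_mult)
        fix t s assume "t \<in> Poly_Mapping.keys (\<alpha> b)"
        hence "t = 0" by (rule zero)
        thus "Q (t + s) \<longleftrightarrow> Q s" by simp
      qed
      thus ?thesis by (simp add: mult.commute)
    qed simp
    hence "\<Phi> \<alpha> = part Q (\<Sum>b<n. \<alpha> b * f b)" by (simp add: \<Phi>_def part_sum)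
    moreover have "(\<Sum>b<n. \<alpha> b * f b) = mon w" using \<alpha>(1) by (simp add: comb)
    ultimately show ?thesis using \<alpha>(1,3) by (intro exI[of _ \<alpha>]) (simp add: n_def)
  qed
  obtain \<alpha> where \<alpha>: "\<forall>b\<ge>n. \<alpha> b = 0" "lin_comb (gs 0) \<alpha> = emb (mon u)" "\<Phi> \<alpha> = part Q (mon u)"
    using lift[OF u(1)] by blast
  obtain \<beta> where \<beta>: "\<forall>b\<ge>n. \<beta> b = 0" "lin_comb (gs 0) \<beta> = emb (mon v)" "\<Phi> \<beta> = part Q (mon v)"
    using lift[OF v(1)] by blast
  have "part Q (mon u) = (mon u :: ('v, 'k) mpoly)"
    using u by (intro part_eq_self) (simp add: Q_def)
  hence \<Phi>\<alpha>: "\<Phi> \<alpha> = mon u" using \<alpha>(3) by simp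
  have "part Q (mon v) = (0 :: ('v, 'k) mpoly)"
    using v by (intro part_eq_0) (simp add: Q_def)
  hence \<Phi>\<beta>: "\<Phi> \<beta> = 0" using \<beta>(3) by simp
  obtain r where r: "L = u + r" using u(2) by (auto simp: mon_dvd_iff_add)
  obtain s where s: "L = v + s" using v(2) by (auto simp: mon_dvd_iff_add)
  define c where "c = vec_scale (mon r) \<alpha> - vec_scale (mon s) \<beta>"
  have "lin_comb (gs 0) c = vec_scale (mon r) (emb (mon u)) - vec_scale (mon s) (emb (mon v))"
    by (simp only: c_def lin_comb_diff lin_comb_scale \<alpha>(2) \<beta>(2))
  also have "\<dots> = 0"
    using r s by (simp add: fun_eq_iff emb_def mon_mult add.commute)
  finally have "c \<in> syz (gs 0)"
    using \<alpha>(1) \<beta>(1) by (simp add: syz_def c_def n_def)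
  moreover have "\<Phi> c = mon r * \<Phi> \<alpha> - mon s * \<Phi> \<beta>"
    by (simp add: c_def \<Phi>_def left_diff_distrib sum_subtractf sum_distrib_left mult.assoc)
  hence "\<Phi> c = mon L" using r by (simp add: \<Phi>\<alpha> \<Phi>\<beta> mon_mult add.commute)
  ultimately show False using syzygies[of c L] by (simp add: lookup_mon)
qed

section \<open>The graphs of linearly related powers\<close>

lemma sum_power_mono_dvd:
  fixes L :: "'v monomial"
  assumes "w \<in> sum_power B k" and "mon_dvd w L"
  shows "w \<in> sum_power {b \<in> B. mon_dvd b L} k"
  using assms
proof (induction k arbitrary: w)
  case (Suc k)
  then obtain s t where st: "w = s + t" "s \<in> B" "t \<in> sum_power B k" by auto
  have "mon_dvd s L" "mon_dvd t L"
    using Suc.prems(2) unfolding st(1) by (auto simp: mon_dvd_def lookup_add intro: add_leD1 add_leD2)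
  thus ?case using st Suc.IH by auto
qed simp

lemma replicate_in_sum_power:
  assumes "b \<in> B"
  shows "mon_of_fun (\<lambda>v. k * Poly_Mapping.lookup b v) \<in> sum_power B k"
proof (induction k)
  case 0
  have "mon_of_fun (\<lambda>v. 0 * Poly_Mapping.lookup b v) = 0" by (rule poly_mapping_eqI) simp
  thus ?case by simp
next
  case (Suc k)
  have "mon_of_fun (\<lambda>v. Suc k * Poly_Mapping.lookup b v) = b + mon_of_fun (\<lambda>v. k * Poly_Mapping.lookup b v)"
    by (rule poly_mapping_eqI) (simp add: lookup_add)
  thus ?case using assms Suc by auto
qed

text \<open>A factor of a generator dividing the product of the two \<open>k\<close>-th powers
  divides it as well, so at each vertex its homomorphism takes a value of \<open>\<phi>\<close> or
  \<open>\<psi>\<close>. For each factor \<open>sep\<close> equates the two exponents, and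
  additivity extends this to the whole generator.\<close>

lemma no_separating_homomorphisms:
  fixes G :: "('n::finite \<times> 'n) set" and H :: "('m::finite \<times> 'm) set"
  defines "B \<equiv> sum_power (whom_mon ` WHom G H)"
  assumes res: "vec_resolution (ideal_gen (mon ` B k) :: ('n \<times> 'm, 'k::field) mpoly set) degs gs"
    and lin: "\<And>j. j \<in> set (degs 1) \<Longrightarrow> j \<le> k * card (UNIV :: 'n set) + 1" and k: "k \<ge> 1"
    and \<phi>: "\<phi> \<in> WHom G H" "\<phi> x \<noteq> l" and \<psi>: "\<psi> \<in> WHom G H" "\<psi> x = l" and xy: "(x, l) \<noteq> (y, l')"
    and sep: "\<And>\<theta>. \<theta> \<in> WHom G H \<Longrightarrow> (\<And>i. \<theta> i = \<phi> i \<or> \<theta> i = \<psi> i) \<Longrightarrow> \<theta> x = l \<longleftrightarrow> \<theta> y = l'"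
  shows False
proof -
  define u where "u = mon_of_fun (\<lambda>v. k * Poly_Mapping.lookup (whom_mon \<phi>) v)"
  define v where "v = mon_of_fun (\<lambda>v. k * Poly_Mapping.lookup (whom_mon \<psi>) v)"
  show False
  proof (rule no_separation_of_linearly_related[OF res _ lin, where p = "(x, l)" and q = "(y, l')" and u = u and v = v and L = "u + v"])
    show "mon_degree b = k * card (UNIV :: 'n set)" if "b \<in> B k" for b
      using that mon_degree_sum_power by (simp add: B_def)
    show "u \<in> B k" "v \<in> B k" using \<phi>(1) \<psi>(1) by (auto simp: B_def u_def v_def intro: replicate_in_sum_power)
    show "mon_dvd u (u + v)" "mon_dvd v (u + v)" by (auto simp: mon_dvd_def lookup_add)
    show "Poly_Mapping.lookup u (x, l) = 0" using \<phi>(2) by (simp add: u_def lookup_whom_mon)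
    show "Poly_Mapping.lookup v (x, l) > 0" using \<psi>(2) k by (simp add: v_def lookup_whom_mon)
    fix w assume w: "w \<in> B k" "mon_dvd w (u + v)"
    have eq: "Poly_Mapping.lookup b (x, l) = Poly_Mapping.lookup b (y, l')"
      if b: "b \<in> {b \<in> whom_mon ` WHom G H. mon_dvd b (u + v)}" for b
    proof -
      from b obtain \<theta> where \<theta>: "b = whom_mon \<theta>" "\<theta> \<in> WHom G H" "mon_dvd (whom_mon \<theta>) (u + v)" by auto
      have "\<theta> i = \<phi> i \<or> \<theta> i = \<psi> i" for i
        using \<theta>(3)[unfolded mon_dvd_def, rule_format, of "(i, \<theta> i)"]
        by (auto simp: lookup_add u_def v_def lookup_whom_mon split: if_splits)
      from sep[OF \<theta>(2) this] show ?thesis by (simp add: \<theta>(1) lookup_whom_mon)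
    qed
    have w': "w \<in> sum_power {b \<in> whom_mon ` WHom G H. mon_dvd b (u + v)} k"
      using w sum_power_mono_dvd by (auto simp: B_def)
    show "Poly_Mapping.lookup w (x, l) = Poly_Mapping.lookup w (y, l')"
    proof (rule antisym)
      show "Poly_Mapping.lookup w (x, l) \<le> Poly_Mapping.lookup w (y, l')"
        by (rule sum_power_additive_le[OF w']) (auto simp: lookup_add eq)
      show "Poly_Mapping.lookup w (y, l') \<le> Poly_Mapping.lookup w (x, l)"
        by (rule sum_power_additive_le[OF w']) (auto simp: lookup_add eq)
    qed
  qed (use xy in auto)
qed

lemma graphs_of_linearly_related:
  fixes G :: "('n::finite \<times> 'n) set" and H :: "('m::finite \<times> 'm) set"
  assumes G: "simple_digraph G" and H: "simple_digraph H" and m: "card (UNIV :: 'm set) \<ge> 2"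
    and res: "vec_resolution (ideal_gen (mon ` sum_power (whom_mon ` WHom G H) k) :: ('n \<times> 'm, 'k::field) mpoly set) degs gs"
    and lin: "\<And>j. j \<in> set (degs 1) \<Longrightarrow> j \<le> k * card (UNIV :: 'n set) + 1" and k: "k \<ge> 1"
  shows "totally_disconnected G \<or> (acyclic G \<and> acyclic H \<and> complete_digraph H)"
proof (cases "G = {}")
  case False
  then obtain x y where xy: "(x, y) \<in> G" by auto
  have G_irrefl: "a \<noteq> b" if "(a, b) \<in> G" for a b using G that by (auto simp: simple_digraph_def irrefl_def)
  have H_asym: "(b, a) \<notin> H" if "(a, b) \<in> H" for a b using H that by (auto simp: simple_digraph_def)
  have const: "(\<lambda>_. a) \<in> WHom G H" for a by (auto simp: WHom_def)
  note no_sep = no_separating_homomorphisms[OF res lin k]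
  have complete: "(j, l) \<in> H \<or> (l, j) \<in> H" if "j \<noteq> l" for j l
  proof (rule ccontr)
    assume *: "\<not> ?thesis"
    \<comment> \<open>Nonadjacent values must coincide on the edge from \<open>x\<close> to
      \<open>y\<close>, so the two constant maps are separated.\<close>
    show False
    proof (rule no_sep)
      show "(\<lambda>_. j) \<in> WHom G H" "(\<lambda>_. l) \<in> WHom G H" by (rule const)+
      show "(x, l) \<noteq> (y, l)" using G_irrefl[OF xy] by simp
      fix \<theta> assume \<theta>: "\<theta> \<in> WHom G H" "\<And>i. \<theta> i = j \<or> \<theta> i = l"
      have "\<theta> x = \<theta> y \<or> (\<theta> x, \<theta> y) \<in> H" using \<theta>(1) xy by (auto simp: WHom_def)
      thus "\<theta> x = l \<longleftrightarrow> \<theta> y = l" using * \<theta>(2)[of x] \<theta>(2)[of y] by auto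
    qed (use that in auto)
  qed
  have "acyclic G"
    unfolding acyclic_def
  proof (intro allI notI)
    fix x0 assume "(x0, x0) \<in> G\<^sup>+"
    then obtain y0 where y0: "(x0, y0) \<in> G" "(y0, x0) \<in> G\<^sup>*" by (metis tranclD)
    \<comment> \<open>Two distinct vertices of \<open>H\<close> exist and are adjacent, so
      \<open>H\<close> has an edge. Along edges of \<open>G\<close> the value \<open>l\<close>
      cannot change back to \<open>j\<close>, so on a cycle it occurs everywhere or nowhere.\<close>
    obtain j0 l0 :: 'm where "j0 \<noteq> l0" using m by (auto simp: card_le_Suc_iff numeral_2_eq_2)
    then obtain j l where jl: "(j, l) \<in> H" using complete by blast
    hence lj: "(l, j) \<notin> H" "j \<noteq> l" using H_asym by auto
    show False
    proof (rule no_sep)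
      show "(\<lambda>_. j) \<in> WHom G H" "(\<lambda>_. l) \<in> WHom G H" by (rule const)+
      show "(x0, l) \<noteq> (y0, l)" using G_irrefl[OF y0(1)] by simp
      fix \<theta> assume \<theta>: "\<theta> \<in> WHom G H" "\<And>i. \<theta> i = j \<or> \<theta> i = l"
      have edge: "\<theta> b = l" if "(a, b) \<in> G" "\<theta> a = l" for a b
      proof -
        have "\<theta> a = \<theta> b \<or> (\<theta> a, \<theta> b) \<in> H" using \<theta>(1) that(1) by (auto simp: WHom_def)
        thus ?thesis using \<theta>(2)[of b] that(2) lj(1) by auto
      qed
      have "\<theta> x0 = l" if "\<theta> y0 = l"
        using y0(2)
      proof (induction rule: rtrancl_induct)
        case (step a b)
        thus ?case using edge by blast
      qed (rule that)
      thus "\<theta> x0 = l \<longleftrightarrow> \<theta> y0 = l" using edge[OF y0(1)] by auto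
    qed (use lj in auto)
  qed
  moreover have no_triangle: False if abc: "(a, b) \<in> H" "(b, c) \<in> H" "(c, a) \<in> H" for a b c
  proof (rule no_sep)
    \<comment> \<open>The vertices reachable from \<open>y\<close> are closed under outgoing edges,
      so sending them to \<open>c\<close> and the rest to \<open>b\<close> gives a homomorphism. A
      mixture with the constant \<open>a\<close> takes at \<open>x\<close> and \<open>y\<close> one
      of the pairs \<open>(b, c)\<close>, \<open>(a, a)\<close>, \<open>(b, a)\<close>,
      \<open>(a, c)\<close>, and the orientation of the triangle rules out the last two.\<close>
    define \<psi> where "\<psi> z = (if (y, z) \<in> G\<^sup>* then c else b)" for z
    have ne: "a \<noteq> b" "b \<noteq> c" "c \<noteq> a" using abc H_asym by auto
    show "(\<lambda>_. a) \<in> WHom G H" by (rule const)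
    show "\<psi> \<in> WHom G H"
      using abc(2) by (auto simp: WHom_def \<psi>_def intro: rtrancl_into_rtrancl)
    have "(y, x) \<notin> G\<^sup>*" using \<open>acyclic G\<close> xy by (metis acyclic_def rtrancl_into_trancl2)
    thus "\<psi> x = b" by (simp add: \<psi>_def)
    show "(x, b) \<noteq> (y, c)" using ne by simp
    show "a \<noteq> b" by (rule ne)
    fix \<theta> assume \<theta>: "\<theta> \<in> WHom G H" "\<And>i. \<theta> i = a \<or> \<theta> i = \<psi> i"
    have "\<psi> y = c" by (simp add: \<psi>_def)
    moreover have "\<theta> x = \<theta> y \<or> (\<theta> x, \<theta> y) \<in> H" using \<theta>(1) xy by (auto simp: WHom_def)
    ultimately show "\<theta> x = b \<longleftrightarrow> \<theta> y = c"
      using \<theta>(2)[of x] \<theta>(2)[of y] \<open>\<psi> x = b\<close> ne abc H_asym by metis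
  qed
  have "trans H"
  proof (rule transI)
    fix a b c assume ab: "(a, b) \<in> H" and bc: "(b, c) \<in> H"
    hence "a \<noteq> c" using H_asym by blast
    thus "(a, c) \<in> H" using complete no_triangle[OF ab bc] by blast
  qed
  hence "acyclic H" using H_asym by (auto simp: acyclic_def trancl_id)
  ultimately show ?thesis using complete by (simp add: complete_digraph_def)
qed (simp add: totally_disconnected_def)

lemma whom_power_nonempty:
  fixes G :: "('n::finite \<times> 'n) set" and H :: "('m::finite \<times> 'm) set"
  shows "sum_power (whom_mon ` WHom G H) k \<noteq> {}"
proof -
  have "(\<lambda>_. undefined) \<in> WHom G H" by (auto simp: WHom_def)
  hence "whom_mon (\<lambda>_. undefined) \<in> whom_mon ` WHom G H" by (rule imageI)
  from replicate_in_sum_power[OF this, where k = k] show ?thesis by auto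
qed

text \<open>An upper bound on the degrees of the first syzygies follows both from a linear
  resolution and from linear relations, so this serves the two conditions at once. As the ideal has
  generators, \<open>d\<close> must be \<open>k\<close> times the number of vertices of
  \<open>G\<close>.\<close>

lemma graphs_of_linear_first_syzygies:
  fixes G :: "('n::finite \<times> 'n) set" and H :: "('m::finite \<times> 'm) set"
    and I :: "('n \<times> 'm, 'k::field) mpoly set"
  defines "I \<equiv> whom_ideal G H"
  assumes G: "simple_digraph G" and H: "simple_digraph H" and m: "card (UNIV :: 'm set) \<ge> 2" and k: "k \<ge> 1"
    and gen: "generated_in_degree (ideal_power I k) d"
    and betti: "\<And>j. betti (ideal_power I k) 1 j \<noteq> 0 \<Longrightarrow> j \<le> d + 1"
  shows "totally_disconnected G \<or> (acyclic G \<and> acyclic H \<and> complete_digraph H)"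
proof -
  define B where "B = sum_power (whom_mon ` WHom G H) k"
  have I: "ideal_power I k = ideal_gen (mon ` B)" by (simp add: I_def whom_ideal_power B_def)
  have deg: "mon_degree b = k * card (UNIV :: 'n set)" if "b \<in> B" for b
    using that by (simp add: B_def mon_degree_sum_power)
  have "mingens (ideal_power I k) = B" unfolding I using deg by (rule mingens_monomial_ideal)
  moreover have "B \<noteq> {}" unfolding B_def by (rule whom_power_nonempty)
  ultimately have d: "d = k * card (UNIV :: 'n set)"
    using gen deg unfolding generated_in_degree_def by auto
  have "finite B" by (simp add: B_def finite_sum_power)
  then obtain degs gs where res: "vec_resolution (ideal_power I k) degs gs"
    and count: "\<And>i j. betti (ideal_power I k) i j = count_list (degs i) j"
    using betti_eq_count[OF _ deg] unfolding I by blast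
  have "j \<le> k * card (UNIV :: 'n set) + 1" if "j \<in> set (degs 1)" for j
    using that betti[of j] by (simp add: count count_list_0_iff d)
  thus ?thesis
    using graphs_of_linearly_related[OF G H m res[unfolded I B_def]] k by blast
qed

theorem theorem3p6:
  fixes G :: "('n::finite \<times> 'n) set"
    and H :: "('m::finite \<times> 'm) set"
    and I :: "('n \<times> 'm, 'k::field) mpoly set"
  defines "I \<equiv> whom_ideal G H"
  assumes "simple_digraph G" and "simple_digraph H" and "card (UNIV :: 'm set) \<ge> 2"
  shows "((\<forall>k\<ge>1. weakly_polymatroidal (ideal_power I k)) \<longleftrightarrow>
           (\<exists>k\<ge>1. weakly_polymatroidal (ideal_power I k))) \<and>
         ((\<exists>k\<ge>1. weakly_polymatroidal (ideal_power I k)) \<longleftrightarrow>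
           (\<exists>k\<ge>1. has_linear_quotients (ideal_power I k))) \<and>
         ((\<exists>k\<ge>1. has_linear_quotients (ideal_power I k)) \<longleftrightarrow>
           (\<exists>k\<ge>1. has_linear_resolution (ideal_power I k))) \<and>
         ((\<exists>k\<ge>1. has_linear_resolution (ideal_power I k)) \<longleftrightarrow>
           (\<exists>k\<ge>1. linearly_related (ideal_power I k))) \<and>
         ((\<exists>k\<ge>1. linearly_related (ideal_power I k)) \<longleftrightarrow>
           totally_disconnected G \<or> (acyclic G \<and> acyclic H \<and> complete_digraph H))"
proof -
  define B where "B = sum_power (whom_mon ` WHom G H)"
  have I: "ideal_power I k = ideal_gen (mon ` B k)" for k by (simp add: I_def whom_ideal_power B_def)
  have fin: "finite (B k)" for k by (simp add: B_def finite_sum_power)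
  have deg: "mon_degree b = k * card (UNIV :: 'n set)" if "b \<in> B k" for b k
    using that by (simp add: B_def mon_degree_sum_power)
  have ne: "B k \<noteq> {}" for k unfolding B_def by (rule whom_power_nonempty)
  let ?graphs = "totally_disconnected G \<or> (acyclic G \<and> acyclic H \<and> complete_digraph H)"
  have wp: "weakly_polymatroidal (ideal_power I k)" if ?graphs for k
    unfolding I_def by (rule whom_ideal_power_weakly_polymatroidal[OF that])
  have lq: "has_linear_quotients (ideal_power I k)" if "weakly_polymatroidal (ideal_power I k)" for k
    using weakly_polymatroidal_imp_linear_quotients[OF fin deg] that unfolding I by blast
  have lr: "has_linear_resolution (ideal_power I k)" "linearly_related (ideal_power I k)"
    if "has_linear_quotients (ideal_power I k)" for k
    using linear_quotients_imp_linear_resolution[OF fin deg ne] that unfolding I by blast+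
  have graphs: ?graphs if k: "k \<ge> 1" and "has_linear_resolution (ideal_power I k) \<or> linearly_related (ideal_power I k)" for k
    using that(2)
  proof
    assume "has_linear_resolution (ideal_power I k)"
    then obtain d where d: "generated_in_degree (ideal_power I k) d" "regularity (ideal_power I k) = ereal (real d)"
      by (auto simp: has_linear_resolution_def)
    have "j \<le> d + 1" if "betti (ideal_power I k) 1 j \<noteq> 0" for j
    proof -
      have "ereal (real j - real 1) \<le> regularity (ideal_power I k)"
        unfolding regularity_def using that by (intro Sup_upper) blast
      thus ?thesis using d(2) by simp
    qed
    thus ?thesis using graphs_of_linear_first_syzygies[OF assms(2-4) k] d(1) unfolding I_def by blast
  next
    assume "linearly_related (ideal_power I k)"
    then obtain d where d: "generated_in_degree (ideal_power I k) d" "\<forall>j. j \<noteq> d + 1 \<longrightarrow> betti (ideal_power I k) 1 j = 0"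
      by (auto simp: linearly_related_def)
    have "j \<le> d + 1" if "betti (ideal_power I k) 1 j \<noteq> 0" for j
      using that d(2) by (metis order_refl)
    thus ?thesis using graphs_of_linear_first_syzygies[OF assms(2-4) k] d(1) unfolding I_def by blast
  qed
  \<comment> \<open>The weakest conditions, for a single \<open>k\<close>, give the graph condition,
    which gives the strongest one for all \<open>k\<close>.\<close>
  show ?thesis using wp lq lr graphs by (meson order_refl)
qed

end
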